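(* There exists an affine system $(K,S)$ which has a unique periodic point (this point being a fixed point) and zero topological entropy (in particular $(K,S)$ has mean dimension $0$, and for every $n\geq1$ the set of points $x\in K$ with $S^nx=x$ has topological dimension $0$), and which does not embed affinely in $(([0,1]^k)^{\mathbb Z},\sigma)$ for any $k\geq1$.
   Context: An affine system is a pair $(K,S)$ where $K$ is a compact metrizable (Choquet) simplex and $S:K\to K$ is an affine homeomorphism. For $k\ge1$, $\sigma$ denotes the shift on $([0,1]^k)^{\mathbb Z}$, $(\sigma x)_n=x_{n+1}$. The system $(K,S)$ embeds affinely in $(([0,1]^k)^{\mathbb Z},\sigma)$ if there is a continuous injective affine map $\phi:K\to([0,1]^k)^{\mathbb Z}$ with $\phi\circ S=\sigma\circ\phi$. Mean dimension is the topological mean dimension (Gromov, Lindenstrauss–Weiss), and topological dimension is Lebesgue covering dimension. *)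

theory Defs
  imports "HOL-Analysis.Analysis" "HOL-Probability.Probability"
begin

text \<open>A Borel probability measure \<open>M\<close> on the ambient space represents \<open>x\<close> if \<open>x\<close> is the
  barycenter of \<open>M\<close>. It is used only for measures concentrated on a compact set, where every bounded
  linear functional is integrable.\<close>

definition represents_point :: "'a::real_normed_vector measure \<Rightarrow> 'a \<Rightarrow> bool" where
  "represents_point M x \<longleftrightarrow>
     prob_space M \<and> sets M = sets borel \<and>
     (\<forall>f :: 'a \<Rightarrow> real. bounded_linear f \<longrightarrow> (\<integral>y. f y \<partial>M) = f x)"

text \<open>Since \<open>K\<close> is metrizable, its set of extreme points is a \<open>G\<^sub>\<delta>\<close>, hence Borel, so that
  ``concentrated on the extreme points'' can be expressed by \<open>emeasure\<close>. (For a nonmeasurable set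
  \<open>emeasure\<close> would be 0 and the condition would fail.)\<close>

text \<open>Working in a normed space loses no generality: a compact metrizable convex subset of a Hausdorff
  locally convex space is mapped affinely and homeomorphically onto a norm-compact convex set of
  bounded sequences by \<open>x \<mapsto> (f\<^sub>n x / 2\<^sup>n)\<^sub>n\<close>, where the \<open>f\<^sub>n\<close> are continuous linear functionals that
  separate its points and are bounded by 1 on it.\<close>

definition choquet_simplex :: "'a::real_normed_vector set \<Rightarrow> bool" where
  "choquet_simplex K \<longleftrightarrow>
     K \<noteq> {} \<and> compact K \<and> convex K \<and>
     (\<forall>x\<in>K. \<exists>!M. represents_point M x \<and> emeasure M {e. e extreme_point_of K} = 1)"

definition affine_map_on :: "'a::real_vector set \<Rightarrow> ('a \<Rightarrow> 'b::real_vector) \<Rightarrow> bool" where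
  "affine_map_on K f \<longleftrightarrow>
     (\<forall>x\<in>K. \<forall>y\<in>K. \<forall>t\<in>{0..1}.
        f ((1 - t) *\<^sub>R x + t *\<^sub>R y) = (1 - t) *\<^sub>R f x + t *\<^sub>R f y)"

definition affine_system :: "'a::real_normed_vector set \<Rightarrow> ('a \<Rightarrow> 'a) \<Rightarrow> bool" where
  "affine_system K S \<longleftrightarrow>
     choquet_simplex K \<and> affine_map_on K S \<and> (\<exists>S'. homeomorphism K K S S')"

text \<open>The space \<open>([0,1]\<^sup>k)\<^sup>\<int>\<close>: a point is a function \<open>x\<close> with \<open>x n i\<close> the \<open>i\<close>-th coordinate
  (\<open>i < k\<close>) of its \<open>n\<close>-th entry; by definition of the product topology, \<open>x n\<close> takes the
  value \<open>undefined\<close> at every \<open>i \<ge> k\<close>.\<close>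

definition cube_shift_space :: "nat \<Rightarrow> (int \<Rightarrow> nat \<Rightarrow> real) topology" where
  "cube_shift_space k =
     product_topology (\<lambda>n. product_topology (\<lambda>i. top_of_set {0..1}) {..<k}) UNIV"

definition shift :: "(int \<Rightarrow> 'b) \<Rightarrow> int \<Rightarrow> 'b" where
  "shift x = (\<lambda>n. x (n + 1))"

definition embeds_affinely :: "'a::real_normed_vector set \<Rightarrow> ('a \<Rightarrow> 'a) \<Rightarrow> nat \<Rightarrow> bool" where
  "embeds_affinely K S k \<longleftrightarrow>
     (\<exists>\<phi>. continuous_map (top_of_set K) (cube_shift_space k) \<phi> \<and>
          inj_on \<phi> K \<and>
          (\<forall>n. \<forall>i<k. affine_map_on K (\<lambda>x. \<phi> x n i)) \<and>
          (\<forall>x\<in>K. \<phi> (S x) = shift (\<phi> x)))"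

definition finite_open_covers :: "'a topology \<Rightarrow> 'a set set set" where
  "finite_open_covers X = {\<U>. finite \<U> \<and> (\<forall>U\<in>\<U>. openin X U) \<and> \<Union>\<U> = topspace X}"

definition refines_cover :: "'a set set \<Rightarrow> 'a set set \<Rightarrow> bool" where
  "refines_cover \<V> \<U> \<longleftrightarrow> (\<forall>V\<in>\<V>. \<exists>U\<in>\<U>. V \<subseteq> U)"

definition cover_ord :: "'a topology \<Rightarrow> 'a set set \<Rightarrow> nat" where
  "cover_ord X \<V> = (SUP x\<in>topspace X. card {V\<in>\<V>. x \<in> V}) - 1"

definition cover_dim :: "'a topology \<Rightarrow> 'a set set \<Rightarrow> nat" where
  "cover_dim X \<U> = (INF \<V>\<in>{\<V>\<in>finite_open_covers X. refines_cover \<V> \<U>}. cover_ord X \<V>)"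

text \<open>Lebesgue covering dimension, with the convention that the empty space has dimension \<open>-1\<close>.\<close>

definition covering_dim :: "'a topology \<Rightarrow> ereal" where
  "covering_dim X =
     (if topspace X = {} then -1
      else (SUP \<U>\<in>finite_open_covers X. ereal (real (cover_dim X \<U>))))"

text \<open>The iterated join \<open>\<U> \<or> T\<^sup>-\<^sup>1\<U> \<or> \<dots> \<or> T\<^sup>-\<^sup>(\<^sup>n\<^sup>-\<^sup>1\<^sup>)\<U>\<close>.\<close>

definition iterated_join :: "'a topology \<Rightarrow> ('a \<Rightarrow> 'a) \<Rightarrow> 'a set set \<Rightarrow> nat \<Rightarrow> 'a set set" where
  "iterated_join X T \<U> n =
     {{x\<in>topspace X. \<forall>i<n. (T ^^ i) x \<in> A i} | A. \<forall>i<n. A i \<in> \<U>}"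

text \<open>For a continuous self-map of a compact space, both limits below exist by subadditivity of
  \<open>cover_dim\<close> and of \<open>ln (min_subcover_card \<dots>)\<close> along the iterated joins.\<close>

definition mean_dim :: "'a topology \<Rightarrow> ('a \<Rightarrow> 'a) \<Rightarrow> ereal" where
  "mean_dim X T =
     (SUP \<U>\<in>finite_open_covers X.
        lim (\<lambda>n. ereal (real (cover_dim X (iterated_join X T \<U> n)) / real n)))"

definition min_subcover_card :: "'a topology \<Rightarrow> 'a set set \<Rightarrow> nat" where
  "min_subcover_card X \<U> = (INF \<V>\<in>{\<V>. \<V> \<subseteq> \<U> \<and> finite \<V> \<and> \<Union>\<V> = topspace X}. card \<V>)"

definition topological_entropy :: "'a topology \<Rightarrow> ('a \<Rightarrow> 'a) \<Rightarrow> ereal" where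
  "topological_entropy X T =
     (SUP \<U>\<in>finite_open_covers X.
        lim (\<lambda>n. ereal (ln (real (min_subcover_card X (iterated_join X T \<U> n))) / real n)))"

end

theory Submission
  imports Defs "HOL-Real_Asymp.Real_Asymp"
begin

text \<open>The simplex is the set of Borel probability measures on the torus \<open>\<bbbT>\<^sup>2\<close>, realized by sequences of
  weighted Fourier coefficients, and the homeomorphism is the push-forward by the skew product
  \<open>(z, w) \<mapsto> (\<rho> z, z w)\<close> with \<open>\<rho>\<close> of modulus one and not a root of unity. A measure that is invariant
  under a power of the skew product has vanishing Fourier coefficients, so Haar measure is the only
  periodic point. The orbit of a point up to time \<open>n\<close> is described with fixed precision by
  polynomially many cells, and a measure is approximated on \<open>n\<close> iterates of finitely many functions
  by the average of \<open>O(log n)\<close> point masses. Hence the covering numbers of the simplex in the Bowen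
  metrics grow subexponentially, which gives entropy zero; choosing thresholds for each time
  separately so that every orbit is rarely close to them, it also gives mean dimension zero.

  The obstruction to an embedding is the infinite multiplicity of the Lebesgue spectrum: for each
  \<open>B\<close> the functions \<open>z\<^sup>j w\<^sup>B\<close> with \<open>j < B\<close> have orthonormal, mutually orthogonal orbits in \<open>L\<^sup>2\<close>. If
  \<open>B\<close> is large compared to \<open>k\<close>, then counting dimensions yields a density with a large coefficient
  that is invisible to \<open>k\<close> given affine functions along a long piece of the orbit, and a
  compactness argument yields two distinct measures that are not separated at any time.\<close>

section \<open>Entropy and subexponential covers\<close>

text \<open>Scaling is the obstacle to the final compactness argument. A perturbation of Haar
  measure in the invisible direction is a positive density only after division by the size of its
  coefficients, which may grow with the orbit piece, so the perturbed measures could merge in the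
  limit. Instead the positive and negative parts of the direction, padded by a common constant, are
  taken as densities: they differ by the unscaled direction, and its second moment controls their
  mass. Two convex combinations with the same density carry the invisibility over from the small
  perturbations, so the affine functions are evaluated at densities only. The large coefficient may
  sit anywhere in the time window; moving it to time 0 lets coordinates that depend on
  \<open>k\<close> alone detect it. Entropy and mean dimension both rest on cells that are small in
  the Bowen metrics but not open. An open cover of low order is pulled back from a triangulation
  along distance functions flattened by staircases: order is paid only where a value lies on a
  rising part of a staircase.\<close>

definition subexponential_covers :: "'a::metric_space set \<Rightarrow> ('a \<Rightarrow> 'a) \<Rightarrow> bool" where
  "subexponential_covers K S \<longleftrightarrow>
     (\<forall>\<delta>>0. \<forall>\<eta>>0::real. \<forall>\<^sub>F n in sequentially. \<exists>\<C>. finite \<C> \<and> real (card \<C>) \<le> exp (\<eta> * real n) \<and>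
        K \<subseteq> \<Union>\<C> \<and> (\<forall>D\<in>\<C>. \<forall>x\<in>D. \<forall>y\<in>D. \<forall>i<n. dist ((S ^^ i) x) ((S ^^ i) y) < \<delta>))"

lemma funpow_in:
  assumes "S \<in> K \<rightarrow> K" "x \<in> K" shows "(S ^^ i) x \<in> K"
  using assms by (induction i) auto

lemma finite_iterated_join:
  assumes "finite \<U>" shows "finite (iterated_join X T \<U> n)"
proof -
  have "iterated_join X T \<U> n \<subseteq> (\<lambda>A. {x\<in>topspace X. \<forall>i<n. (T ^^ i) x \<in> A i}) ` (PiE {..<n} (\<lambda>_. \<U>))"
  proof
    fix B assume "B \<in> iterated_join X T \<U> n"
    then obtain A where A: "B = {x\<in>topspace X. \<forall>i<n. (T ^^ i) x \<in> A i}" "\<forall>i<n. A i \<in> \<U>"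
      unfolding iterated_join_def by blast
    then have "B = {x\<in>topspace X. \<forall>i<n. (T ^^ i) x \<in> restrict A {..<n} i}"
      "restrict A {..<n} \<in> PiE {..<n} (\<lambda>_. \<U>)" by auto
    then show "B \<in> (\<lambda>A. {x\<in>topspace X. \<forall>i<n. (T ^^ i) x \<in> A i}) ` (PiE {..<n} (\<lambda>_. \<U>))" by blast
  qed
  moreover have "finite (PiE {..<n} (\<lambda>_. \<U>))" using assms by (intro finite_PiE) auto
  ultimately show ?thesis by (meson finite_surj)
qed

lemma open_cover_Lebesgue:
  assumes K: "compact K" and U: "\<U> \<in> finite_open_covers (top_of_set K)"
  obtains \<delta> where "\<delta> > 0" "\<And>x. x \<in> K \<Longrightarrow> \<exists>U\<in>\<U>. ball x \<delta> \<inter> K \<subseteq> U"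
proof -
  have "\<exists>G. open G \<and> U = K \<inter> G" if "U \<in> \<U>" for U
    using U that unfolding finite_open_covers_def by (auto simp: openin_open)
  then obtain G where G: "\<And>U. U \<in> \<U> \<Longrightarrow> open (G U) \<and> U = K \<inter> G U" by metis
  have "K \<subseteq> \<Union>(G ` \<U>)" using U G unfolding finite_open_covers_def by auto
  then obtain \<delta> where d: "\<delta> > 0" "\<And>x. x \<in> K \<Longrightarrow> \<exists>H\<in>G ` \<U>. ball x \<delta> \<subseteq> H"
    using Heine_Borel_lemma[OF K, of "G ` \<U>"] G by (metis (no_types, lifting) imageE)
  show thesis
  proof (rule that[OF d(1)])
    fix x assume "x \<in> K"
    then obtain U where "U \<in> \<U>" "ball x \<delta> \<subseteq> G U" using d(2) by blast
    then show "\<exists>U\<in>\<U>. ball x \<delta> \<inter> K \<subseteq> U" using G by blast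
  qed
qed

text \<open>For a Lebesgue number \<delta> a cover member around \<open>(S ^^ i) x\<close> is chosen
  separately for each \<open>i\<close>, and the choices together name one member of the
  join.\<close>

lemma small_subset_iterated_join:
  assumes S: "S \<in> K \<rightarrow> K" and L: "\<And>x. x \<in> K \<Longrightarrow> \<exists>U\<in>\<U>. ball x \<delta> \<inter> K \<subseteq> U"
    and x: "x \<in> K" and D: "\<And>y. y \<in> D \<Longrightarrow> y \<in> K \<and> (\<forall>i<n. dist ((S ^^ i) x) ((S ^^ i) y) < \<delta>)"
  obtains V where "V \<in> iterated_join (top_of_set K) S \<U> n" "D \<subseteq> V"
proof -
  have "\<exists>U\<in>\<U>. ball ((S ^^ i) x) \<delta> \<inter> K \<subseteq> U" for i
    using L funpow_in[OF S x] by blast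
  then obtain A where A: "\<And>i. A i \<in> \<U>" "\<And>i. ball ((S ^^ i) x) \<delta> \<inter> K \<subseteq> A i" by metis
  show thesis
  proof (rule that)
    show "{x\<in>topspace (top_of_set K). \<forall>i<n. (S ^^ i) x \<in> A i} \<in> iterated_join (top_of_set K) S \<U> n"
      unfolding iterated_join_def using A by auto
    show "D \<subseteq> {x\<in>topspace (top_of_set K). \<forall>i<n. (S ^^ i) x \<in> A i}"
      using D A(2) funpow_in[OF S] by fastforce
  qed
qed

lemma Union_iterated_join:
  assumes S: "S \<in> K \<rightarrow> K" and U: "\<Union>\<U> = K"
  shows "\<Union>(iterated_join (top_of_set K) S \<U> n) = K"
proof
  show "\<Union>(iterated_join (top_of_set K) S \<U> n) \<subseteq> K" unfolding iterated_join_def by auto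
  show "K \<subseteq> \<Union>(iterated_join (top_of_set K) S \<U> n)"
  proof
    fix x assume x: "x \<in> K"
    have "\<exists>U\<in>\<U>. (S ^^ i) x \<in> U" for i using funpow_in[OF S x] U by blast
    then obtain A where "\<And>i. A i \<in> \<U>" "\<And>i. (S ^^ i) x \<in> A i" by metis
    then show "x \<in> \<Union>(iterated_join (top_of_set K) S \<U> n)"
      unfolding iterated_join_def using x by auto
  qed
qed

text \<open>Keeps the logarithm in the entropy nonnegative, so that an upper bound on the subcovers
  determines the limit.\<close>

lemma min_subcover_card_ge_1:
  assumes "finite \<U>" "\<Union>\<U> = topspace X" "topspace X \<noteq> {}"
  shows "min_subcover_card X \<U> \<ge> 1"
proof -
  have "min_subcover_card X \<U> \<in> card ` {\<V>. \<V> \<subseteq> \<U> \<and> finite \<V> \<and> \<Union>\<V> = topspace X}"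
    unfolding min_subcover_card_def by (rule Inf_nat_def1) (use assms in blast)
  then obtain \<V> where "min_subcover_card X \<U> = card \<V>" "finite \<V>" "\<Union>\<V> = topspace X" by blast
  moreover have "\<V> \<noteq> {}" using calculation assms(3) by (metis Union_empty)
  ultimately show ?thesis by (simp add: Suc_le_eq card_gt_0_iff)
qed

lemma topological_entropy_eq_0:
  assumes K: "compact K" "K \<noteq> {}" and S: "S \<in> K \<rightarrow> K" and sub: "subexponential_covers K S"
  shows "topological_entropy (top_of_set K) S = 0"
proof -
  have lim0: "lim (\<lambda>n. ereal (ln (real (min_subcover_card (top_of_set K) (iterated_join (top_of_set K) S \<U> n))) / real n)) = 0"
    if U: "\<U> \<in> finite_open_covers (top_of_set K)" for \<U>
  proof -
    obtain \<delta> where d: "\<delta> > 0" and L: "\<And>x. x \<in> K \<Longrightarrow> \<exists>U\<in>\<U>. ball x \<delta> \<inter> K \<subseteq> U"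
      using open_cover_Lebesgue[OF K(1) U] by blast
    define m where "m n = min_subcover_card (top_of_set K) (iterated_join (top_of_set K) S \<U> n)" for n
    have UU: "finite \<U>" "\<Union>\<U> = K" using U unfolding finite_open_covers_def by auto
    have m1: "m n \<ge> 1" for n
      unfolding m_def by (rule min_subcover_card_ge_1) (use UU K S in \<open>auto simp: finite_iterated_join Union_iterated_join\<close>)
    have "(\<lambda>n. ln (real (m n)) / real n) \<longlonglongrightarrow> 0"
    proof (rule LIMSEQ_I)
      fix r :: real assume r: "r > 0"
      obtain n0 where n0: "\<And>n. n \<ge> n0 \<Longrightarrow> \<exists>\<C>. finite \<C> \<and> real (card \<C>) \<le> exp (r/2 * real n) \<and>
              K \<subseteq> \<Union>\<C> \<and> (\<forall>D\<in>\<C>. \<forall>x\<in>D. \<forall>y\<in>D. \<forall>i<n. dist ((S ^^ i) x) ((S ^^ i) y) < \<delta>)"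
        using sub[unfolded subexponential_covers_def, rule_format, OF d, of "r/2"] r
        by (auto simp: eventually_sequentially)
      show "\<exists>no. \<forall>n\<ge>no. norm (ln (real (m n)) / real n - 0) < r"
      proof (intro exI allI impI)
          fix n :: nat assume "max 1 n0 \<le> n"
          then have n: "0 < n" "n \<ge> n0" by auto
          obtain \<C> where C: "finite \<C>" "real (card \<C>) \<le> exp (r/2 * real n)" "K \<subseteq> \<Union>\<C>"
            "\<And>D x y i. D \<in> \<C> \<Longrightarrow> x \<in> D \<Longrightarrow> y \<in> D \<Longrightarrow> i < n \<Longrightarrow> dist ((S ^^ i) x) ((S ^^ i) y) < \<delta>" using n0[OF n(2)] by metis
          let ?J = "iterated_join (top_of_set K) S \<U> n"
          have "\<exists>V\<in>?J. D \<inter> K \<subseteq> V" if "D \<in> \<C>" "D \<inter> K \<noteq> {}" for D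
          proof -
            obtain x where x: "x \<in> D" "x \<in> K" using \<open>D \<inter> K \<noteq> {}\<close> by blast
            obtain V where "V \<in> ?J" "D \<inter> K \<subseteq> V"
              using small_subset_iterated_join[OF S L x(2), of "D \<inter> K" n] C(4)[OF \<open>D \<in> \<C>\<close> x(1)] by auto
            then show ?thesis by blast
          qed
          then obtain V where V: "\<And>D. D \<in> \<C> \<Longrightarrow> D \<inter> K \<noteq> {} \<Longrightarrow> V D \<in> ?J \<and> D \<inter> K \<subseteq> V D" by metis
          let ?V = "V ` {D\<in>\<C>. D \<inter> K \<noteq> {}}"
          have sub: "?V \<subseteq> ?J" using V by blast
          have "K \<subseteq> \<Union>?V" using C(3) V by blast
          moreover have "\<Union>?V \<subseteq> K" using sub Union_iterated_join[OF S UU(2), of n] by blast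
          ultimately have "m n \<le> card ?V"
            unfolding m_def min_subcover_card_def
            by (intro cInf_lower imageI) (use sub C(1) in auto)
          also have "\<dots> \<le> card {D\<in>\<C>. D \<inter> K \<noteq> {}}" by (rule card_image_le) (use C(1) in auto)
          also have "\<dots> \<le> card \<C>" by (rule card_mono) (use C(1) in auto)
          finally have "real (m n) \<le> exp (r/2 * real n)" using C(2) by linarith
          then have "ln (real (m n)) \<le> ln (exp (r/2 * real n))"
            using m1[of n] by (intro ln_mono) auto
          then have "ln (real (m n)) \<le> r/2 * n" by simp
          moreover have "ln (real (m n)) \<ge> 0" using m1[of n] by simp
          ultimately have "ln (real (m n)) / real n \<ge> 0" "ln (real (m n)) / real n \<le> r/2"
            using n by (auto simp: divide_le_eq)
          then show "norm (ln (real (m n)) / real n - 0) < r" using r unfolding diff_zero real_norm_def by linarith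
      qed
    qed
    then have "(\<lambda>n. ereal (ln (real (m n)) / real n)) \<longlonglongrightarrow> ereal 0" by (simp only: lim_ereal)
    then show ?thesis unfolding m_def by (metis limI zero_ereal_def)
  qed
  have "{K} \<in> finite_open_covers (top_of_set K)" unfolding finite_open_covers_def by auto
  then have "finite_open_covers (top_of_set K) \<noteq> {}" by blast
  then show ?thesis unfolding topological_entropy_def using lim0 by simp
qed

section \<open>Mean dimension and subexponential covers\<close>

text \<open>First moment method. For independent uniform thresholds in \<open>{..<L}\<close>, each
  coordinate multiplies the expectation of \<open>L\<close> to the number of bad coordinates by at
  most (3 L + L) / L = 4. Summing over \<open>\<C>\<close> bounds the average over \<theta>, hence
  some \<theta>. As \<open>L\<close> is the base of the power, a large \<open>L\<close> makes bad
  coordinates rare.\<close>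

lemma exists_sparse_thresholds:
  fixes bad :: "'d \<Rightarrow> 'i \<Rightarrow> nat set"
  assumes I: "finite I" and C: "finite \<C>" and L: "L \<ge> 1"
    and bad: "\<And>D a. D \<in> \<C> \<Longrightarrow> a \<in> I \<Longrightarrow> card (bad D a \<inter> {..<L}) \<le> 3"
  obtains \<theta> where "\<And>a. a \<in> I \<Longrightarrow> \<theta> a < L"
    "\<And>D. D \<in> \<C> \<Longrightarrow> real L ^ card {a\<in>I. \<theta> a \<in> bad D a} \<le> real (card \<C>) * 4 ^ card I"
proof -
  let ?\<Theta> = "PiE I (\<lambda>_. {..<L})"
  define w where "w D \<theta> = real L ^ card {a\<in>I. \<theta> a \<in> bad D a}" for D \<theta>
  have w_prod: "w D \<theta> = (\<Prod>a\<in>I. if \<theta> a \<in> bad D a then real L else 1)" for D \<theta>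
    unfolding w_def using I by (simp add: prod.If_cases Int_def)
  have col: "(\<Sum>t<L. if t \<in> bad D a then real L else 1) \<le> 4 * real L" if "D \<in> \<C>" "a \<in> I" for D a
  proof -
    have "(\<Sum>t<L. if t \<in> bad D a then real L else 1) \<le> (\<Sum>t<L. (if t \<in> bad D a then real L else 0) + 1)"
      by (rule sum_mono) auto
    also have "\<dots> = real L * card (bad D a \<inter> {..<L}) + L"
      by (simp add: sum.distrib sum.If_cases Int_def conj_commute)
    also have "\<dots> \<le> real L * 3 + L"
      using bad[OF that] by (intro add_mono mult_left_mono) auto
    finally show ?thesis by simp
  qed
  have "(\<Sum>\<theta>\<in>?\<Theta>. \<Sum>D\<in>\<C>. w D \<theta>) = (\<Sum>D\<in>\<C>. \<Sum>\<theta>\<in>?\<Theta>. w D \<theta>)" by (rule sum.swap)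
  also have "\<dots> = (\<Sum>D\<in>\<C>. \<Prod>a\<in>I. \<Sum>t<L. if t \<in> bad D a then real L else 1)"
    unfolding w_prod using I by (intro sum.cong refl prod_sum_PiE[symmetric]) auto
  also have "\<dots> \<le> (\<Sum>D\<in>\<C>. \<Prod>a\<in>I. 4 * real L)"
    using col by (intro sum_mono prod_mono conjI sum_nonneg) auto
  also have "\<dots> = (\<Sum>\<theta>\<in>?\<Theta>. real (card \<C>) * 4 ^ card I)"
    using I by (simp add: power_mult_distrib card_PiE)
  finally have "(\<Sum>\<theta>\<in>?\<Theta>. \<Sum>D\<in>\<C>. w D \<theta>) \<le> (\<Sum>\<theta>\<in>?\<Theta>. real (card \<C>) * 4 ^ card I)" .
  moreover have "finite ?\<Theta>" using I by (intro finite_PiE) auto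
  moreover have "?\<Theta> \<noteq> {}" using L by (auto simp: PiE_eq_empty_iff lessThan_empty_iff)
  ultimately obtain \<theta> where th: "\<theta> \<in> ?\<Theta>" "(\<Sum>D\<in>\<C>. w D \<theta>) \<le> real (card \<C>) * 4 ^ card I"
    using sum_strict_mono[of ?\<Theta> "\<lambda>_. real (card \<C>) * 4 ^ card I" "\<lambda>\<theta>. \<Sum>D\<in>\<C>. w D \<theta>"]
    by (meson linorder_not_less)
  show thesis
  proof (rule that[of \<theta>])
    show "\<theta> a < L" if "a \<in> I" for a using th(1) that by auto
    fix D assume "D \<in> \<C>"
    then have "w D \<theta> \<le> (\<Sum>D\<in>\<C>. w D \<theta>)"
      using C by (intro member_le_sum) (auto simp: w_def)
    then show "real L ^ card {a\<in>I. \<theta> a \<in> bad D a} \<le> real (card \<C>) * 4 ^ card I"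
      using th(2) unfolding w_def by linarith
  qed
qed

text \<open>The open star of the vertex \<open>v\<close> in the Freudenthal triangulation of \<open>\<real>\<^sup>I\<close>. A point lies in
  the stars of the vertices of its carrier simplex, whose dimension is at most the number of its
  nonintegral coordinates.\<close>

definition freudenthal_star :: "'i set \<Rightarrow> ('i \<Rightarrow> int) \<Rightarrow> ('i \<Rightarrow> real) \<Rightarrow> bool" where
  "freudenthal_star I v y \<longleftrightarrow> (\<forall>a\<in>I. \<forall>b\<in>I. y a - v a < 1 \<and> v a - y a < 1 \<and> (y a - v a) + (v b - y b) < 1)"

lemma freudenthal_star_floor: "freudenthal_star I (\<lambda>a. \<lfloor>y a\<rfloor>) y"
  unfolding freudenthal_star_def
proof (intro ballI conjI)
  fix a b
  have "y a < \<lfloor>y a\<rfloor> + 1" "\<lfloor>y b\<rfloor> \<le> y b" "\<lfloor>y a\<rfloor> \<le> y a" by linarith+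
  then show "y a - \<lfloor>y a\<rfloor> < 1" "\<lfloor>y a\<rfloor> - y a < 1" "(y a - \<lfloor>y a\<rfloor>) + (\<lfloor>y b\<rfloor> - y b) < 1" by linarith+
qed

text \<open>The vertices have entries \<open>\<lfloor>y a\<rfloor>\<close> or
  \<open>\<lfloor>y a\<rfloor> + 1\<close>, the latter only where \<open>y a\<close> is not an
  integer. Any two are comparable: opposite strict differences at \<open>a\<close> and
  \<open>b\<close> would make two numbers below 1 add up to 2. So the vertices form a chain, on
  which the height \<open>h\<close> is injective and bounded by the number of nonintegral
  coordinates.\<close>

lemma card_freudenthal_star_le:
  fixes y :: "'i \<Rightarrow> real"
  assumes I: "finite I"
  defines "V \<equiv> {v \<in> extensional I. freudenthal_star I v y}"
  shows "finite V" "card V \<le> 1 + card {a\<in>I. y a \<notin> \<int>}"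
proof -
  let ?N = "{a\<in>I. y a \<notin> \<int>}"
  define h where "h v = (\<Sum>a\<in>I. nat (v a - \<lfloor>y a\<rfloor>))" for v :: "'i \<Rightarrow> int"
  have V01: "v a = \<lfloor>y a\<rfloor> \<or> v a = \<lfloor>y a\<rfloor> + 1 \<and> y a \<notin> \<int>" if "v \<in> V" "a \<in> I" for v a
  proof -
    have *: "y a - v a < 1" "v a - y a < 1" using that unfolding V_def freudenthal_star_def by auto
    then have "v a = \<lfloor>y a\<rfloor> \<or> v a = \<lfloor>y a\<rfloor> + 1" by linarith
    moreover have "v a \<noteq> \<lfloor>y a\<rfloor> + 1" if "y a \<in> \<int>"
      using * that by (auto elim!: Ints_cases)
    ultimately show ?thesis by blast
  qed
  have le: "h v \<le> card ?N" if "v \<in> V" for v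
  proof -
    have "h v \<le> (\<Sum>a\<in>I. if y a \<notin> \<int> then 1 else 0)"
      unfolding h_def using V01[OF that] by (intro sum_mono) force
    also have "\<dots> = card ?N" using I by (simp add: sum.If_cases Int_def)
    finally show ?thesis .
  qed
  have inj: "inj_on h V"
  proof (rule inj_onI)
    fix v w assume vw: "v \<in> V" "w \<in> V" "h v = h w"
    have cmp: "(\<forall>a\<in>I. v a \<le> w a) \<or> (\<forall>a\<in>I. w a \<le> v a)"
    proof (rule ccontr)
      assume "\<not> ?thesis"
      then obtain a b where ab: "a \<in> I" "b \<in> I" "v a > w a" "w b > v b" by force
      then have "v a = \<lfloor>y a\<rfloor> + 1" "w a = \<lfloor>y a\<rfloor>" "w b = \<lfloor>y b\<rfloor> + 1" "v b = \<lfloor>y b\<rfloor>"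
        using V01[OF vw(1)] V01[OF vw(2)] by force+
      moreover have "(y b - v b) + (v a - y a) < 1" "(y a - w a) + (w b - y b) < 1"
        using vw ab unfolding V_def freudenthal_star_def by auto
      ultimately show False by simp
    qed
    have eq: "v a = w a" if "a \<in> I" for a
    proof -
      have ge: "v a \<ge> \<lfloor>y a\<rfloor>" "w a \<ge> \<lfloor>y a\<rfloor>" if "a \<in> I" for a
        using V01[OF vw(1) that] V01[OF vw(2) that] by auto
      have "nat (v a - \<lfloor>y a\<rfloor>) = nat (w a - \<lfloor>y a\<rfloor>)"
        using cmp
      proof
        assume *: "\<forall>a\<in>I. v a \<le> w a"
        show ?thesis
          using sum_mono_inv[of "\<lambda>a. nat (v a - \<lfloor>y a\<rfloor>)" I "\<lambda>a. nat (w a - \<lfloor>y a\<rfloor>)"] vw(3) * I that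
          unfolding h_def by (simp add: nat_mono)
      next
        assume *: "\<forall>a\<in>I. w a \<le> v a"
        show ?thesis
          using sum_mono_inv[of "\<lambda>a. nat (w a - \<lfloor>y a\<rfloor>)" I "\<lambda>a. nat (v a - \<lfloor>y a\<rfloor>)"] vw(3) * I that
          unfolding h_def by (simp add: nat_mono)
      qed
      then show ?thesis using ge[OF that] by linarith
    qed
    show "v = w"
      using vw(1,2) eq unfolding V_def by (auto intro!: extensionalityI)
  qed
  have sub: "h ` V \<subseteq> {..card ?N}" using le by auto
  then show "finite V" using inj finite_imageD finite_subset by blast
  have "card V = card (h ` V)" using inj by (simp add: card_image)
  also have "\<dots> \<le> card {..card ?N}" using sub by (intro card_mono) auto
  finally show "card V \<le> 1 + card ?N" by simp
qed

text \<open>Continuous, and constant outside the intervals \<open>(m, m + 1/L)\<close>, \<open>m \<in> \<int>\<close>.\<close>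

definition staircase :: "nat \<Rightarrow> real \<Rightarrow> real" where
  "staircase L u = \<lfloor>u\<rfloor> + min 1 (L * frac u)"

lemma isCont_staircase:
  assumes L: "L \<ge> 1" shows "isCont (staircase L) u"
proof -
  define m where "m = \<lfloor>u\<rfloor>"
  \<comment> \<open>Only the ramps that start at \<open>m - 1\<close> and \<open>m\<close> meet the
    open interval between \<open>m - 1\<close> and \<open>m + 1\<close>, so their sum describes the
    staircase around \<open>u\<close> without the floor.\<close>
  define g where "g t = (m - 1) + min 1 (L * (t - m + 1)) + max 0 (min 1 (L * (t - m)))" for t :: real
  have eq: "staircase L t = g t" if t: "t \<in> {real_of_int m - 1 <..< m + 1}" for t
  proof (cases "t < m")
    case True
    then have "\<lfloor>t\<rfloor> = m - 1" using t by (intro floor_unique) auto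
    moreover have "L * (t - m) \<le> 0" using True by (simp add: mult_nonneg_nonpos)
    moreover have "frac t = t - m + 1" using calculation(1) unfolding frac_def by simp
    ultimately show ?thesis unfolding staircase_def g_def by simp
  next
    case False
    then have "\<lfloor>t\<rfloor> = m" using t by (intro floor_unique) auto
    moreover have "1 \<le> L * (t - m + 1)" using False L mult_mono[of 1 "real L" 1 "t - m + 1"] by simp
    moreover have "0 \<le> L * (t - m)" using False by simp
    ultimately show ?thesis unfolding staircase_def g_def frac_def by simp
  qed
  have "u \<in> {real_of_int m - 1 <..< m + 1}" unfolding m_def by (simp; linarith)
  then have "\<forall>\<^sub>F t in nhds u. t \<in> {real_of_int m - 1 <..< m + 1}"
    by (intro eventually_nhds_in_open) auto
  then have "\<forall>\<^sub>F t in nhds u. staircase L t = g t" by eventually_elim (rule eq)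
  moreover have "isCont g u" unfolding g_def by (intro continuous_intros)
  ultimately show ?thesis using isCont_cong by metis
qed

text \<open>The staircase stays between \<open>\<lfloor>u\<rfloor>\<close> and
  \<open>\<lfloor>u\<rfloor> + 1\<close>, so being within 1 of an integer \<open>v\<close> confines
  \<open>u\<close> as well. At the end point \<open>u = v - 1\<close> its value is exactly
  \<open>v - 1\<close>, which the strict hypothesis excludes.\<close>

lemma staircase_window:
  assumes L: "L \<ge> 1" and v: "staircase L u - of_int v < 1" "of_int v - staircase L u < 1"
  shows "of_int v - 1 < u" "u < of_int v + 1"
proof -
  have m: "0 \<le> min 1 (L * frac u)" "min 1 (L * frac u) \<le> 1" by auto
  show "u < of_int v + 1"
  proof (rule ccontr)
    assume "\<not> ?thesis"
    then have "\<lfloor>u\<rfloor> \<ge> v + 1" by linarith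
    then show False using v(1) m unfolding staircase_def by linarith
  qed
  show "of_int v - 1 < u"
  proof (rule ccontr)
    assume *: "\<not> ?thesis"
    then consider "\<lfloor>u\<rfloor> \<le> v - 2" | "u = of_int (v - 1)" by linarith
    then show False
    proof cases
      case 1 then show False using v(2) m unfolding staircase_def by linarith
    next
      case 2 then show False using v(2) unfolding staircase_def by (simp add: frac_eq_0_iff[THEN iffD2])
    qed
  qed
qed

text \<open>A nonintegral value puts \<open>s - \<theta> / L\<close> less than \<open>1 / L\<close>
  above an integer, so \<open>L * s\<close> determines \<theta> modulo \<open>L\<close>. For each
  value of \<open>s\<close> a single threshold is bad, which is what makes random thresholds
  efficient.\<close>

lemma staircase_nonint:
  assumes L: "L \<ge> 1" and n: "staircase L (s - \<theta> / L) \<notin> \<int>" and th: "\<theta> < L"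
  shows "\<theta> = nat (\<lfloor>L * s\<rfloor> mod int L)"
proof -
  define u where "u = s - \<theta> / L"
  have f: "0 < frac u" "L * frac u < 1"
  proof -
    show "L * frac u < 1"
      using n unfolding staircase_def u_def[symmetric] by (cases "L * frac u < 1") (auto simp: min_def)
    have "frac u \<noteq> 0" using n unfolding staircase_def u_def[symmetric] by (intro notI) simp
    then show "0 < frac u" using frac_ge_0[of u] by linarith
  qed
  have "L * s = of_int (int L * \<lfloor>u\<rfloor> + \<theta>) + L * frac u"
    using L unfolding u_def frac_def by (simp add: field_simps)
  then have "\<lfloor>L * s\<rfloor> = int L * \<lfloor>u\<rfloor> + \<theta>" using f L by (intro floor_unique) auto
  then show ?thesis using th by simp
qed

text \<open>The scaled distances of the first \<open>n\<close> iterates to the net \<open>P\<close>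
  serve as coordinates on \<open>K\<close>; after a shift by \<theta> and the staircase, preimages
  of Freudenthal stars form the cover. They are small because at each time some net point is close.
  Their order is bounded by the number of nonintegral coordinates, which the sparse thresholds keep
  below \<open>M\<close> on every cell of \<open>\<C>\<close>.\<close>

lemma exists_low_order_cover:
  assumes K: "compact K" and S: "S \<in> K \<rightarrow> K" "continuous_on K S"
    and U: "\<U> \<in> finite_open_covers (top_of_set K)" "\<U> \<noteq> {}"
    and L: "\<And>x. x \<in> K \<Longrightarrow> \<exists>U\<in>\<U>. ball x \<delta> \<inter> K \<subseteq> U"
    and P: "finite P" "\<And>x. x \<in> K \<Longrightarrow> \<exists>p\<in>P. dist x p < \<kappa>" and \<kappa>: "\<kappa> > 0" "4 * \<kappa> \<le> \<delta>"
    and C: "finite \<C>" "K \<subseteq> \<Union>\<C>" and N: "N \<ge> 1"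
    and small: "\<And>D x y i. D \<in> \<C> \<Longrightarrow> x \<in> D \<Longrightarrow> y \<in> D \<Longrightarrow> i < n \<Longrightarrow> dist ((S ^^ i) x) ((S ^^ i) y) < \<kappa> / real N"
    and M: "\<And>b. real N ^ b \<le> real (card \<C>) * 4 ^ (n * card P) \<Longrightarrow> b \<le> M"
  shows "cover_dim (top_of_set K) (iterated_join (top_of_set K) S \<U> n) \<le> M"
proof -
  let ?I = "{..<n} \<times> P"
  define s where "s x a = dist ((S ^^ fst a) x) (snd a) / \<kappa>" for x and a :: "nat \<times> 'a"
  define rep where "rep D = (SOME x. x \<in> D)" for D :: "'a set"
  \<comment> \<open>On a cell the scaled distance differs from that of the representative by less
    than \<open>1 / N\<close>, so the floor of its \<open>N\<close>-fold moves by at most one; hence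
    three residues.\<close>
  define bad where "bad D a = (\<lambda>e. nat ((\<lfloor>N * s (rep D) a\<rfloor> + e) mod int N)) ` {-1, 0, 1}" for D a
  have card3: "card (bad D a \<inter> {..<N}) \<le> 3" for D a
  proof -
    have "card (bad D a \<inter> {..<N}) \<le> card (bad D a)" unfolding bad_def by (intro card_mono) auto
    also have "\<dots> \<le> card {-1, 0, 1 :: int}" unfolding bad_def by (rule card_image_le) auto
    finally show ?thesis by simp
  qed
  have "finite ?I" using P(1) by simp
  note exists_sparse_thresholds[of ?I \<C> N bad, OF this C(1) N card3]
  then obtain \<theta> where \<theta>: "\<And>a. a \<in> ?I \<Longrightarrow> \<theta> a < N"
    "\<And>D. D \<in> \<C> \<Longrightarrow> real N ^ card {a\<in>?I. \<theta> a \<in> bad D a} \<le> real (card \<C>) * 4 ^ card ?I"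
    by blast
  define y where "y x a = staircase N (s x a - \<theta> a / N)" for x a
  have cS: "continuous_on K (S ^^ i)" for i
  proof (induction i)
    case (Suc i)
    have "(S ^^ i) ` K \<subseteq> K" using funpow_in[OF S(1)] by auto
    then have "continuous_on K (S \<circ> (S ^^ i))"
      using Suc S(2) continuous_on_compose continuous_on_subset by blast
    then show ?case by simp
  qed (simp add: continuous_on_id')
  have cy: "continuous_on K (\<lambda>x. y x a)" for a
  proof -
    have 1: "continuous_on K (\<lambda>x. s x a - \<theta> a / N)"
      unfolding s_def using \<kappa>(1) N by (intro continuous_intros cS) auto
    have 2: "continuous_on UNIV (staircase N)"
      using isCont_staircase[OF N] by (simp add: continuous_at_imp_continuous_on)
    show ?thesis
      unfolding y_def by (rule continuous_on_compose2[OF 2 1]) auto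
  qed
  have few: "card {a\<in>?I. y x a \<notin> \<int>} \<le> M" if x: "x \<in> K" for x
  proof -
    obtain D where D: "D \<in> \<C>" "x \<in> D" using C(2) x by blast
    have r: "rep D \<in> D" unfolding rep_def using D(2) by (rule someI)
    have "\<theta> a \<in> bad D a" if a: "a \<in> ?I" "y x a \<notin> \<int>" for a
    proof -
      have "\<bar>dist ((S ^^ fst a) x) (snd a) - dist ((S ^^ fst a) (rep D)) (snd a)\<bar> \<le> dist ((S ^^ fst a) x) ((S ^^ fst a) (rep D))"
        by metric
      also have "\<dots> < \<kappa> / N" using small[OF D(1,2) r] a by auto
      finally have close: "\<bar>s x a - s (rep D) a\<bar> < 1 / N"
        using \<kappa>(1) unfolding s_def by (simp add: diff_divide_distrib[symmetric] divide_less_eq)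
      have "\<bar>N * s x a - N * s (rep D) a\<bar> < 1"
      proof -
        have "\<bar>N * s x a - N * s (rep D) a\<bar> = N * \<bar>s x a - s (rep D) a\<bar>"
          by (simp add: abs_mult flip: right_diff_distrib)
        also have "\<dots> < N * (1 / N)"
          using close N by (intro mult_strict_left_mono) auto
        finally show ?thesis using N by simp
      qed
      then have "\<lfloor>N * s x a\<rfloor> - \<lfloor>N * s (rep D) a\<rfloor> \<in> {-1, 0, 1}" by (simp; linarith)
      then obtain e where "e \<in> {-1, 0, 1}" "\<lfloor>N * s x a\<rfloor> = \<lfloor>N * s (rep D) a\<rfloor> + e"
        by (metis add.commute diff_add_cancel)
      moreover have "\<theta> a = nat (\<lfloor>N * s x a\<rfloor> mod int N)"
        using staircase_nonint[OF N _ \<theta>(1)[OF a(1)]] a(2) unfolding y_def by blast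
      ultimately show ?thesis unfolding bad_def by auto
    qed
    then have "card {a\<in>?I. y x a \<notin> \<int>} \<le> card {a\<in>?I. \<theta> a \<in> bad D a}"
      using P(1) by (intro card_mono) auto
    also have "\<dots> \<le> M" using \<theta>(2)[OF D(1)] by (intro M) (simp add: card_cartesian_product)
    finally show ?thesis .
  qed
  define W where "W v = {x\<in>K. freudenthal_star ?I v (y x)}" for v
  have Wopen: "openin (top_of_set K) (W v)" for v
  proof -
    let ?c = "\<lambda>a b. (K \<inter> (\<lambda>x. y x a - v a) -` {..<1}) \<inter> (K \<inter> (\<lambda>x. v a - y x a) -` {..<1})
       \<inter> (K \<inter> (\<lambda>x. (y x a - v a) + (v b - y x b)) -` {..<1})"
    \<comment> \<open>Over an empty index set the intersection is the whole type and not a subset of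
      \<open>K\<close>; the extra factor \<open>K\<close> repairs this.\<close>
    have "openin (top_of_set K) (K \<inter> (\<Inter>a\<in>?I. \<Inter>b\<in>?I. ?c a b))"
    proof (cases "?I = {}")
      case False
      have "openin (top_of_set K) (\<Inter>a\<in>?I. \<Inter>b\<in>?I. ?c a b)"
        using False P(1)
        by (intro openin_INT2 openin_Int continuous_openin_preimage_gen continuous_intros cy) auto
      then show ?thesis by (rule openin_Int[OF openin_subtopology_self])
    qed simp
    moreover have "K \<inter> (\<Inter>a\<in>?I. \<Inter>b\<in>?I. ?c a b) = W v"
      unfolding W_def freudenthal_star_def set_eq_iff Int_iff INT_iff vimage_eq lessThan_iff mem_Collect_eq
      by blast
    ultimately show ?thesis by simp
  qed
  define \<W> where "\<W> = W ` extensional ?I"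
  have W_ext: "W (restrict v ?I) = W v" for v
    unfolding W_def freudenthal_star_def by fastforce
  have cov: "K \<subseteq> \<Union>\<W>"
  proof
    fix x assume "x \<in> K"
    then have "x \<in> W (restrict (\<lambda>a. \<lfloor>y x a\<rfloor>) ?I)"
      unfolding W_ext using freudenthal_star_floor[of ?I "y x"] unfolding W_def by auto
    then show "x \<in> \<Union>\<W>" unfolding \<W>_def by (meson UnionI image_eqI restrict_extensional)
  qed
  have "\<forall>c\<in>\<W>. openin (top_of_set K) c" unfolding \<W>_def using Wopen by blast
  then obtain \<V> where V: "\<V> \<subseteq> \<W>" "finite \<V>" "K \<subseteq> \<Union>\<V>"
    using K[unfolded compact_eq_openin_cover, THEN spec, of \<W>] cov by blast
  have small_W: "\<exists>B\<in>iterated_join (top_of_set K) S \<U> n. V \<subseteq> B" if "V \<in> \<V>" for V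
  proof (cases "V = {}")
    case True
    obtain U0 where "U0 \<in> \<U>" using U(2) by blast
    then have "{x\<in>topspace (top_of_set K). \<forall>i<n. (S ^^ i) x \<in> (\<lambda>_. U0) i} \<in> iterated_join (top_of_set K) S \<U> n"
      unfolding iterated_join_def mem_Collect_eq
      by (intro exI[of _ "\<lambda>_. U0"] conjI) auto
    then show ?thesis using True by auto
  next
    case False
    obtain v where v: "V = W v" using \<open>V \<in> \<V>\<close> V(1) unfolding \<W>_def by blast
    obtain x where x: "x \<in> W v" using False v by blast
    have xK: "x \<in> K" using x unfolding W_def by auto
    have "z \<in> K \<and> (\<forall>i<n. dist ((S ^^ i) x) ((S ^^ i) z) < \<delta>)" if z: "z \<in> W v" for z
    proof (intro conjI allI impI)
      show "z \<in> K" using z unfolding W_def by auto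
      fix i assume i: "i < n"
      obtain p where p: "p \<in> P" "dist ((S ^^ i) x) p < \<kappa>" using P(2) funpow_in[OF S(1) xK] by blast
      let ?a = "(i, p)"
      have a: "?a \<in> ?I" using i p by auto
      have "of_int (v ?a) - 1 < s t ?a - \<theta> ?a / N" "s t ?a - \<theta> ?a / N < of_int (v ?a) + 1" if "t \<in> W v" for t
        using staircase_window[OF N, of "s t ?a - \<theta> ?a / N" "v ?a"] that a
        unfolding W_def freudenthal_star_def y_def by blast+
      \<comment> \<open>Both points lie within one unit of the same vertex, so their distances to
        \<open>p\<close> differ by less than \<open>2 * \<kappa>\<close>; together with
        \<open>dist ((S ^^ i) x) p < \<kappa>\<close> this accounts for the
        \<open>4 * \<kappa>\<close> of the hypothesis.\<close>
      from this[OF x] this[OF z] have "s z ?a < s x ?a + 2" by linarith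
      then have "dist ((S ^^ i) z) p < dist ((S ^^ i) x) p + 2 * \<kappa>"
        using \<kappa>(1) unfolding s_def by (simp add: field_simps)
      then have "dist ((S ^^ i) x) ((S ^^ i) z) < 4 * \<kappa>" using p(2) by metric
      then show "dist ((S ^^ i) x) ((S ^^ i) z) < \<delta>" using \<kappa>(2) by linarith
    qed
    then show ?thesis using small_subset_iterated_join[OF S(1) L xK, of V n] v by metis
  qed
  have "\<V> \<in> finite_open_covers (top_of_set K)"
    using V Wopen unfolding finite_open_covers_def \<W>_def W_def by auto
  then have "cover_dim (top_of_set K) (iterated_join (top_of_set K) S \<U> n) \<le> cover_ord (top_of_set K) \<V>"
    unfolding cover_dim_def using small_W by (intro cINF_lower) (auto simp: refines_cover_def)
  also have "(SUP x\<in>topspace (top_of_set K). card {V\<in>\<V>. x \<in> V}) \<le> 1 + M"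
  proof (cases "K = {}")
    case False
    then show ?thesis
    proof (intro cSUP_least)
      fix x assume "x \<in> topspace (top_of_set K)"
      then have x: "x \<in> K" by simp
      let ?V = "{v \<in> extensional ?I. freudenthal_star ?I v (y x)}"
      have "{V\<in>\<V>. x \<in> V} \<subseteq> W ` ?V" using V(1) unfolding \<W>_def W_def by auto
      moreover have fin: "finite ?V" "card ?V \<le> 1 + card {a\<in>?I. y x a \<notin> \<int>}"
        using card_freudenthal_star_le[of ?I "y x"] P(1) by auto
      ultimately have "card {V\<in>\<V>. x \<in> V} \<le> card (W ` ?V)" by (intro card_mono) auto
      also have "\<dots> \<le> card ?V" using fin(1) by (rule card_image_le)
      finally show "card {V\<in>\<V>. x \<in> V} \<le> 1 + M" using fin(2) few[OF x] by linarith
    qed simp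
  qed (simp add: bot_nat_def)
  then have "cover_ord (top_of_set K) \<V> \<le> M" unfolding cover_ord_def by simp
  finally show ?thesis .
qed

text \<open>The order \<open>b\<close> of the cover satisfies \<open>b * ln N \<le> c * n\<close>,
  where \<open>c\<close> depends on the net \<open>P\<close> but not on the refinement
  \<open>N\<close> of the scale. Enlarging \<open>N\<close> pushes the order below any given
  fraction of \<open>n\<close>.\<close>

lemma mean_dim_eq_0:
  assumes K: "compact K" "K \<noteq> {}" and S: "S \<in> K \<rightarrow> K" "continuous_on K S" and sub: "subexponential_covers K S"
  shows "mean_dim (top_of_set K) S = 0"
proof -
  have lim0: "lim (\<lambda>n. ereal (real (cover_dim (top_of_set K) (iterated_join (top_of_set K) S \<U> n)) / real n)) = 0"
    if U: "\<U> \<in> finite_open_covers (top_of_set K)" for \<U>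
  proof -
    obtain \<delta> where d: "\<delta> > 0" and L: "\<And>x. x \<in> K \<Longrightarrow> \<exists>U\<in>\<U>. ball x \<delta> \<inter> K \<subseteq> U"
      using open_cover_Lebesgue[OF K(1) U] by blast
    define \<kappa> where "\<kappa> = \<delta> / 4"
    have \<kappa>: "\<kappa> > 0" "4 * \<kappa> \<le> \<delta>" using d unfolding \<kappa>_def by auto
    obtain P where P: "finite P" "K \<subseteq> (\<Union>p\<in>P. ball p \<kappa>)"
      using K(1)[unfolded compact_eq_totally_bounded] \<kappa>(1) by meson
    then have P': "\<And>x. x \<in> K \<Longrightarrow> \<exists>p\<in>P. dist x p < \<kappa>" by (fastforce simp: dist_commute)
    have U': "\<U> \<noteq> {}" using U K(2) unfolding finite_open_covers_def by auto
    define m where "m n = cover_dim (top_of_set K) (iterated_join (top_of_set K) S \<U> n)" for n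
    have "(\<lambda>n. real (m n) / real n) \<longlonglongrightarrow> 0"
    proof (rule LIMSEQ_I)
      fix r :: real assume r: "r > 0"
      define c where "c = 1 + card P * ln 4"
      have c: "c > 0" unfolding c_def by (simp add: add_pos_nonneg)
      \<comment> \<open>Large enough that \<open>ln N \<ge> 2 * c / r\<close>, which turns
        \<open>b * ln N \<le> c * n\<close> into \<open>b \<le> n * r / 2\<close>; the summand 2
        keeps \<open>ln N\<close> positive.\<close>
      define N where "N = nat \<lceil>exp (2 * c / r)\<rceil> + 2"
      have "N \<ge> 2" "real N \<ge> exp (2 * c / r)" unfolding N_def by simp linarith
      then have N: "N \<ge> 1" "real N > 1" "real N \<ge> exp (2 * c / r)" by linarith+
      then have "ln (exp (2 * c / r)) \<le> ln (real N)" by (intro ln_mono) auto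
      then have lnN: "2 * c / r \<le> ln (real N)" "ln (real N) > 0" using N by simp_all
      have "\<kappa> / N > 0" using \<kappa> N by simp
      then obtain n0 where n0: "\<And>n. n \<ge> n0 \<Longrightarrow> \<exists>\<C>. finite \<C> \<and> real (card \<C>) \<le> exp (1 * real n) \<and>
              K \<subseteq> \<Union>\<C> \<and> (\<forall>D\<in>\<C>. \<forall>x\<in>D. \<forall>y\<in>D. \<forall>i<n. dist ((S ^^ i) x) ((S ^^ i) y) < \<kappa> / N)"
        using sub[unfolded subexponential_covers_def, rule_format, of "\<kappa> / N" 1]
        by (auto simp: eventually_sequentially)
      show "\<exists>no. \<forall>n\<ge>no. norm (real (m n) / real n - 0) < r"
      proof (intro exI allI impI)
        fix n :: nat assume "max 1 n0 \<le> n"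
        then have n: "0 < n" "n \<ge> n0" by auto
        obtain \<C> where C: "finite \<C>" "real (card \<C>) \<le> exp (1 * real n)" "K \<subseteq> \<Union>\<C>"
            "\<And>D x y i. D \<in> \<C> \<Longrightarrow> x \<in> D \<Longrightarrow> y \<in> D \<Longrightarrow> i < n \<Longrightarrow> dist ((S ^^ i) x) ((S ^^ i) y) < \<kappa> / N"
          using n0[OF n(2)] by metis
        have "m n \<le> nat \<lfloor>n * r / 2\<rfloor>"
          unfolding m_def
        proof (rule exists_low_order_cover[OF K(1) S U U' L P(1) P' \<kappa> C(1,3) N(1) C(4)])
          fix b assume b: "real N ^ b \<le> real (card \<C>) * 4 ^ (n * card P)"
          have "real b * ln N = ln (real N ^ b)" using N by (simp add: ln_realpow)
          also have "\<dots> \<le> ln (exp (real n) * 4 ^ (n * card P))"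
            using b C(2) N by (intro ln_mono) (auto intro: order_trans[OF b] mult_right_mono)
          also have "\<dots> = n * c" unfolding c_def by (simp add: ln_mult ln_realpow algebra_simps)
          also have "\<dots> = (n * r / 2) * (2 * c / r)" using r by simp
          also have "\<dots> \<le> (n * r / 2) * ln N" using lnN r by (intro mult_left_mono) auto
          finally have "real b \<le> n * r / 2" using lnN(2) by simp
          then show "b \<le> nat \<lfloor>n * r / 2\<rfloor>" by (simp add: le_nat_floor)
        qed auto
        also have "real (nat \<lfloor>n * r / 2\<rfloor>) \<le> n * r / 2" using r by (intro of_nat_floor) simp
        finally have "real (m n) \<le> n * r / 2" by simp
        then have "real (m n) / n \<le> r / 2" using n by (simp add: field_simps)
        then show "norm (real (m n) / real n - 0) < r"
          using r unfolding diff_zero real_norm_def abs_divide abs_of_nat by linarith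
      qed
    qed
    then have "(\<lambda>n. ereal (real (m n) / real n)) \<longlonglongrightarrow> ereal 0" by (simp only: lim_ereal)
    then show ?thesis unfolding m_def by (metis limI zero_ereal_def)
  qed
  have "{K} \<in> finite_open_covers (top_of_set K)" unfolding finite_open_covers_def by auto
  then have "finite_open_covers (top_of_set K) \<noteq> {}" by blast
  then show ?thesis unfolding mean_dim_def using lim0 by simp
qed

lemma covering_dim_singleton: "covering_dim (top_of_set {p}) = 0"
proof -
  have "cover_dim (top_of_set {p}) \<U> = 0" if U: "\<U> \<in> finite_open_covers (top_of_set {p})" for \<U>
  proof -
    have "\<Union>\<U> = {p}" using U unfolding finite_open_covers_def by simp
    then have "\<exists>U\<in>\<U>. p \<in> U" by blast
    then have "{{p}} \<in> {\<V> \<in> finite_open_covers (top_of_set {p}). refines_cover \<V> \<U>}"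
      unfolding finite_open_covers_def refines_cover_def by auto
    then have "cover_dim (top_of_set {p}) \<U> \<le> cover_ord (top_of_set {p}) {{p}}"
      unfolding cover_dim_def by (intro cINF_lower) auto
    also have "{V \<in> {{p}}. p \<in> V} = {{p}}" by auto
    then have "cover_ord (top_of_set {p}) {{p}} = 0" unfolding cover_ord_def by simp
    finally show ?thesis by simp
  qed
  moreover have "{{p}} \<in> finite_open_covers (top_of_set {p})" unfolding finite_open_covers_def by auto
  then have "finite_open_covers (top_of_set {p}) \<noteq> {}" by blast
  ultimately show ?thesis unfolding covering_dim_def by (simp add: zero_ereal_def)
qed

section \<open>The simplex of probability measures on a compact set\<close>

text \<open>The common bound \<open>1 / 2 ^ n\<close> makes the tails uniformly small, so
  convergence in each coordinate is convergence in the sup norm.\<close>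

lemma tendsto_bcontfun_weighted:
  fixes f :: "'b \<Rightarrow> (nat \<Rightarrow>\<^sub>C real)"
  assumes lim: "\<And>n. ((\<lambda>m. apply_bcontfun (f m) n) \<longlongrightarrow> apply_bcontfun l n) F"
    and f: "\<forall>\<^sub>F m in F. \<forall>n. \<bar>apply_bcontfun (f m) n\<bar> \<le> 1 / 2 ^ n"
    and l: "\<And>n. \<bar>apply_bcontfun l n\<bar> \<le> 1 / 2 ^ n"
  shows "(f \<longlongrightarrow> l) F"
proof (rule tendstoI)
  fix e :: real assume e: "e > 0"
  obtain N where N: "(1/2::real) ^ N < e / 4" using real_arch_pow_inv[of "e/4" "1/2"] e by auto
  have "\<forall>\<^sub>F m in F. \<forall>n\<in>{..<N}. dist (apply_bcontfun (f m) n) (apply_bcontfun l n) < e / 2"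
    using e by (intro eventually_ball_finite ballI tendstoD[OF lim]) auto
  with f show "\<forall>\<^sub>F m in F. dist (f m) l < e"
  proof eventually_elim
    case (elim m)
    have "dist (apply_bcontfun (f m) n) (apply_bcontfun l n) \<le> e / 2" for n
    proof (cases "n < N")
      case False
      have "dist (apply_bcontfun (f m) n) (apply_bcontfun l n) \<le> \<bar>apply_bcontfun (f m) n\<bar> + \<bar>apply_bcontfun l n\<bar>"
        unfolding dist_real_def by linarith
      also have "\<dots> \<le> 1 / 2 ^ n + 1 / 2 ^ n" using elim(1) l by (intro add_mono) auto
      also have "\<dots> \<le> 2 * (1/2) ^ N"
        using power_decreasing[of N n "1/2::real"] False by (simp add: power_one_over)
      finally show ?thesis using N by linarith
    qed (use elim(2) in force)
    then have "dist (f m) l \<le> e / 2" by (rule dist_bound)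
    then show ?case using e by linarith
  qed
qed

text \<open>A Bernoulli choice between the two measures, taken as a bind in the probability monad,
  so that total mass and null sets come from the rules for bind.\<close>

lemma exists_mixture_measure:
  fixes \<nu> \<nu>' :: "'a::topological_space measure"
  assumes p: "prob_space \<nu>" "prob_space \<nu>'" and s: "sets \<nu> = sets borel" "sets \<nu>' = sets borel"
    and t: "(t :: real) \<in> {0..1}"
  obtains \<rho> where "prob_space \<rho>" "sets \<rho> = sets borel"
    "\<And>P. Measurable.pred borel P \<Longrightarrow> AE x in \<nu>. P x \<Longrightarrow> AE x in \<nu>'. P x \<Longrightarrow> AE x in \<rho>. P x"
    "\<And>g B. g \<in> borel_measurable borel \<Longrightarrow> (\<And>x. \<bar>g x\<bar> \<le> B) \<Longrightarrow>
        (\<integral>x. g x \<partial>\<rho>) = (1 - t) * (\<integral>x. g x \<partial>\<nu>) + t * (\<integral>x. g x \<partial>\<nu>')"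
proof -
  define k where "k b = (if b then \<nu>' else \<nu>)" for b
  have k: "k b \<in> space (prob_algebra borel)" for b using p s unfolding k_def by (simp add: space_prob_algebra)
  let ?M = "measure_pmf (bernoulli_pmf t)"
  define \<rho> where "\<rho> = ?M \<bind> k"
  have M: "?M \<in> space (prob_algebra (count_space UNIV))" by (simp add: space_prob_algebra measure_pmf.prob_space_axioms)
  have km: "k \<in> count_space UNIV \<rightarrow>\<^sub>M prob_algebra borel" using k by simp
  have km': "k \<in> ?M \<rightarrow>\<^sub>M subprob_algebra borel"
    using measurable_prob_algebraD[OF km] by (simp add: measurable_cong_sets[OF sets_measure_pmf_count_space refl])
  have ps: "prob_space \<rho>" unfolding \<rho>_def using M km by (rule prob_space_bind')
  have sets: "sets \<rho> = sets borel" unfolding \<rho>_def using M km by (rule sets_bind')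
  show thesis
  proof (rule that[OF ps sets])
    fix P assume P: "Measurable.pred borel P" "AE x in \<nu>. P x" "AE x in \<nu>'. P x"
    show "AE x in \<rho>. P x"
      unfolding \<rho>_def AE_bind[OF km' P(1)] using P(2,3) unfolding k_def by simp
  next
    fix g :: "'a \<Rightarrow> real" and B assume g: "g \<in> borel_measurable borel" "\<And>x. \<bar>g x\<bar> \<le> B"
    \<comment> \<open>Adding \<open>B\<close> makes the function nonnegative, so that the integral
      against the bind can be computed as an \<open>nn_integral\<close>; \<open>B\<close> cancels at
      the end.\<close>
    have gB: "0 \<le> g x + B" for x using g(2)[of x] by linarith
    have int: "integrable N g" and nn: "(\<integral>\<^sup>+x. ennreal (g x + B) \<partial>N) = ennreal ((\<integral>x. g x \<partial>N) + B)"
      and nn0: "(\<integral>x. g x \<partial>N) + B \<ge> 0"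
      if N: "prob_space N" "sets N = sets borel" for N
    proof -
      interpret prob_space N by fact
      have [measurable]: "g \<in> borel_measurable N" using g(1) N(2) by (simp cong: measurable_cong_sets)
      show int: "integrable N g" by (rule integrable_const_bound[of _ B]) (use g in auto)
      have "(\<integral>\<^sup>+x. ennreal (g x + B) \<partial>N) = ennreal (\<integral>x. g x + B \<partial>N)"
        using int gB by (intro nn_integral_eq_integral) auto
      also have "(\<integral>x. g x + B \<partial>N) = (\<integral>x. g x \<partial>N) + B" using int by (simp add: prob_space)
      finally show "(\<integral>\<^sup>+x. ennreal (g x + B) \<partial>N) = ennreal ((\<integral>x. g x \<partial>N) + B)" .
      have "(\<integral>x. g x + B \<partial>N) \<ge> 0" using gB by simp
      then show "(\<integral>x. g x \<partial>N) + B \<ge> 0" using int by (simp add: prob_space)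
    qed
    have "ennreal ((\<integral>x. g x \<partial>\<rho>) + B) = (\<integral>\<^sup>+x. ennreal (g x + B) \<partial>\<rho>)" using nn[OF ps sets] by simp
    also have "\<dots> = (\<integral>\<^sup>+b. (\<integral>\<^sup>+x. ennreal (g x + B) \<partial>k b) \<partial>?M)"
      unfolding \<rho>_def using g(1) by (intro nn_integral_bind[OF _ km']) auto
    also have "\<dots> = (\<integral>\<^sup>+x. ennreal (g x + B) \<partial>\<nu>') * ennreal t + (\<integral>\<^sup>+x. ennreal (g x + B) \<partial>\<nu>) * ennreal (1 - t)"
      using t by (simp add: k_def nn_integral_bernoulli_pmf)
    also have "\<dots> = ennreal (((\<integral>x. g x \<partial>\<nu>') + B) * t + ((\<integral>x. g x \<partial>\<nu>) + B) * (1 - t))"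
      unfolding nn[OF p(1) s(1)] nn[OF p(2) s(2)] using nn0[OF p(1) s(1)] nn0[OF p(2) s(2)] t
      by (simp add: ennreal_mult' ennreal_plus)
    finally have "(\<integral>x. g x \<partial>\<rho>) + B = ((\<integral>x. g x \<partial>\<nu>') + B) * t + ((\<integral>x. g x \<partial>\<nu>) + B) * (1 - t)"
      using nn0[OF p(1) s(1)] nn0[OF p(2) s(2)] nn0[OF ps sets] t by (subst (asm) ennreal_inj) auto
    then show "(\<integral>x. g x \<partial>\<rho>) = (1 - t) * (\<integral>x. g x \<partial>\<nu>) + t * (\<integral>x. g x \<partial>\<nu>')"
      by (simp add: algebra_simps)
  qed
qed

lemma borel_measure_eqI_continuous:
  fixes \<nu> \<nu>' :: "'a::metric_space measure"
  assumes p: "prob_space \<nu>" "prob_space \<nu>'" and s: "sets \<nu> = sets borel" "sets \<nu>' = sets borel"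
    and eq: "\<And>g. continuous_on UNIV g \<Longrightarrow> (\<And>x. \<bar>g x\<bar> \<le> (1::real)) \<Longrightarrow> (\<integral>x. g x \<partial>\<nu>) = (\<integral>x. g x \<partial>\<nu>')"
  shows "\<nu> = \<nu>'"
proof (rule measure_eqI_generator_eq[where E="{U. open U}" and \<Omega>=UNIV and A="\<lambda>_. UNIV"])
  show "Int_stable {U :: 'a set. open U}" by (auto simp: Int_stable_def)
  show "sets \<nu> = sigma_sets UNIV {U. open U}" "sets \<nu>' = sigma_sets UNIV {U. open U}"
    using s by (simp_all add: borel_def)
  interpret \<nu>: prob_space \<nu> by fact
  interpret \<nu>': prob_space \<nu>' by fact
  show "emeasure \<nu> UNIV \<noteq> \<infinity>" by simp
  fix U :: "'a set" assume "U \<in> {U. open U}"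
  then have U: "open U" by simp
  show "emeasure \<nu> U = emeasure \<nu>' U"
  \<comment> \<open>The whole space is separate because \<open>infdist x {}\<close> is 0 by
    convention, which would make every \<open>g n\<close> vanish.\<close>
  proof (cases "U = UNIV")
    case True
    then show ?thesis using \<nu>.emeasure_space_1 \<nu>'.emeasure_space_1 s by (metis sets_eq_imp_space_eq space_borel)
  next
    case False
    define g where "g n x = min 1 (real n * infdist x (- U))" for n x
    have g_cont: "continuous_on UNIV (g n)" for n unfolding g_def by (intro continuous_intros)
    have g_bd: "0 \<le> g n x" "g n x \<le> 1" for n x unfolding g_def by (auto simp: infdist_nonneg)
    have g_lim: "(\<lambda>n. g n x) \<longlonglongrightarrow> indicat_real U x" for x
    proof (cases "x \<in> U")
      case True
      have "infdist x (- U) > 0"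
        using True U False in_closed_iff_infdist_zero[of "- U" x] infdist_nonneg[of x "- U"]
        by (auto simp: less_le)
      then obtain N where "1 < real N * infdist x (- U)" using reals_Archimedean3 by blast
      have "\<forall>\<^sub>F n in sequentially. g n x = 1"
        using eventually_ge_at_top[of N]
      proof eventually_elim
        case (elim n)
        have "real N * infdist x (- U) \<le> real n * infdist x (- U)"
          using elim infdist_nonneg by (intro mult_right_mono) auto
        then show ?case unfolding g_def using \<open>1 < _\<close> by simp
      qed
      then show ?thesis using True by (simp add: tendsto_eventually)
    next
      case False
      then have "infdist x (- U) = 0" by simp
      then show ?thesis using False unfolding g_def by simp
    qed
    have lim: "(\<lambda>n. \<integral>x. g n x \<partial>N) \<longlonglongrightarrow> measure N U" if "prob_space N" "sets N = sets borel" for N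
    proof -
      interpret prob_space N by fact
      have [measurable]: "g n \<in> borel_measurable N" for n
        using borel_measurable_continuous_onI[OF g_cont] that(2) by (simp cong: measurable_cong_sets)
      have [measurable]: "U \<in> sets N" using U that(2) by simp
      have "(\<lambda>n. \<integral>x. g n x \<partial>N) \<longlonglongrightarrow> (\<integral>x. indicat_real U x \<partial>N)"
        by (rule integral_dominated_convergence[where w="\<lambda>_. 1"]) (use g_lim g_bd in auto)
      then show ?thesis by simp
    qed
    have "(\<integral>x. g n x \<partial>\<nu>) = (\<integral>x. g n x \<partial>\<nu>')" for n
      using g_bd by (intro eq g_cont) (simp add: abs_le_iff order_trans[OF _ g_bd(1)])
    then have "measure \<nu> U = measure \<nu>' U" using lim[OF p(1) s(1)] lim[OF p(2) s(2)] LIMSEQ_unique by simp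
    then show ?thesis by (simp add: \<nu>.emeasure_eq_measure \<nu>'.emeasure_eq_measure)
  qed
qed auto

lemma bounded_linear_apply_bcontfun: "bounded_linear (\<lambda>q :: 'b::topological_space \<Rightarrow>\<^sub>C 'c::real_normed_vector. apply_bcontfun q n)"
  by (rule bounded_linear_intro[where K=1]) (use norm_bounded in auto)

text \<open>Weak compactness is to be inherited from the real line: the curve is defined on all of
  it, has values in \<open>X\<close> and covers \<open>X\<close> already on \<open>{0..1}\<close>.
  The coordinates \<open>c n\<close> are Borel on the whole space but continuous only on
  \<open>X\<close>, so that they may be cut off outside. By \<open>c_dense\<close> their integrals
  determine the measure.\<close>

locale measure_simplex =
  fixes X :: "'a::euclidean_space set" and \<gamma> :: "real \<Rightarrow> 'a" and c :: "nat \<Rightarrow> 'a \<Rightarrow> real"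
  assumes curve: "continuous_on UNIV \<gamma>" "range \<gamma> \<subseteq> X" "X \<subseteq> \<gamma> ` {0..1}"
    and c_meas [measurable]: "\<And>n. c n \<in> borel_measurable borel"
    and c_cont: "\<And>n. continuous_on X (c n)"
    and c_le: "\<And>n x. \<bar>c n x\<bar> \<le> 1"
    and c_dense: "\<And>g e. continuous_on X g \<Longrightarrow> e > 0 \<Longrightarrow>
      \<exists>N a. \<forall>x\<in>X. \<bar>g x - (\<Sum>n<N. a n * c n x)\<bar> < (e :: real)"
begin

lemma curve_in: "\<gamma> t \<in> X"
  using curve(2) by auto

lemma compact_X: "compact X"
proof -
  have "X = \<gamma> ` {0..1}" using curve by blast
  then show ?thesis
    by (metis compact_Icc compact_continuous_image continuous_on_subset curve(1) subset_UNIV)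
qed

lemma X_borel [measurable]: "X \<in> sets borel"
  using compact_X by (simp add: borel_closed compact_imp_closed)

definition prob_on :: "'a measure set" where
  "prob_on = {\<nu>. prob_space \<nu> \<and> sets \<nu> = sets borel \<and> (AE x in \<nu>. x \<in> X)}"

text \<open>The weights \<open>1 / 2 ^ n\<close> turn weak convergence of measures into norm
  convergence of their images.\<close>

definition bary :: "'a measure \<Rightarrow> nat \<Rightarrow>\<^sub>C real" where
  "bary \<nu> = Bcontfun (\<lambda>n. (\<integral>x. c n x \<partial>\<nu>) / 2 ^ n)"

definition K :: "(nat \<Rightarrow>\<^sub>C real) set" where
  "K = bary ` prob_on"

text \<open>Test functions whose integral will be affine and continuous on \<open>K\<close>.
  Continuity is asked only on \<open>X\<close>, where the measures live, so that the coordinates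
  \<open>c n\<close> qualify.\<close>

definition regular :: "('a \<Rightarrow> real) \<Rightarrow> bool" where
  "regular g \<longleftrightarrow> g \<in> borel_measurable borel \<and> bounded (range g) \<and> continuous_on X g"

lemma regular_c: "regular (c n)"
  unfolding regular_def using c_le c_cont c_meas by (auto intro!: boundedI)

lemma continuous_regular:
  assumes "continuous_on UNIV g" "\<And>x. \<bar>g x\<bar> \<le> B" shows "regular g"
  unfolding regular_def using assms borel_measurable_continuous_onI continuous_on_subset[OF assms(1)]
  by (auto intro!: boundedI)

lemma regularE:
  assumes "regular g" obtains B where "\<And>x. \<bar>g x\<bar> \<le> B"
  using assms unfolding regular_def bounded_iff by auto

context
  fixes \<nu> assumes \<nu>: "\<nu> \<in> prob_on"
begin

lemma prob_space_prob_on: "prob_space \<nu>" and sets_prob_on [measurable_cong]: "sets \<nu> = sets borel"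
  and AE_prob_on: "AE x in \<nu>. x \<in> X"
  using \<nu> unfolding prob_on_def by auto

lemma measurable_prob_on: "g \<in> borel_measurable borel \<Longrightarrow> g \<in> borel_measurable \<nu>"
  using sets_prob_on by (simp cong: measurable_cong_sets)

lemma regular_measurable: "regular g \<Longrightarrow> g \<in> borel_measurable \<nu>"
  unfolding regular_def using measurable_prob_on by blast

lemma integrable_bounded_borel:
  assumes "g \<in> borel_measurable borel" "\<And>x. \<bar>g x\<bar> \<le> (B::real)" shows "integrable \<nu> g"
proof -
  interpret prob_space \<nu> by (rule prob_space_prob_on)
  show ?thesis using assms measurable_prob_on by (intro integrable_const_bound[of _ B]) auto
qed

lemma integrable_regular: "regular g \<Longrightarrow> integrable \<nu> g"
  using integrable_bounded_borel regularE unfolding regular_def by (metis regularE regular_def)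

lemma integral_diff_le:
  assumes g: "integrable \<nu> g" "integrable \<nu> h" and le: "\<And>x. x \<in> X \<Longrightarrow> \<bar>g x - h x\<bar> \<le> (e::real)"
  shows "\<bar>(\<integral>x. g x \<partial>\<nu>) - (\<integral>x. h x \<partial>\<nu>)\<bar> \<le> e"
proof -
  interpret prob_space \<nu> by (rule prob_space_prob_on)
  have "\<bar>(\<integral>x. g x \<partial>\<nu>) - (\<integral>x. h x \<partial>\<nu>)\<bar> = \<bar>\<integral>x. g x - h x \<partial>\<nu>\<bar>" using g by simp
  also have "\<dots> \<le> (\<integral>x. \<bar>g x - h x\<bar> \<partial>\<nu>)" by (rule integral_abs_bound)
  also have "\<dots> \<le> (\<integral>x. e \<partial>\<nu>)"
    using g AE_prob_on le by (intro integral_mono_AE) (auto elim: eventually_mono)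
  finally show ?thesis by (simp add: prob_space)
qed

lemma integral_c_le: "\<bar>\<integral>x. c n x \<partial>\<nu>\<bar> \<le> 1"
  using integral_diff_le[OF integrable_regular[OF regular_c[of n]], of "\<lambda>_. 0" 1] c_le[of n] by simp

lemma apply_bary: "apply_bcontfun (bary \<nu>) n = (\<integral>x. c n x \<partial>\<nu>) / 2 ^ n"
proof -
  have "(\<lambda>n. (\<integral>x. c n x \<partial>\<nu>) / 2 ^ n) \<in> bcontfun"
  proof (rule bcontfun_normI[where b=1])
    show "norm ((\<integral>x. c n x \<partial>\<nu>) / 2 ^ n) \<le> 1" for n
      using order_trans[OF integral_c_le[of n] one_le_power[of "2::real" n]] by (auto simp: divide_le_eq)
  qed (rule Topological_Spaces.continuous_on_discrete)
  then show ?thesis unfolding bary_def by (simp add: Bcontfun_inverse)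
qed

lemma apply_bary_le: "\<bar>apply_bcontfun (bary \<nu>) n\<bar> \<le> 1 / 2 ^ n"
  unfolding apply_bary using integral_c_le[of n] by (simp add: divide_right_mono)

end

lemma integral_combination:
  assumes \<nu>: "\<nu> \<in> prob_on"
  shows "(\<integral>x. (\<Sum>n<N. a n * c n x) \<partial>\<nu>) = (\<Sum>n<N. a n * (2 ^ n * apply_bcontfun (bary \<nu>) n))"
  using integrable_regular[OF \<nu> regular_c] by (simp add: apply_bary[OF \<nu>])

text \<open>By \<open>c_dense\<close> the integral of a test function is, uniformly over all
  measures, close to a finite linear combination of coordinates of the barycenter. Injectivity of
  \<open>bary\<close> and affinity and continuity of \<open>ev\<close> are read off from
  this.\<close>

lemma regular_approx:
  assumes g: "regular g" and e: "e > 0"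
  obtains N a where "\<And>\<nu>. \<nu> \<in> prob_on \<Longrightarrow>
    \<bar>(\<integral>x. g x \<partial>\<nu>) - (\<Sum>n<N. a n * (2 ^ n * apply_bcontfun (bary \<nu>) n))\<bar> \<le> e"
proof -
  obtain N a where Na: "\<And>x. x \<in> X \<Longrightarrow> \<bar>g x - (\<Sum>n<N. a n * c n x)\<bar> < e"
    using c_dense[of g e] g e unfolding regular_def by blast
  show thesis
  proof (rule that)
    fix \<nu> assume \<nu>: "\<nu> \<in> prob_on"
    show "\<bar>(\<integral>x. g x \<partial>\<nu>) - (\<Sum>n<N. a n * (2 ^ n * apply_bcontfun (bary \<nu>) n))\<bar> \<le> e"
      unfolding integral_combination[OF \<nu>, symmetric] using Na integrable_regular[OF \<nu>] g regular_c
      by (intro integral_diff_le[OF \<nu>]) (auto intro: less_imp_le)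
  qed
qed

lemma bary_inj: "inj_on bary prob_on"
proof (rule inj_onI)
  fix \<nu> \<nu>' assume \<nu>: "\<nu> \<in> prob_on" "\<nu>' \<in> prob_on" "bary \<nu> = bary \<nu>'"
  show "\<nu> = \<nu>'"
  proof (rule borel_measure_eqI_continuous)
    fix g :: "'a \<Rightarrow> real" assume g: "continuous_on UNIV g" "\<And>x. \<bar>g x\<bar> \<le> 1"
    have "\<bar>(\<integral>x. g x \<partial>\<nu>) - (\<integral>x. g x \<partial>\<nu>')\<bar> \<le> 0 + e" if "e > 0" for e
    proof -
      have "e / 2 > 0" using that by simp
      then obtain N a where Na: "\<And>\<nu>. \<nu> \<in> prob_on \<Longrightarrow>
        \<bar>(\<integral>x. g x \<partial>\<nu>) - (\<Sum>n<N. a n * (2 ^ n * apply_bcontfun (bary \<nu>) n))\<bar> \<le> e / 2"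
        using regular_approx[OF continuous_regular[OF g]] by metis
      show ?thesis using Na[OF \<nu>(1)] Na[OF \<nu>(2)] unfolding \<nu>(3) by linarith
    qed
    then have "\<bar>(\<integral>x. g x \<partial>\<nu>) - (\<integral>x. g x \<partial>\<nu>')\<bar> \<le> 0" by (rule field_le_epsilon)
    then show "(\<integral>x. g x \<partial>\<nu>) = (\<integral>x. g x \<partial>\<nu>')" by simp
  qed (use \<nu> in \<open>auto simp: prob_on_def\<close>)
qed

definition meas :: "(nat \<Rightarrow>\<^sub>C real) \<Rightarrow> 'a measure" where
  "meas = the_inv_into prob_on bary"

lemma meas_bary: "\<nu> \<in> prob_on \<Longrightarrow> meas (bary \<nu>) = \<nu>"
  unfolding meas_def using bary_inj by (rule the_inv_into_f_f)

lemma meas_in: "q \<in> K \<Longrightarrow> meas q \<in> prob_on" and bary_meas: "q \<in> K \<Longrightarrow> bary (meas q) = q"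
  unfolding K_def using meas_bary by auto

lemma K_le: "q \<in> K \<Longrightarrow> \<bar>apply_bcontfun q n\<bar> \<le> 1 / 2 ^ n"
  unfolding K_def using apply_bary_le by auto

abbreviation ev :: "('a \<Rightarrow> real) \<Rightarrow> (nat \<Rightarrow>\<^sub>C real) \<Rightarrow> real" where
  "ev g q \<equiv> \<integral>x. g x \<partial>meas q"

lemma apply_K: "q \<in> K \<Longrightarrow> apply_bcontfun q n = ev (c n) q / 2 ^ n"
  using apply_bary[OF meas_in] bary_meas by metis

lemma convex_K: "convex K"
proof (rule convexI)
  fix p q and u v :: real assume p: "p \<in> K" "q \<in> K" and uv: "0 \<le> u" "0 \<le> v" "u + v = 1"
  note mp = meas_in[OF p(1)] and mq = meas_in[OF p(2)]
  obtain \<rho> where \<rho>: "prob_space \<rho>" "sets \<rho> = sets borel"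
    "\<And>P. Measurable.pred borel P \<Longrightarrow> AE x in meas p. P x \<Longrightarrow> AE x in meas q. P x \<Longrightarrow> AE x in \<rho>. P x"
    "\<And>g B. g \<in> borel_measurable borel \<Longrightarrow> (\<And>x. \<bar>g x\<bar> \<le> B) \<Longrightarrow>
        (\<integral>x. g x \<partial>\<rho>) = (1 - v) * (\<integral>x. g x \<partial>meas p) + v * (\<integral>x. g x \<partial>meas q)"
    using exists_mixture_measure[of "meas p" "meas q" v] mp mq uv unfolding prob_on_def by auto
  have "AE x in \<rho>. x \<in> X" using \<rho>(3)[of "\<lambda>x. x \<in> X"] AE_prob_on mp mq by simp
  then have r: "\<rho> \<in> prob_on" using \<rho> unfolding prob_on_def by auto
  have "bary \<rho> = u *\<^sub>R p + v *\<^sub>R q"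
  proof (rule bcontfun_eqI)
    fix n
    have u: "1 - v = u" using uv by simp
    show "apply_bcontfun (bary \<rho>) n = apply_bcontfun (u *\<^sub>R p + v *\<^sub>R q) n"
      using \<rho>(4)[OF c_meas c_le] by (simp add: apply_bary[OF r] apply_K p u add_divide_distrib)
  qed
  then show "u *\<^sub>R p + v *\<^sub>R q \<in> K" unfolding K_def using r by (metis imageI)
qed

lemma ev_affine:
  assumes g: "regular g" and p: "p \<in> K" "q \<in> K" and t: "t \<in> {0..1}"
  shows "ev g ((1 - t) *\<^sub>R p + t *\<^sub>R q) = (1 - t) * ev g p + t * ev g q"
proof -
  let ?r = "(1 - t) *\<^sub>R p + t *\<^sub>R q"
  have r: "?r \<in> K" using convexD_alt[OF convex_K p(1,2)] t by auto
  have "\<bar>ev g ?r - ((1 - t) * ev g p + t * ev g q)\<bar> \<le> 0 + e" if e: "e > 0" for e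
  proof -
    obtain N a where Na: "\<And>\<nu>. \<nu> \<in> prob_on \<Longrightarrow>
      \<bar>(\<integral>x. g x \<partial>\<nu>) - (\<Sum>n<N. a n * (2 ^ n * apply_bcontfun (bary \<nu>) n))\<bar> \<le> e / 2"
      using regular_approx[OF g, of "e/2"] e half_gt_zero by metis
    define l where "l q = (\<Sum>n<N. a n * (2 ^ n * apply_bcontfun q n))" for q
    have Nb: "\<bar>ev g q - l q\<bar> \<le> e / 2" if "q \<in> K" for q
      using Na[OF meas_in[OF that]] unfolding l_def bary_meas[OF that] .
    have "l ?r = (1 - t) * l p + t * l q"
      unfolding l_def by (simp add: sum_distrib_left sum.distrib[symmetric] algebra_simps)
    then have "ev g ?r - ((1 - t) * ev g p + t * ev g q) =
      (ev g ?r - l ?r) - ((1 - t) * (ev g p - l p) + t * (ev g q - l q))" by (simp add: algebra_simps)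
    moreover have "\<bar>(1 - t) * (ev g p - l p) + t * (ev g q - l q)\<bar> \<le> (1 - t) * (e/2) + t * (e/2)"
      using t Nb[OF p(1)] Nb[OF p(2)]
      by (intro order_trans[OF abs_triangle_ineq] add_mono) (simp_all add: abs_mult mult_left_mono del: times_divide_eq_right)
    moreover have "(1 - t) * (e/2) + t * (e/2) = e / 2" by (simp add: field_simps)
    ultimately show ?thesis using Nb[OF r] by linarith
  qed
  then have "\<bar>ev g ?r - ((1 - t) * ev g p + t * ev g q)\<bar> \<le> 0" by (rule field_le_epsilon)
  then show ?thesis by simp
qed

lemma continuous_on_ev:
  assumes g: "regular g" shows "continuous_on K (ev g)"
proof (rule continuous_on_iff[THEN iffD2], intro ballI allI impI)
  fix p and e :: real assume p: "p \<in> K" and e: "e > 0"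
  obtain N a where Na: "\<And>\<nu>. \<nu> \<in> prob_on \<Longrightarrow>
    \<bar>(\<integral>x. g x \<partial>\<nu>) - (\<Sum>n<N. a n * (2 ^ n * apply_bcontfun (bary \<nu>) n))\<bar> \<le> e / 4"
    using regular_approx[OF g, of "e/4"] e by (metis divide_pos_pos zero_less_numeral)
  define l where "l q = (\<Sum>n<N. a n * (2 ^ n * apply_bcontfun q n))" for q
  have Nb: "\<bar>ev g q - l q\<bar> \<le> e / 4" if "q \<in> K" for q
    using Na[OF meas_in[OF that]] unfolding l_def bary_meas[OF that] .
  have "continuous_on K l"
    unfolding l_def
    by (intro continuous_intros continuous_on_sum linear_continuous_on
        bounded_linear_apply_bcontfun)
  moreover have "e / 4 > 0" using e by simp
  ultimately obtain d where d: "d > 0" "\<And>q. q \<in> K \<Longrightarrow> dist q p < d \<Longrightarrow> dist (l q) (l p) < e / 4"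
    using p unfolding continuous_on_iff by blast
  show "\<exists>d>0. \<forall>q\<in>K. dist q p < d \<longrightarrow> dist (ev g q) (ev g p) < e"
  proof (intro exI[of _ d] conjI ballI impI)
    fix q assume q: "q \<in> K" "dist q p < d"
    show "dist (ev g q) (ev g p) < e"
      using Nb[OF p] Nb[OF q(1)] d(2)[OF q] e unfolding dist_real_def by linarith
  qed (rule d(1))
qed

lemma continuous_on_K_coordI:
  assumes F: "\<And>q. q \<in> D \<Longrightarrow> F q \<in> K" and cont: "\<And>n. continuous_on D (\<lambda>q. ev (c n) (F q))"
  shows "continuous_on D F"
  unfolding continuous_on_def
proof
  fix q assume q: "q \<in> D"
  show "(F \<longlongrightarrow> F q) (at q within D)"
  proof (rule tendsto_bcontfun_weighted)
    fix n
    have "((\<lambda>q. ev (c n) (F q)) \<longlongrightarrow> ev (c n) (F q)) (at q within D)"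
      using cont q unfolding continuous_on_def by blast
    then have "((\<lambda>q. ev (c n) (F q) / 2 ^ n) \<longlongrightarrow> ev (c n) (F q) / 2 ^ n) (at q within D)"
      by (intro tendsto_intros) auto
    moreover have "\<forall>\<^sub>F q' in at q within D. ev (c n) (F q') / 2 ^ n = apply_bcontfun (F q') n"
      using F apply_K by (auto simp: eventually_at_topological)
    ultimately show "((\<lambda>m. apply_bcontfun (F m) n) \<longlongrightarrow> apply_bcontfun (F q) n) (at q within D)"
      using F[OF q] apply_K by (simp add: Lim_transform_eventually)
  next
    show "\<forall>\<^sub>F m in at q within D. \<forall>n. \<bar>apply_bcontfun (F m) n\<bar> \<le> 1 / 2 ^ n"
      using F K_le by (auto simp: eventually_at_topological)
  qed (use K_le F q in auto)
qed

end

section \<open>Weak compactness and extreme points of the simplex\<close>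

context measure_simplex
begin

text \<open>The first parameter at which the curve hits \<open>x\<close> is a Borel function: inside
  \<open>X\<close> its sublevel set at \<open>r\<close> is the compact image of the parameters up to
  \<open>r\<close>.\<close>

lemma exists_borel_section:
  obtains s where "s \<in> borel_measurable borel" "\<And>x. s x \<in> {0..1}" "\<And>x. x \<in> X \<Longrightarrow> \<gamma> (s x) = x"
proof -
  define F where "F x = {t\<in>{0..1}. \<gamma> t = x}" for x
  define s where "s x = (if x \<in> X then Inf (F x) else 0)" for x
  have F_ne: "F x \<noteq> {}" if "x \<in> X" for x using curve(3) that unfolding F_def by fastforce
  have F_bdd: "bdd_below (F x)" for x unfolding F_def by (intro bdd_belowI[of _ 0]) auto
  have F_cl: "closed (F x)" for x
  proof -
    have "closed ({0..1} \<inter> \<gamma> -` {x})"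
      by (intro continuous_closed_preimage continuous_on_subset[OF curve(1)]) auto
    moreover have "{0..1} \<inter> \<gamma> -` {x} = F x" unfolding F_def by auto
    ultimately show ?thesis by simp
  qed
  have s_in: "s x \<in> F x" if "x \<in> X" for x
    using closed_contains_Inf[OF F_ne[OF that] F_bdd F_cl] that unfolding s_def by simp
  show thesis
  proof (rule that[of s])
    show "s x \<in> {0..1}" for x
      using s_in unfolding F_def s_def by (cases "x \<in> X") auto
    show "\<gamma> (s x) = x" if "x \<in> X" for x using s_in[OF that] unfolding F_def by auto
    show "s \<in> borel_measurable borel"
    proof (rule borel_measurableI_le)
      fix r
      have "s x \<le> r \<longleftrightarrow> x \<in> \<gamma> ` ({0..1} \<inter> {..r})" if x: "x \<in> X" for x
      proof
        assume "s x \<le> r"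
        then show "x \<in> \<gamma> ` ({0..1} \<inter> {..r})" using s_in[OF x] unfolding F_def by force
      next
        assume "x \<in> \<gamma> ` ({0..1} \<inter> {..r})"
        then obtain t where "t \<in> F x" "t \<le> r" unfolding F_def by auto
        then show "s x \<le> r" using cInf_lower[OF _ F_bdd] x unfolding s_def by fastforce
      qed
      moreover have "\<gamma> ` ({0..1} \<inter> {..r}) \<subseteq> X" using curve_in by auto
      ultimately have "{x. s x \<le> r} = \<gamma> ` ({0..1} \<inter> {..r}) \<union> (if 0 \<le> r then - X else {})"
        unfolding s_def by auto
      moreover have "compact (\<gamma> ` ({0..1} \<inter> {..r}))"
        by (intro compact_continuous_image continuous_on_subset[OF curve(1)] compact_Int_closed) auto
      then have "\<gamma> ` ({0..1} \<inter> {..r}) \<in> sets borel" by (intro borel_closed compact_imp_closed)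
      moreover have "- X \<in> sets borel" using X_borel by (rule borel_comp)
      ultimately show "{x \<in> space borel. s x \<le> r} \<in> sets borel" by (auto intro: sets.Un)
    qed
  qed
qed

text \<open>The section carries the measures to the unit interval, where they are tight and hence
  have a weakly convergent subsequence; the curve carries the limit back. A test function composed
  with the curve is continuous on the whole line, as weak convergence requires.\<close>

lemma prob_on_weakly_compact:
  fixes \<nu> :: "nat \<Rightarrow> 'a measure"
  assumes \<nu>: "\<And>n. \<nu> n \<in> prob_on"
  obtains r \<rho> where "strict_mono r" "\<rho> \<in> prob_on"
    "\<And>g. regular g \<Longrightarrow> (\<lambda>n. \<integral>x. g x \<partial>\<nu> (r n)) \<longlonglongrightarrow> (\<integral>x. g x \<partial>\<rho>)"
proof -
  obtain s where s: "s \<in> borel_measurable borel" "\<And>x. s x \<in> {0..1}" "\<And>x. x \<in> X \<Longrightarrow> \<gamma> (s x) = x"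
    using exists_borel_section by metis
  have s_meas: "s \<in> borel_measurable (\<nu> n)" for n using s(1) \<nu> measurable_prob_on by blast
  define M where "M n = distr (\<nu> n) borel s" for n
  have M: "real_distribution (M n)" for n
  proof -
    interpret prob_space "\<nu> n" using \<nu> by (rule prob_space_prob_on)
    show ?thesis unfolding M_def using s_meas by (intro real_distribution_distr) simp
  qed
  have "tight M"
    unfolding tight_def
  proof (intro conjI allI impI M)
    have *: "measure (M n) {-1<..2} > 1 - \<epsilon>" if e: "\<epsilon> > 0" for \<epsilon> n
    proof -
    interpret prob_space "\<nu> n" using \<nu> by (rule prob_space_prob_on)
    have "measure (M n) {-1<..2} = measure (\<nu> n) (s -` {-1<..2} \<inter> space (\<nu> n))"
      unfolding M_def using s_meas by (intro measure_distr) auto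
    also have "s -` {-1<..2} \<inter> space (\<nu> n) = space (\<nu> n)"
    proof -
      have "s x \<in> {-1<..2}" for x using s(2)[of x] by auto
      then show ?thesis by auto
    qed
    finally show ?thesis using e by (simp add: prob_space)
    qed
    show "\<exists>a b. a < b \<and> (\<forall>n. 1 - \<epsilon> < measure (M n) {a<..b})" if "\<epsilon> > 0" for \<epsilon> :: real
      using *[OF that] by (intro exI[of _ "-1"] exI[of _ "2::real"]) auto
  qed
  then obtain r N where r: "strict_mono r" "real_distribution N" "weak_conv_m (M \<circ> id \<circ> r) N"
    using tight_imp_convergent_subsubsequence[of M id] strict_mono_id by blast
  interpret N: real_distribution N by fact
  have g_meas: "\<gamma> \<in> borel_measurable borel" using curve(1) by (rule borel_measurable_continuous_onI)
  then have g_meas': "\<gamma> \<in> borel_measurable N" by simp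
  define \<rho> where "\<rho> = distr N borel \<gamma>"
  \<comment> \<open>The curve maps the whole line into \<open>X\<close>, so \<open>\<rho>\<close> is
    concentrated on \<open>X\<close> wherever \<open>N\<close> has its mass.\<close>
  have \<rho>: "\<rho> \<in> prob_on"
    unfolding prob_on_def \<rho>_def
  proof (intro CollectI conjI)
    show "prob_space (distr N borel \<gamma>)" using g_meas' by (rule N.prob_space_distr)
    show "AE x in distr N borel \<gamma>. x \<in> X"
      using curve_in by (subst AE_distr_iff[OF g_meas']) auto
  qed simp
  show thesis
  proof (rule that[OF r(1) \<rho>])
    fix g assume g: "regular g"
    obtain B where B: "\<And>x. \<bar>g x\<bar> \<le> B" using regularE[OF g] by blast
    have gm: "g \<in> borel_measurable borel" using g unfolding regular_def by auto
    have "continuous_on UNIV (\<lambda>t. g (\<gamma> t))"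
      using g unfolding regular_def
      by (intro continuous_on_compose2[OF _ curve(1), of X]) (use curve_in in auto)
    then have cont: "isCont (\<lambda>t. g (\<gamma> t)) t" for t by (simp add: continuous_on_eq_continuous_at)
    have wc: "real_distribution ((M \<circ> id \<circ> r) n)" for n using M by simp
    have "(\<lambda>n. \<integral>t. g (\<gamma> t) \<partial>(M \<circ> id \<circ> r) n) \<longlonglongrightarrow> (\<integral>t. g (\<gamma> t) \<partial>N)"
      by (rule weak_conv_imp_integral_bdd_continuous_conv[OF wc r(2,3) cont, of B]) (use B in auto)
    moreover have "(\<integral>t. g (\<gamma> t) \<partial>M n) = (\<integral>x. g x \<partial>\<nu> n)" for n
    proof -
      have "(\<integral>t. g (\<gamma> t) \<partial>M n) = (\<integral>x. g (\<gamma> (s x)) \<partial>\<nu> n)"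
        unfolding M_def using measurable_compose[OF g_meas gm] by (intro integral_distr[OF s_meas])
      also have "\<dots> = (\<integral>x. g x \<partial>\<nu> n)"
      proof (rule integral_cong_AE)
        show "AE x in \<nu> n. g (\<gamma> (s x)) = g x"
          using AE_prob_on[OF \<nu>] by eventually_elim (simp add: s(3))
        show "g \<in> borel_measurable (\<nu> n)" using gm \<nu> measurable_prob_on by blast
        have "(\<lambda>x. g (\<gamma> (s x))) \<in> borel_measurable borel" by (rule measurable_compose[OF s(1) measurable_compose[OF g_meas gm]])
        then show "(\<lambda>x. g (\<gamma> (s x))) \<in> borel_measurable (\<nu> n)" using \<nu> measurable_prob_on by blast
      qed
      finally show ?thesis .
    qed
    moreover have "(\<integral>t. g (\<gamma> t) \<partial>N) = (\<integral>x. g x \<partial>\<rho>)"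
      unfolding \<rho>_def using gm by (intro integral_distr[symmetric] g_meas')
    ultimately show "(\<lambda>n. \<integral>x. g x \<partial>\<nu> (r n)) \<longlonglongrightarrow> (\<integral>x. g x \<partial>\<rho>)" by simp
  qed
qed

lemma compact_K: "compact K"
  unfolding compact_eq_seq_compact_metric seq_compact_def
proof (intro allI impI)
  fix f :: "nat \<Rightarrow> (nat \<Rightarrow>\<^sub>C real)" assume f: "\<forall>n. f n \<in> K"
  then have m: "meas (f n) \<in> prob_on" for n using meas_in by blast
  obtain r \<rho> where r: "strict_mono r" "\<rho> \<in> prob_on"
    "\<And>g. regular g \<Longrightarrow> (\<lambda>n. ev g (f (r n))) \<longlonglongrightarrow> (\<integral>x. g x \<partial>\<rho>)"
    using prob_on_weakly_compact[of "\<lambda>n. meas (f n)"] m by auto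
  have \<rho>: "bary \<rho> \<in> K" unfolding K_def using r(2) by blast
  have "(f \<circ> r) \<longlonglongrightarrow> bary \<rho>"
  proof (rule tendsto_bcontfun_weighted)
    fix n
    have "(\<lambda>m. ev (c n) (f (r m)) / 2 ^ n) \<longlonglongrightarrow> (\<integral>x. c n x \<partial>\<rho>) / 2 ^ n"
      by (intro tendsto_intros r(3) regular_c) auto
    then show "(\<lambda>m. apply_bcontfun ((f \<circ> r) m) n) \<longlonglongrightarrow> apply_bcontfun (bary \<rho>) n"
      using f by (simp add: apply_K apply_bary[OF r(2)])
  qed (use f \<rho> K_le in auto)
  then show "\<exists>l\<in>K. \<exists>r. strict_mono r \<and> (f \<circ> r) \<longlonglongrightarrow> l" using \<rho> r(1) by blast
qed

lemma return_prob_on: "x \<in> X \<Longrightarrow> return borel x \<in> prob_on"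
  unfolding prob_on_def by (auto simp: prob_space_return AE_return)

definition dirac :: "'a \<Rightarrow> nat \<Rightarrow>\<^sub>C real" where
  "dirac x = bary (return borel x)"

lemma dirac_in: "x \<in> X \<Longrightarrow> dirac x \<in> K"
  unfolding dirac_def K_def using return_prob_on by blast

lemma ev_dirac: "x \<in> X \<Longrightarrow> g \<in> borel_measurable borel \<Longrightarrow> ev g (dirac x) = (g x :: real)"
  unfolding dirac_def by (simp add: meas_bary return_prob_on integral_return)

lemma continuous_on_dirac: "continuous_on X dirac"
proof (rule continuous_on_K_coordI)
  show "continuous_on X (\<lambda>x. ev (c n) (dirac x))" for n
    using c_cont[of n] by (subst continuous_on_cong[OF refl, of _ _ "c n"]) (auto simp: ev_dirac)
qed (rule dirac_in)

lemma X_ne: "X \<noteq> {}"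
  using curve_in by blast

lemma K_ne: "K \<noteq> {}"
  using X_ne dirac_in by blast

lemma K_eqI:
  assumes "p \<in> K" "q \<in> K" "\<And>n. ev (c n) p = ev (c n) q" shows "p = q"
  using assms by (intro bcontfun_eqI) (simp add: apply_K)

lemma dirac_inj: "inj_on dirac X"
proof (rule inj_onI)
  fix x y assume xy: "x \<in> X" "y \<in> X" "dirac x = dirac y"
  have "regular (\<lambda>z. min 1 (dist z x))"
    by (rule continuous_regular[of _ 1]) (auto intro!: continuous_intros)
  then have "(\<lambda>z. min 1 (dist z x)) \<in> borel_measurable borel" unfolding regular_def by simp
  from ev_dirac[OF xy(1) this] ev_dirac[OF xy(2) this] have "min 1 (dist x x) = min 1 (dist y x)"
    unfolding xy(3) by simp
  then show "x = y" by (simp add: min_def split: if_splits)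
qed

lemma density_prob_on:
  fixes h g :: "'a \<Rightarrow> real"
  assumes \<nu>: "\<nu> \<in> prob_on" and h: "h \<in> borel_measurable borel" "\<And>x. 0 \<le> h x" "\<And>x. h x \<le> B"
    and int: "(\<integral>x. h x \<partial>\<nu>) = 1"
  shows "density \<nu> (\<lambda>x. ennreal (h x)) \<in> prob_on"
    and "g \<in> borel_measurable borel \<Longrightarrow> (\<integral>x. g x \<partial>density \<nu> (\<lambda>x. ennreal (h x))) = (\<integral>x. h x * g x \<partial>\<nu>)"
proof -
  have hm: "h \<in> borel_measurable \<nu>" by (rule measurable_prob_on[OF \<nu> h(1)])
  have hi: "integrable \<nu> h" using h by (intro integrable_bounded_borel[OF \<nu>, of _ B]) auto
  have "(\<integral>\<^sup>+x. ennreal (h x) \<partial>\<nu>) = ennreal (\<integral>x. h x \<partial>\<nu>)"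
    using hi h(2) by (intro nn_integral_eq_integral) auto
  then have 1: "(\<integral>\<^sup>+x. ennreal (h x) \<partial>\<nu>) = 1" using int by simp
  have "emeasure (density \<nu> (\<lambda>x. ennreal (h x))) (space \<nu>) = (\<integral>\<^sup>+x. ennreal (h x) * indicator (space \<nu>) x \<partial>\<nu>)"
    using hm by (intro emeasure_density) auto
  also have "\<dots> = (\<integral>\<^sup>+x. ennreal (h x) \<partial>\<nu>)" by (intro nn_integral_cong) auto
  finally have "prob_space (density \<nu> (\<lambda>x. ennreal (h x)))" using 1 by (intro prob_spaceI) simp
  moreover have "AE x in density \<nu> (\<lambda>x. ennreal (h x)). x \<in> X"
    using AE_prob_on[OF \<nu>] hm by (subst AE_density) (auto elim: eventually_mono)
  ultimately show "density \<nu> (\<lambda>x. ennreal (h x)) \<in> prob_on"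
    unfolding prob_on_def using sets_prob_on[OF \<nu>] by simp
  show "(\<integral>x. g x \<partial>density \<nu> (\<lambda>x. ennreal (h x))) = (\<integral>x. h x * g x \<partial>\<nu>)"
    if "g \<in> borel_measurable borel"
    using hm measurable_prob_on[OF \<nu> that] h(2) by (subst integral_density) auto
qed

text \<open>Perturbing the density by \<open>\<plusminus>(c n - \<integral>c n)/2\<close> shows that every coordinate function has variance
  zero for the measure representing an extreme point.\<close>

lemma extreme_point_imp_dirac:
  assumes q: "q extreme_point_of K"
  shows "\<exists>x\<in>X. q = dirac x"
proof -
  have qK: "q \<in> K" using q unfolding extreme_point_of_def by blast
  note mq = meas_in[OF qK]
  interpret prob_space "meas q" using mq by (rule prob_space_prob_on)
  define m where "m n = ev (c n) q" for n
  have m_le: "\<bar>m n\<bar> \<le> 1" for n unfolding m_def using mq by (rule integral_c_le)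
  have int_c: "integrable (meas q) (c n)" for n using integrable_regular[OF mq regular_c] .
  have "AE x in meas q. c n x = m n" for n
  proof -
    \<comment> \<open>Since \<open>c n - m n\<close> is at most 2 in absolute value, the factor 1/2
      keeps both densities between 0 and 2.\<close>
    define d where "d \<sigma> x = 1 + \<sigma> * (c n x - m n) / 2" for \<sigma> x
    have dM: "d \<sigma> \<in> borel_measurable borel" for \<sigma>
      unfolding d_def by measurable
    have d_ge: "0 \<le> d \<sigma> x" "d \<sigma> x \<le> 2" if "\<sigma> \<in> {-1, 1}" for \<sigma> x
    proof -
      have "-2 \<le> c n x - m n" "c n x - m n \<le> 2" using c_le[of n x] m_le[of n] by linarith+
      then show "0 \<le> d \<sigma> x" "d \<sigma> x \<le> 2" using that unfolding d_def by (auto simp: field_simps)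
    qed
    have d_int: "(\<integral>x. d \<sigma> x \<partial>meas q) = 1" for \<sigma>
      unfolding d_def using int_c by (simp add: m_def prob_space)
    define \<rho> where "\<rho> \<sigma> = density (meas q) (\<lambda>x. ennreal (d \<sigma> x))" for \<sigma>
    have \<rho>: "\<rho> \<sigma> \<in> prob_on" if "\<sigma> \<in> {-1, 1}" for \<sigma>
      unfolding \<rho>_def using density_prob_on(1)[OF mq dM d_ge d_int] that by blast
    have int_\<rho>: "(\<integral>x. g x \<partial>\<rho> \<sigma>) = (\<integral>x. g x \<partial>meas q) + \<sigma> / 2 * (\<integral>x. (c n x - m n) * g x \<partial>meas q)"
      if rg: "regular g" and that: "\<sigma> \<in> {-1, 1}" for g \<sigma>
    proof -
      obtain B where B: "\<And>x. \<bar>g x\<bar> \<le> B" using regularE[OF rg] by blast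
      have gm: "g \<in> borel_measurable borel" using rg unfolding regular_def by auto
      have "\<bar>(c n x - m n) * g x\<bar> \<le> 2 * B" for x
        unfolding abs_mult using c_le[of n x] m_le[of n] B[of x] by (intro mult_mono) auto
      then have i1: "integrable (meas q) (\<lambda>x. (c n x - m n) * g x)"
        using gm mq by (intro integrable_bounded_borel[of _ _ "2 * B"]) auto
      have i2: "integrable (meas q) g" using integrable_regular[OF mq rg] .
      have "(\<integral>x. g x \<partial>\<rho> \<sigma>) = (\<integral>x. d \<sigma> x * g x \<partial>meas q)"
        unfolding \<rho>_def using density_prob_on(2)[OF mq dM d_ge d_int gm] that by blast
      also have "\<dots> = (\<integral>x. g x + \<sigma> / 2 * ((c n x - m n) * g x) \<partial>meas q)"
        unfolding d_def by (intro Bochner_Integration.integral_cong) (auto simp: field_simps)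
      also have "\<dots> = (\<integral>x. g x \<partial>meas q) + \<sigma> / 2 * (\<integral>x. (c n x - m n) * g x \<partial>meas q)"
        using i1 i2 by simp
      finally show ?thesis .
    qed
    have bK: "bary (\<rho> \<sigma>) \<in> K" if "\<sigma> \<in> {-1, 1}" for \<sigma> unfolding K_def using \<rho>[OF that] by blast
    \<comment> \<open>\<open>q\<close> is the midpoint of the two perturbed measures, so extremality
      makes them equal; comparing their \<open>n\<close>-th coordinates shows that the variance of
      \<open>c n\<close> vanishes.\<close>
    have "q = (1 - 1/2) *\<^sub>R bary (\<rho> (-1)) + (1/2) *\<^sub>R bary (\<rho> 1)"
    proof (rule bcontfun_eqI)
      fix k show "apply_bcontfun q k = apply_bcontfun ((1 - 1/2) *\<^sub>R bary (\<rho> (-1)) + (1/2) *\<^sub>R bary (\<rho> 1)) k"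
        using \<rho>[of 1] \<rho>[of "-1"] int_\<rho>[OF regular_c[of k], of 1] int_\<rho>[OF regular_c[of k], of "-1"]
        by (simp add: apply_K[OF qK] apply_bary field_simps)
    qed
    then have "bary (\<rho> (-1)) \<noteq> bary (\<rho> 1) \<Longrightarrow> q \<in> open_segment (bary (\<rho> (-1))) (bary (\<rho> 1))"
      unfolding in_segment by (intro conjI exI[of _ "1/2"]) auto
    then have "bary (\<rho> (-1)) = bary (\<rho> 1)"
      using q bK[of 1] bK[of "-1"] unfolding extreme_point_of_def by blast
    then have "apply_bcontfun (bary (\<rho> (-1))) n = apply_bcontfun (bary (\<rho> 1)) n" by simp
    then have "(\<integral>x. (c n x - m n) * c n x \<partial>meas q) = 0"
      using \<rho>[of 1] \<rho>[of "-1"] int_\<rho>[OF regular_c[of n], of 1] int_\<rho>[OF regular_c[of n], of "-1"]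
      by (simp add: apply_bary)
    moreover have "integrable (meas q) (\<lambda>x. (c n x - m n) * c n x)"
    proof (rule integrable_bounded_borel[OF mq])
      show "\<bar>(c n x - m n) * c n x\<bar> \<le> 2 * 1" for x
        unfolding abs_mult using c_le[of n x] m_le[of n] by (intro mult_mono) auto
    qed auto
    ultimately have "(\<integral>x. (c n x - m n)\<^sup>2 \<partial>meas q) = 0"
      "integrable (meas q) (\<lambda>x. (c n x - m n)\<^sup>2)"
    proof -
      assume 0: "(\<integral>x. (c n x - m n) * c n x \<partial>meas q) = 0" and i: "integrable (meas q) (\<lambda>x. (c n x - m n) * c n x)"
      have eq: "(c n x - m n)\<^sup>2 = (c n x - m n) * c n x - m n * (c n x - m n)" for x
        by (simp add: power2_eq_square algebra_simps)
      show "integrable (meas q) (\<lambda>x. (c n x - m n)\<^sup>2)" unfolding eq using i int_c by auto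
      have "(\<integral>x. (c n x - m n)\<^sup>2 \<partial>meas q) = 0 - m n * (\<integral>x. c n x - m n \<partial>meas q)"
        unfolding eq using i int_c 0 by simp
      also have "(\<integral>x. c n x - m n \<partial>meas q) = 0" using int_c by (simp add: m_def prob_space)
      finally show "(\<integral>x. (c n x - m n)\<^sup>2 \<partial>meas q) = 0" by simp
    qed
    then have "AE x in meas q. (c n x - m n)\<^sup>2 = 0"
      by (subst integral_nonneg_eq_0_iff_AE[symmetric]) auto
    then show ?thesis by simp
  qed
  then have "AE x in meas q. \<forall>n. c n x = m n" by (simp add: AE_all_countable)
  then have "AE x in meas q. x \<in> X \<and> (\<forall>n. c n x = m n)" using AE_prob_on[OF mq] by eventually_elim auto
  moreover have "ae_filter (meas q) \<noteq> bot" by (simp add: ae_filter_eq_bot_iff emeasure_space_1)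
  ultimately obtain x where x: "x \<in> X" "\<And>n. c n x = m n"
    using eventually_happens by blast
  have "q = dirac x" by (rule K_eqI[OF qK dirac_in[OF x(1)]]) (simp add: ev_dirac x m_def)
  then show ?thesis using x(1) by blast
qed

text \<open>\<open>min 1 (dist z x)\<close> is a nonnegative test function that vanishes only at
  \<open>x\<close>. Its integral is affine on \<open>K\<close>, so if it is 0 inside a segment it is
  0 at both ends, which forces both ends to be the point mass.\<close>

lemma dirac_extreme:
  assumes x: "x \<in> X" shows "dirac x extreme_point_of K"
  unfolding extreme_point_of_def
proof (intro conjI ballI notI)
  show "dirac x \<in> K" using dirac_in[OF x] .
  fix a b assume ab: "a \<in> K" "b \<in> K" "dirac x \<in> open_segment a b"
  then obtain t where t: "0 < t" "t < 1" "dirac x = (1 - t) *\<^sub>R a + t *\<^sub>R b" and ne: "a \<noteq> b"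
    unfolding in_segment by blast
  let ?g = "\<lambda>z. min 1 (dist z x)"
  have g: "regular ?g" by (rule continuous_regular[of _ 1]) (auto intro!: continuous_intros)
  then have gm: "?g \<in> borel_measurable borel" unfolding regular_def by simp
  have "(1 - t) * ev ?g a + t * ev ?g b = 0"
    using ev_affine[OF g ab(1,2), of t] t ev_dirac[OF x gm] by simp
  moreover have nn: "ev ?g p \<ge> 0" for p by simp
  moreover have "(1 - t) * ev ?g a \<ge> 0" "t * ev ?g b \<ge> 0" using t nn by (auto intro: mult_nonneg_nonneg)
  ultimately have "(1 - t) * ev ?g a = 0" "t * ev ?g b = 0" by linarith+
  then have 0: "ev ?g a = 0" "ev ?g b = 0" using t by auto
  have "p = dirac x" if p: "p \<in> K" "ev ?g p = 0" for p
  proof -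
    note mp = meas_in[OF p(1)]
    interpret prob_space "meas p" using mp by (rule prob_space_prob_on)
    have "AE z in meas p. ?g z = 0"
      using p(2) integrable_regular[OF mp g] by (subst integral_nonneg_eq_0_iff_AE[symmetric]) auto
    then have AE: "AE z in meas p. z = x" by eventually_elim (simp add: min_def split: if_splits)
    have "ev (c n) p = c n x" for n
    proof -
      have "ev (c n) p = (\<integral>z. c n x \<partial>meas p)"
        using AE measurable_prob_on[OF mp c_meas] by (intro integral_cong_AE) auto
      then show ?thesis by (simp add: prob_space)
    qed
    then show ?thesis using K_eqI[OF p(1) dirac_in[OF x]] ev_dirac[OF x c_meas] by simp
  qed
  then show False using ab 0 ne by metis
qed

lemma extreme_points_K: "{e. e extreme_point_of K} = dirac ` X"
  using extreme_point_imp_dirac dirac_extreme by auto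

end

section \<open>Representation by measures on the set of point masses\<close>

lemma apply_bcontfun_sum:
  "apply_bcontfun (sum f A) n = (\<Sum>i\<in>A. apply_bcontfun (f i) n)" for f :: "'i \<Rightarrow> ('b::topological_space \<Rightarrow>\<^sub>C 'c::real_normed_vector)"
  using linear_sum[OF bounded_linear.linear[OF bounded_linear_apply_bcontfun[of n]]] by simp

definition unit_bcontfun :: "nat \<Rightarrow> (nat \<Rightarrow>\<^sub>C real)" where
  "unit_bcontfun n = Bcontfun (\<lambda>k. if k = n then 1 else 0)"

lemma apply_unit_bcontfun: "apply_bcontfun (unit_bcontfun n) k = (if k = n then 1 else 0)"
proof -
  have "(\<lambda>k. if k = n then 1 else 0 :: real) \<in> bcontfun"
    by (rule bcontfun_normI[where b=1]) (auto intro: Topological_Spaces.continuous_on_discrete)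
  then show ?thesis unfolding unit_bcontfun_def by (simp add: Bcontfun_inverse)
qed

context measure_simplex
begin

text \<open>A bounded functional on bounded sequences need not be determined by its values at the
  unit vectors. On \<open>K\<close> it is, because the geometric decay of the coordinates makes
  truncations converge in norm, uniformly. This reduces \<open>represents_point\<close> to
  coordinates.\<close>

lemma functional_approx_K:
  fixes f :: "(nat \<Rightarrow>\<^sub>C real) \<Rightarrow> real"
  assumes f: "bounded_linear f"
  obtains B where "B > 0"
    "\<And>N p. p \<in> K \<Longrightarrow> \<bar>f p - (\<Sum>n<N. apply_bcontfun p n * f (unit_bcontfun n))\<bar> \<le> B * (1/2) ^ N"
proof -
  obtain B where B: "B > 0" "\<And>x. norm (f x) \<le> norm x * B" using bounded_linear.pos_bounded[OF f] by blast
  show thesis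
  proof (rule that[OF B(1)])
    fix N p assume p: "p \<in> K"
    define r where "r = p - (\<Sum>n<N. apply_bcontfun p n *\<^sub>R unit_bcontfun n)"
    have "norm (apply_bcontfun r k) \<le> (1/2) ^ N" for k
    proof -
      have "apply_bcontfun r k = (if k < N then 0 else apply_bcontfun p k)"
        unfolding r_def by (simp add: apply_bcontfun_sum apply_unit_bcontfun if_distrib sum.delta cong: if_cong)
      then show ?thesis
        using K_le[OF p, of k] power_decreasing[of N k "1/2::real"] by (auto simp: power_one_over)
    qed
    then have "norm r \<le> (1/2) ^ N" by (rule norm_bound)
    then have "norm r * B \<le> (1/2) ^ N * B" using B(1) by (intro mult_right_mono) auto
    moreover have "f p - (\<Sum>n<N. apply_bcontfun p n * f (unit_bcontfun n)) = f r"
      using f unfolding r_def by (simp add: linear_diff[OF bounded_linear.linear] linear_sum[OF bounded_linear.linear] linear_scale[OF bounded_linear.linear])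
    ultimately show "\<bar>f p - (\<Sum>n<N. apply_bcontfun p n * f (unit_bcontfun n))\<bar> \<le> B * (1/2) ^ N"
      using B(2)[of r] by (simp add: mult.commute)
  qed
qed

lemma measurable_extend:
  fixes f :: "'b::topological_space \<Rightarrow> 'c::topological_space"
  assumes "continuous_on A f" "A \<in> sets borel"
  shows "(\<lambda>x. if x \<in> A then f x else y) \<in> borel_measurable borel"
  using borel_measurable_continuous_on_restrict[OF assms(1)] assms(2)
  by (subst measurable_If_restrict_space_iff) auto

text \<open>A total Borel extension of \<open>dirac\<close> with values in \<open>K\<close>, so that
  the distribution of \<open>meas q\<close> under it is a measure on the whole sequence
  space.\<close>

definition dirac_ext :: "'a \<Rightarrow> (nat \<Rightarrow>\<^sub>C real)" where
  "dirac_ext x = (if x \<in> X then dirac x else dirac (SOME x. x \<in> X))"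

lemma dirac_ext_in: "dirac_ext x \<in> K"
  unfolding dirac_ext_def using dirac_in X_ne some_in_eq by metis

lemma measurable_dirac_ext: "dirac_ext \<in> borel_measurable borel"
  unfolding dirac_ext_def[abs_def] using continuous_on_dirac X_borel by (rule measurable_extend)

lemma dirac_image_borel: "dirac ` X \<in> sets borel"
  by (intro borel_closed compact_imp_closed compact_continuous_image continuous_on_dirac compact_X)

lemma represents_point_distr_dirac:
  assumes q: "q \<in> K" shows "represents_point (distr (meas q) borel dirac_ext) q"
  unfolding represents_point_def
proof (intro conjI allI impI)
  note mq = meas_in[OF q]
  interpret prob_space "meas q" using mq by (rule prob_space_prob_on)
  have dm: "dirac_ext \<in> borel_measurable (meas q)" using mq measurable_dirac_ext by (rule measurable_prob_on)
  show "prob_space (distr (meas q) borel dirac_ext)" using dm by (rule prob_space_distr)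
  show "sets (distr (meas q) borel dirac_ext) = sets borel" by simp
  fix f :: "(nat \<Rightarrow>\<^sub>C real) \<Rightarrow> real" assume f: "bounded_linear f"
  obtain B where B: "B > 0"
    "\<And>N p. p \<in> K \<Longrightarrow> \<bar>f p - (\<Sum>n<N. apply_bcontfun p n * f (unit_bcontfun n))\<bar> \<le> B * (1/2) ^ N"
    using functional_approx_K[OF f] by blast
  have fm: "f \<in> borel_measurable borel"
    using linear_continuous_on[OF f] by (rule borel_measurable_continuous_onI)
  have f0: "\<bar>f p\<bar> \<le> B" if "p \<in> K" for p using B(2)[OF that, of 0] by simp
  have fi: "integrable (meas q) (\<lambda>x. f (dirac_ext x))"
    using f0 dirac_ext_in measurable_compose[OF measurable_dirac_ext fm]
    by (intro integrable_bounded_borel[OF mq, of _ B]) auto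
  have "\<bar>(\<integral>x. f (dirac_ext x) \<partial>meas q) - f q\<bar> \<le> 0 + e" if e: "e > 0" for e
  proof -
    obtain N where "(1/2::real) ^ N < e / (2 * B)" using real_arch_pow_inv[of "e/(2*B)" "1/2"] e B(1) by auto
    then have N: "B * (1/2) ^ N < e / 2" using B(1) by (simp add: field_simps)
    let ?s = "\<lambda>x. \<Sum>n<N. c n x / 2 ^ n * f (unit_bcontfun n)"
    have si: "integrable (meas q) ?s" using integrable_regular[OF mq regular_c] by auto
    have "\<bar>(\<integral>x. f (dirac_ext x) \<partial>meas q) - (\<integral>x. ?s x \<partial>meas q)\<bar> \<le> B * (1/2) ^ N"
    proof (rule integral_diff_le[OF mq fi si])
      fix x assume x: "x \<in> X"
      show "\<bar>f (dirac_ext x) - ?s x\<bar> \<le> B * (1/2) ^ N"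
        using B(2)[OF dirac_in[OF x], of N] x
        by (simp add: dirac_ext_def apply_K[OF dirac_in] ev_dirac[OF x c_meas])
    qed
    moreover have "(\<integral>x. ?s x \<partial>meas q) = (\<Sum>n<N. apply_bcontfun q n * f (unit_bcontfun n))"
      using integrable_regular[OF mq regular_c] by (simp add: apply_K[OF q])
    ultimately show ?thesis using B(2)[OF q, of N] N by linarith
  qed
  then have "\<bar>(\<integral>x. f (dirac_ext x) \<partial>meas q) - f q\<bar> \<le> 0" by (rule field_le_epsilon)
  then have "(\<integral>x. f (dirac_ext x) \<partial>meas q) = f q" by simp
  then show "(\<integral>y. f y \<partial>distr (meas q) borel dirac_ext) = f q"
    using integral_distr[OF dm fm] by simp
qed

text \<open>The point masses form a compact copy of \<open>X\<close>, so \<open>M\<close> can be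
  carried back to a measure on \<open>X\<close>. Testing \<open>represents_point\<close> on the
  coordinate functionals shows that its barycenter is \<open>q\<close>, and \<open>bary\<close> is
  injective.\<close>

lemma represents_point_unique:
  assumes q: "q \<in> K" and M: "represents_point M q" "emeasure M (dirac ` X) = 1"
  shows "M = distr (meas q) borel dirac_ext"
proof -
  interpret prob_space M using M(1) unfolding represents_point_def by blast
  have sM: "sets M = sets borel" using M(1) unfolding represents_point_def by blast
  define x0 where "x0 = (SOME x. x \<in> X)"
  have x0: "x0 \<in> X" unfolding x0_def using X_ne some_in_eq by metis
  define r where "r y = (if y \<in> dirac ` X then the_inv_into X dirac y else x0)" for y
  have rd: "r (dirac x) = x" if "x \<in> X" for x
    using that the_inv_into_f_f[OF dirac_inj that] unfolding r_def by simp
  have "continuous_on (dirac ` X) (the_inv_into X dirac)"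
    using the_inv_into_f_f[OF dirac_inj] by (intro continuous_on_inv continuous_on_dirac compact_X) auto
  then have rm: "r \<in> borel_measurable borel"
    unfolding r_def[abs_def] using dirac_image_borel by (rule measurable_extend)
  then have rm': "r \<in> borel_measurable M" using sM by (simp cong: measurable_cong_sets)
  have rX: "r y \<in> X" for y
    unfolding r_def using x0 the_inv_into_f_f[OF dirac_inj] by auto
  have AE: "AE y in M. y \<in> dirac ` X"
    using M(2) dirac_image_borel sM by (intro AE_prob_1) (simp add: measure_def)
  define \<nu> where "\<nu> = distr M borel r"
  have \<nu>: "\<nu> \<in> prob_on"
    unfolding prob_on_def \<nu>_def using prob_space_distr[OF rm'] rX by (auto simp: AE_distr_iff[OF rm'])
  have "bary \<nu> = q"
  proof (rule bcontfun_eqI)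
    fix n
    have "(\<integral>x. c n x \<partial>\<nu>) = (\<integral>y. c n (r y) \<partial>M)" unfolding \<nu>_def by (rule integral_distr[OF rm' c_meas])
    also have "\<dots> = (\<integral>y. 2 ^ n * apply_bcontfun y n \<partial>M)"
    proof (rule integral_cong_AE)
      show "(\<lambda>y. c n (r y)) \<in> borel_measurable M" by (rule measurable_compose[OF rm' c_meas])
      have "(\<lambda>y :: nat \<Rightarrow>\<^sub>C real. 2 ^ n * apply_bcontfun y n) \<in> borel_measurable borel"
        by (intro borel_measurable_continuous_onI continuous_intros linear_continuous_on bounded_linear_apply_bcontfun)
      then show "(\<lambda>y. 2 ^ n * apply_bcontfun y n) \<in> borel_measurable M" using sM by (simp cong: measurable_cong_sets)
      show "AE y in M. c n (r y) = 2 ^ n * apply_bcontfun y n"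
        using AE by eventually_elim (auto simp: rd apply_K[OF dirac_in] ev_dirac)
    qed
    also have "\<dots> = 2 ^ n * (\<integral>y. apply_bcontfun y n \<partial>M)" by simp
    also have "(\<integral>y. apply_bcontfun y n \<partial>M) = apply_bcontfun q n"
      using M(1) bounded_linear_apply_bcontfun unfolding represents_point_def by blast
    finally show "apply_bcontfun (bary \<nu>) n = apply_bcontfun q n" by (simp add: apply_bary[OF \<nu>])
  qed
  then have "meas q = \<nu>" using meas_bary[OF \<nu>] by simp
  then have "distr (meas q) borel dirac_ext = distr M borel (dirac_ext \<circ> r)"
    unfolding \<nu>_def by (simp add: distr_distr[OF measurable_dirac_ext rm'])
  also have "\<dots> = distr M borel (\<lambda>y. y)"
    using AE rd measurable_dirac_ext rm rm' sM
    by (intro distr_cong_AE) (auto simp: dirac_ext_def intro: measurable_comp elim!: eventually_mono)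
  also have "\<dots> = M" using sM[symmetric] by (rule distr_id2)
  finally show ?thesis ..
qed

lemma choquet_simplex_K: "choquet_simplex K"
  unfolding choquet_simplex_def extreme_points_K
proof (intro conjI K_ne compact_K convex_K ballI)
  fix q assume q: "q \<in> K"
  note mq = meas_in[OF q]
  interpret prob_space "meas q" using mq by (rule prob_space_prob_on)
  have dm: "dirac_ext \<in> borel_measurable (meas q)" using mq measurable_dirac_ext by (rule measurable_prob_on)
  have "emeasure (distr (meas q) borel dirac_ext) (dirac ` X) = emeasure (meas q) (dirac_ext -` dirac ` X \<inter> space (meas q))"
    using dm dirac_image_borel by (rule emeasure_distr)
  also have "dirac_ext -` dirac ` X \<inter> space (meas q) = space (meas q)"
  proof -
    have "dirac_ext x \<in> dirac ` X" for x
      unfolding dirac_ext_def using X_ne some_in_eq by (metis imageI)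
    then show ?thesis by auto
  qed
  also have "emeasure (meas q) (space (meas q)) = 1" by (rule emeasure_space_1)
  finally have "emeasure (distr (meas q) borel dirac_ext) (dirac ` X) = 1" .
  then show "\<exists>!M. represents_point M q \<and> emeasure M (dirac ` X) = 1"
    using represents_point_distr_dirac[OF q] represents_point_unique[OF q] by blast
qed

section \<open>Push-forward maps on the simplex\<close>

definition self_map :: "('a \<Rightarrow> 'a) \<Rightarrow> bool" where
  "self_map T \<longleftrightarrow> T \<in> borel_measurable borel \<and> continuous_on X T \<and> T ` X \<subseteq> X"

definition push :: "('a \<Rightarrow> 'a) \<Rightarrow> (nat \<Rightarrow>\<^sub>C real) \<Rightarrow> (nat \<Rightarrow>\<^sub>C real)" where
  "push T q = bary (distr (meas q) borel T)"

context
  fixes T assumes T: "self_map T"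
begin

lemma distr_prob_on:
  assumes \<nu>: "\<nu> \<in> prob_on" shows "distr \<nu> borel T \<in> prob_on"
proof -
  interpret prob_space \<nu> using \<nu> by (rule prob_space_prob_on)
  have Tm: "T \<in> borel_measurable borel" "T ` X \<subseteq> X" using T unfolding self_map_def by auto
  have Tm': "T \<in> borel_measurable \<nu>" using measurable_prob_on[OF \<nu>] Tm sets_prob_on[OF \<nu>] by (simp cong: measurable_cong_sets)
  have "AE x in \<nu>. T x \<in> X" using AE_prob_on[OF \<nu>] Tm(2) by (auto elim: eventually_mono)
  then show ?thesis
    unfolding prob_on_def using prob_space_distr[OF Tm'] by (auto simp: AE_distr_iff[OF Tm'])
qed

lemma push_in: "q \<in> K \<Longrightarrow> push T q \<in> K"
  unfolding push_def using distr_prob_on meas_in unfolding K_def by blast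

lemma regular_comp:
  assumes g: "regular g" shows "regular (\<lambda>x. g (T x))"
proof -
  have "continuous_on X (\<lambda>x. g (T x))"
    using T g unfolding self_map_def regular_def by (blast intro: continuous_on_compose2)
  moreover have "(\<lambda>x. g (T x)) \<in> borel_measurable borel"
    using T g unfolding self_map_def regular_def by (blast intro: measurable_compose)
  moreover have "bounded (range (\<lambda>x. g (T x)))"
    using g unfolding regular_def by (blast intro: bounded_subset)
  ultimately show ?thesis unfolding regular_def by blast
qed

lemma ev_push:
  assumes q: "q \<in> K" and g: "g \<in> borel_measurable borel" shows "ev g (push T q) = (\<integral>x. g (T x) \<partial>meas q :: real)"
proof -
  note mq = meas_in[OF q]
  have Tm: "T \<in> borel_measurable (meas q)" using T sets_prob_on[OF mq] unfolding self_map_def by (simp cong: measurable_cong_sets)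
  show ?thesis unfolding push_def meas_bary[OF distr_prob_on[OF mq]] using Tm g by (rule integral_distr)
qed

lemma push_affine: "affine_map_on K (push T)"
  unfolding affine_map_on_def
proof (intro ballI)
  fix p q and t :: real assume pq: "p \<in> K" "q \<in> K" and t: "t \<in> {0..1}"
  have r: "(1 - t) *\<^sub>R p + t *\<^sub>R q \<in> K" "(1 - t) *\<^sub>R push T p + t *\<^sub>R push T q \<in> K"
    using convexD_alt[OF convex_K] push_in pq t by auto
  show "push T ((1 - t) *\<^sub>R p + t *\<^sub>R q) = (1 - t) *\<^sub>R push T p + t *\<^sub>R push T q"
    by (rule K_eqI) (use r pq t push_in in \<open>simp_all add: ev_push ev_affine regular_c regular_comp\<close>)
qed

lemma push_continuous: "continuous_on K (push T)"
proof (rule continuous_on_K_coordI)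
  fix n
  show "continuous_on K (\<lambda>q. ev (c n) (push T q))"
    using continuous_on_ev[OF regular_comp[OF regular_c[of n]]]
    by (subst continuous_on_cong[OF refl, of _ _ "ev (\<lambda>x. c n (T x))"]) (auto simp: ev_push)
qed (rule push_in)

lemma funpow_push_in: "q \<in> K \<Longrightarrow> (push T ^^ i) q \<in> K"
  by (induction i) (auto intro: push_in)

lemma self_map_funpow: "self_map (T ^^ i)"
proof (induction i)
  case (Suc i)
  then have "continuous_on X (T \<circ> (T ^^ i))"
    using T unfolding self_map_def by (blast intro: continuous_on_compose continuous_on_subset)
  moreover have "T \<circ> (T ^^ i) \<in> borel_measurable borel"
    using Suc T unfolding self_map_def by (blast intro: measurable_comp)
  ultimately show ?case using Suc T unfolding self_map_def by (simp add: image_comp[symmetric]) blast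
qed (simp add: self_map_def)

end

lemma ev_push_funpow:
  assumes T: "self_map T" and q: "q \<in> K" and g: "g \<in> borel_measurable borel"
  shows "ev g ((push T ^^ i) q) = (\<integral>x. g ((T ^^ i) x) \<partial>meas q :: real)"
  using g
proof (induction i arbitrary: g)
  case (Suc i)
  have "(\<lambda>x. g (T x)) \<in> borel_measurable borel"
    using T Suc.prems unfolding self_map_def by (blast intro: measurable_compose)
  then show ?case using Suc by (simp add: ev_push[OF T funpow_push_in[OF T q]])
qed simp

lemma push_inverse:
  assumes T: "self_map T" "self_map T'" and inv: "\<And>x. x \<in> X \<Longrightarrow> T' (T x) = x" and q: "q \<in> K"
  shows "push T' (push T q) = q"
proof (rule K_eqI)
  fix n
  note mq = meas_in[OF q]
  have cT': "(\<lambda>x. c n (T' x)) \<in> borel_measurable borel"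
    using regular_comp[OF T(2) regular_c] unfolding regular_def by blast
  have "ev (c n) (push T' (push T q)) = (\<integral>x. c n (T' (T x)) \<partial>meas q)"
    using q by (simp add: ev_push T push_in cT')
  also have "\<dots> = ev (c n) q"
  proof (rule integral_cong_AE)
    show "AE x in meas q. c n (T' (T x)) = c n x"
      using AE_prob_on[OF mq] by eventually_elim (simp add: inv)
    show "(\<lambda>x. c n (T' (T x))) \<in> borel_measurable (meas q)"
      using regular_comp[OF T(1) regular_comp[OF T(2) regular_c]] regular_measurable[OF mq] by blast
    show "c n \<in> borel_measurable (meas q)" using measurable_prob_on[OF mq c_meas] .
  qed
  finally show "ev (c n) (push T' (push T q)) = ev (c n) q" .
qed (use q T push_in in auto)

lemma affine_system_push:
  assumes T: "self_map T" "self_map T'" and inv: "\<And>x. x \<in> X \<Longrightarrow> T' (T x) = x" "\<And>x. x \<in> X \<Longrightarrow> T (T' x) = x"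
  shows "affine_system K (push T)"
  unfolding affine_system_def
proof (intro conjI choquet_simplex_K push_affine T(1) exI)
  show "homeomorphism K K (push T) (push T')"
    by (rule homeomorphismI)
      (use push_continuous push_in push_inverse[OF T inv(1)] push_inverse[OF T(2,1) inv(2)] T in auto)
qed

end

section \<open>Covering numbers of the simplex of measures\<close>

text \<open>Hoeffding's lemma on an interval of length \<open>2 * b\<close> gives the constant;
  negative \<open>l\<close> is reduced to positive \<open>l\<close> by passing to the negative of
  \<open>z\<close>.\<close>

lemma expectation_exp_le:
  fixes z :: "'a \<Rightarrow> real"
  assumes "prob_space M" and z: "z \<in> borel_measurable M" "\<And>x. \<bar>z x\<bar> \<le> b" "(\<integral>x. z x \<partial>M) = 0" and b: "b > 0"
  shows "(\<integral>x. exp (l * z x) \<partial>M) \<le> exp (l\<^sup>2 * b\<^sup>2 / 2)"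
proof -
  interpret prob_space M by fact
  have int: "integrable M (\<lambda>x. exp (l * y x))" if "y \<in> borel_measurable M" "\<And>x. \<bar>y x\<bar> \<le> b" for l y
  proof (rule integrable_const_bound[of _ "exp (\<bar>l\<bar> * b)"])
    show "AE x in M. norm (exp (l * y x)) \<le> exp (\<bar>l\<bar> * b)"
    proof (rule AE_I2)
      fix x
      have "l * y x \<le> \<bar>l\<bar> * \<bar>y x\<bar>" by (metis abs_ge_self abs_mult)
      also have "\<dots> \<le> \<bar>l\<bar> * b" using that(2) by (intro mult_left_mono) auto
      finally show "norm (exp (l * y x)) \<le> exp (\<bar>l\<bar> * b)" by simp
    qed
  qed (use that in auto)
  have pos: "(\<integral>x. exp (l * y x) \<partial>M) \<le> exp (l\<^sup>2 * b\<^sup>2 / 2)"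
    if l: "l > 0" and y: "y \<in> borel_measurable M" "\<And>x. \<bar>y x\<bar> \<le> b" "(\<integral>x. y x \<partial>M) = 0" for l y
  proof -
    interpret interval_bounded_random_variable M y "- b" b
      by unfold_locales (use y in \<open>auto simp: abs_le_iff minus_le_iff\<close>)
    have "ennreal (\<integral>x. exp (l * y x) \<partial>M) = (\<integral>\<^sup>+x. ennreal (exp (l * y x)) \<partial>M)"
      using int[OF y(1,2)] by (intro nn_integral_eq_integral[symmetric]) auto
    also have "\<dots> \<le> ennreal (exp (l\<^sup>2 * (b - - b)\<^sup>2 / 8))"
      using Hoeffdings_lemma_nn_integral_0[OF l y(3)] .
    also have "l\<^sup>2 * (b - - b)\<^sup>2 / 8 = l\<^sup>2 * b\<^sup>2 / 2" by (simp add: power2_eq_square)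
    finally show ?thesis by simp
  qed
  consider "l > 0" | "l = 0" | "l < 0" by linarith
  then show ?thesis
  proof cases
    case 1 then show ?thesis using pos z by blast
  next
    case 2 then show ?thesis by (simp add: prob_space)
  next
    case 3 then show ?thesis using pos[of "- l" "\<lambda>x. - z x"] z by simp
  qed
qed

text \<open>The points are chosen one at a time so that the exponential moments do not exceed their
  expected growth.\<close>

lemma exists_empirical_approximation:
  fixes v :: "'r \<Rightarrow> 'a \<Rightarrow> real"
  assumes M: "prob_space M" and X: "AE x in M. x \<in> X" and R: "finite R"
    and v: "\<And>r. r \<in> R \<Longrightarrow> v r \<in> borel_measurable M" "\<And>r x. r \<in> R \<Longrightarrow> \<bar>v r x\<bar> \<le> 1"
    and \<epsilon>: "\<epsilon> > 0" and m: "m > 0" "real m \<ge> 8 * ln (2 * card R) / \<epsilon>\<^sup>2"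
  obtains xs where "length xs = m" "set xs \<subseteq> X"
    "\<And>r. r \<in> R \<Longrightarrow> \<bar>(\<integral>x. v r x \<partial>M) - (\<Sum>x\<leftarrow>xs. v r x) / m\<bar> \<le> \<epsilon>"
proof -
  interpret prob_space M by fact
  define e where "e r = (\<integral>x. v r x \<partial>M)" for r
  have vi: "integrable M (v r)" if "r \<in> R" for r
    using v that by (intro integrable_const_bound[of _ 1]) auto
  have e1: "\<bar>e r\<bar> \<le> 1" if "r \<in> R" for r
  proof -
    have "\<bar>e r\<bar> \<le> (\<integral>x. \<bar>v r x\<bar> \<partial>M)" unfolding e_def by (rule integral_abs_bound)
    also have "\<dots> \<le> (\<integral>x. 1 \<partial>M)" using v(2) that vi by (intro integral_mono) auto
    finally show ?thesis by (simp add: prob_space)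
  qed
  \<comment> \<open>With this \<open>l\<close> the growth \<open>2 * l^2 * m\<close> and the
    logarithm of the initial value, at most \<open>m * \<epsilon>^2 / 8\<close>, add up exactly to
    \<open>l * m * \<epsilon>\<close>.\<close>
  define l where "l = \<epsilon> / 4"
  have l: "l > 0" using \<epsilon> unfolding l_def by simp
  define s where "s r xs = (\<Sum>x\<leftarrow>xs. v r x - e r)" for r and xs :: "'a list"
  \<comment> \<open>Both signs are kept so that \<open>\<Phi>\<close> dominates
    \<open>exp (l * \<bar>s r xs\<bar>)\<close> for every \<open>r\<close>; its value at the empty
    list is \<open>2 * card R\<close>.\<close>
  define \<Phi> where "\<Phi> xs = (\<Sum>r\<in>R. exp (l * s r xs) + exp (- l * s r xs))" for xs
  have step: "\<exists>x\<in>X. \<Phi> (x # xs) \<le> exp (2 * l\<^sup>2) * \<Phi> xs" for xs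
  proof (rule ccontr)
    assume "\<not> ?thesis"
    then have gt: "AE x in M. exp (2 * l\<^sup>2) * \<Phi> xs < \<Phi> (x # xs)"
      using X by (auto simp: not_le elim: eventually_mono)
    have split: "\<Phi> (x # xs) = (\<Sum>r\<in>R. exp (l * s r xs) * exp (l * (v r x - e r)) + exp (- l * s r xs) * exp (- l * (v r x - e r)))" for x
      unfolding \<Phi>_def s_def by (simp add: exp_add[symmetric] algebra_simps)
    have int: "integrable M (\<lambda>x. exp (k * (v r x - e r)))"
      and le: "(\<integral>x. exp (k * (v r x - e r)) \<partial>M) \<le> exp (2 * k\<^sup>2)" if r: "r \<in> R" for r k
    proof -
      have b: "\<bar>v r x - e r\<bar> \<le> 2" for x using v(2)[OF r, of x] e1[OF r] by linarith
      have "\<bar>k * (v r x - e r)\<bar> \<le> \<bar>k\<bar> * 2" for x unfolding abs_mult using b by (intro mult_left_mono) auto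
      then have "exp (k * (v r x - e r)) \<le> exp (\<bar>k\<bar> * 2)" for x by (simp add: abs_le_iff)
      then show "integrable M (\<lambda>x. exp (k * (v r x - e r)))"
        using v(1)[OF r] by (intro integrable_const_bound[of _ "exp (\<bar>k\<bar> * 2)"]) auto
      have "(\<integral>x. v r x - e r \<partial>M) = 0" using vi[OF r] by (simp add: e_def prob_space)
      then have "(\<integral>x. exp (k * (v r x - e r)) \<partial>M) \<le> exp (k\<^sup>2 * 2\<^sup>2 / 2)"
        using v(1)[OF r] b by (intro expectation_exp_le M) auto
      then show "(\<integral>x. exp (k * (v r x - e r)) \<partial>M) \<le> exp (2 * k\<^sup>2)" by (simp add: mult.commute)
    qed
    have \<Phi>i: "integrable M (\<lambda>x. \<Phi> (x # xs))" 
      unfolding split by (intro Bochner_Integration.integrable_sum Bochner_Integration.integrable_add integrable_mult_right int)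
    have "exp (2 * l\<^sup>2) * \<Phi> xs < (\<integral>x. \<Phi> (x # xs) \<partial>M)" using \<Phi>i gt by (rule expectation_greater)
    also have "\<dots> = (\<Sum>r\<in>R. exp (l * s r xs) * (\<integral>x. exp (l * (v r x - e r)) \<partial>M)
        + exp (- l * s r xs) * (\<integral>x. exp (- l * (v r x - e r)) \<partial>M))"
    proof -
      have i: "integrable M (\<lambda>x. exp (l * s r xs) * exp (l * (v r x - e r)))"
        "integrable M (\<lambda>x. exp (- l * s r xs) * exp (- l * (v r x - e r)))" if "r \<in> R" for r
        using that by (intro integrable_mult_right int; simp)+
      have "(\<integral>x. \<Phi> (x # xs) \<partial>M) = (\<Sum>r\<in>R. \<integral>x. exp (l * s r xs) * exp (l * (v r x - e r)) + exp (- l * s r xs) * exp (- l * (v r x - e r)) \<partial>M)"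
        unfolding split by (rule Bochner_Integration.integral_sum) (intro Bochner_Integration.integrable_add i)
      also have "\<dots> = (\<Sum>r\<in>R. exp (l * s r xs) * (\<integral>x. exp (l * (v r x - e r)) \<partial>M)
        + exp (- l * s r xs) * (\<integral>x. exp (- l * (v r x - e r)) \<partial>M))"
        by (intro sum.cong refl, subst Bochner_Integration.integral_add[OF i]) auto
      finally show ?thesis .
    qed
    also have "\<dots> \<le> (\<Sum>r\<in>R. exp (l * s r xs) * exp (2 * l\<^sup>2) + exp (- l * s r xs) * exp (2 * l\<^sup>2))"
      using le[of _ l] le[of _ "- l"] by (intro sum_mono add_mono mult_left_mono) auto
    also have "\<dots> = exp (2 * l\<^sup>2) * \<Phi> xs" unfolding \<Phi>_def by (simp add: sum_distrib_left algebra_simps)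
    finally show False by simp
  qed
  have "\<exists>xs. length xs = k \<and> set xs \<subseteq> X \<and> \<Phi> xs \<le> exp (2 * l\<^sup>2) ^ k * (2 * card R)" for k
  proof (induction k)
    case 0 then show ?case by (simp add: \<Phi>_def s_def)
  next
    case (Suc k)
    then obtain xs where xs: "length xs = k" "set xs \<subseteq> X" "\<Phi> xs \<le> exp (2 * l\<^sup>2) ^ k * (2 * card R)" by blast
    obtain x where x: "x \<in> X" "\<Phi> (x # xs) \<le> exp (2 * l\<^sup>2) * \<Phi> xs" using step by blast
    note x(2)
    also have "exp (2 * l\<^sup>2) * \<Phi> xs \<le> exp (2 * l\<^sup>2) * (exp (2 * l\<^sup>2) ^ k * (2 * card R))"
      using xs(3) by (intro mult_left_mono) auto
    finally show ?case using xs x by (intro exI[of _ "x # xs"]) (simp add: mult.assoc)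
  qed
  then obtain xs where xs: "length xs = m" "set xs \<subseteq> X" "\<Phi> xs \<le> exp (2 * l\<^sup>2) ^ m * (2 * card R)" by blast
  show thesis
  proof (rule that[OF xs(1,2)])
    fix r assume r: "r \<in> R"
    have "exp (l * \<bar>s r xs\<bar>) \<le> exp (l * s r xs) + exp (- l * s r xs)"
      by (cases "s r xs \<ge> 0") (auto simp: abs_if)
    also have "\<dots> \<le> \<Phi> xs" unfolding \<Phi>_def using R r by (intro member_le_sum) (auto simp: add_nonneg_nonneg)
    also note xs(3)
    also have "exp (2 * l\<^sup>2) ^ m * (2 * card R) = exp (2 * l\<^sup>2 * m + ln (2 * card R))"
    proof -
      have "card R > 0" using R r by (auto simp: card_gt_0_iff)
      then show ?thesis by (simp add: exp_add exp_of_nat_mult[symmetric] mult.commute)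
    qed
    finally have "l * \<bar>s r xs\<bar> \<le> 2 * l\<^sup>2 * m + ln (2 * card R)" by simp
    also have "ln (2 * card R) \<le> m * \<epsilon>\<^sup>2 / 8" using m(2) \<epsilon> by (simp add: field_simps)
    also have "2 * l\<^sup>2 * m + m * \<epsilon>\<^sup>2 / 8 = l * (m * \<epsilon>)" unfolding l_def by (simp add: power2_eq_square field_simps)
    finally have "\<bar>s r xs\<bar> \<le> m * \<epsilon>" using l by simp
    moreover have "(\<Sum>x\<leftarrow>xs. v r x) = s r xs + m * e r"
      unfolding s_def using xs(1) by (simp add: sum_list_subtractf sum_list_triv)
    then have "e r - (\<Sum>x\<leftarrow>xs. v r x) / m = - (s r xs / m)" using m(1) by (simp add: add_divide_distrib)
    then have "\<bar>e r - (\<Sum>x\<leftarrow>xs. v r x) / m\<bar> = \<bar>s r xs\<bar> / m" by simp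
    ultimately show "\<bar>(\<integral>x. v r x \<partial>M) - (\<Sum>x\<leftarrow>xs. v r x) / m\<bar> \<le> \<epsilon>"
      using m(1) unfolding e_def[symmetric] by (simp add: divide_le_eq mult.commute)
  qed
qed

text \<open>A word of \<open>O(log n)\<close> cells, chosen among polynomially many cells, has a
  number of possibilities whose logarithm is a product of two logarithms, hence
  \<open>o(n)\<close>.\<close>

lemma polylog_power_subexponential:
  fixes \<eta> a C d k :: real
  assumes "\<eta> > 0" "C > 0" "d > 0"
  shows "\<forall>\<^sub>F n :: nat in sequentially. k * (a * ln (d * n) + 2) * ln (C * n) \<le> \<eta> * n"
proof -
  have "((\<lambda>n :: nat. k * (a * ln (d * n) + 2) * ln (C * n) / n) \<longlongrightarrow> 0) sequentially"
    using assms(2,3) by real_asymp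
  then have "\<forall>\<^sub>F n :: nat in sequentially. k * (a * ln (d * n) + 2) * ln (C * n) / n < \<eta>"
    using assms(1) by (rule order_tendstoD)
  then show ?thesis using eventually_gt_at_top[of 0]
    by eventually_elim (simp add: field_simps)
qed

context measure_simplex
begin

lemma dist_K_le:
  assumes pq: "p \<in> K" "q \<in> K" and \<epsilon>: "2 * (1/2) ^ N \<le> \<epsilon>"
    and le: "\<And>n. n < N \<Longrightarrow> \<bar>ev (c n) p - ev (c n) q\<bar> \<le> \<epsilon>"
  shows "dist p q \<le> \<epsilon>"
proof (rule dist_bound)
  fix n
  show "dist (apply_bcontfun p n) (apply_bcontfun q n) \<le> \<epsilon>"
  proof (cases "n < N")
    case True
    have "dist (apply_bcontfun p n) (apply_bcontfun q n) = \<bar>ev (c n) p - ev (c n) q\<bar> / 2 ^ n"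
      using pq by (simp add: apply_K dist_real_def flip: diff_divide_distrib)
    also have "\<dots> \<le> \<bar>ev (c n) p - ev (c n) q\<bar> / 1" by (intro divide_left_mono) auto
    finally show ?thesis using le[OF True] by simp
  next
    case False
    have "dist (apply_bcontfun p n) (apply_bcontfun q n) \<le> 1 / 2 ^ n + 1 / 2 ^ n"
      unfolding dist_real_def using K_le[OF pq(1), of n] K_le[OF pq(2), of n] by linarith
    also have "\<dots> \<le> 2 * (1/2) ^ N"
      using power_decreasing[of N n "1/2::real"] False by (simp add: power_one_over)
    finally show ?thesis using \<epsilon> by linarith
  qed
qed

lemma uniformly_close_c:
  assumes "\<epsilon> > 0"
  obtains \<delta> where "\<delta> > 0" "\<And>n x y. n < N \<Longrightarrow> x \<in> X \<Longrightarrow> y \<in> X \<Longrightarrow> dist x y < \<delta> \<Longrightarrow> \<bar>c n x - c n y\<bar> < \<epsilon>"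
proof -
  have "\<exists>\<delta>>0. \<forall>x\<in>X. \<forall>y\<in>X. dist x y < \<delta> \<longrightarrow> \<bar>c n x - c n y\<bar> < \<epsilon>" for n
    using compact_uniformly_continuous[OF c_cont[of n] compact_X] assms
    unfolding uniformly_continuous_on_def dist_real_def by (metis dist_commute)
  then obtain \<delta> where \<delta>: "\<And>n. \<delta> n > 0" "\<And>n x y. x \<in> X \<Longrightarrow> y \<in> X \<Longrightarrow> dist x y < \<delta> n \<Longrightarrow> \<bar>c n x - c n y\<bar> < \<epsilon>"
    by metis
  show thesis
  proof (rule that)
    show "Min (insert 1 (\<delta> ` {..<N})) > 0" using \<delta>(1) by (subst Min_gr_iff) auto
    fix n x y assume "n < N" "x \<in> X" "y \<in> X" "dist x y < Min (insert 1 (\<delta> ` {..<N}))"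
    then show "\<bar>c n x - c n y\<bar> < \<epsilon>" using \<delta>(2)[of x y n] by auto
  qed
qed

text \<open>A measure is determined, up to a small error in \<open>n\<close> iterates of finitely many coordinates, by
  the cells containing the points of an empirical approximation of length \<open>O(log n)\<close>.\<close>

lemma subexponential_covers_push:
  assumes T: "self_map T"
    and poly: "\<And>\<delta>. \<delta> > 0 \<Longrightarrow> \<exists>C>0. \<forall>n\<ge>1. \<exists>\<P>. finite \<P> \<and> real (card \<P>) \<le> (C * real n) ^ k \<and> X \<subseteq> \<Union>\<P> \<and>
      (\<forall>D\<in>\<P>. \<forall>x\<in>D \<inter> X. \<forall>y\<in>D \<inter> X. \<forall>i<n. dist ((T ^^ i) x) ((T ^^ i) y) < \<delta>)"
  shows "subexponential_covers K (push T)"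
  unfolding subexponential_covers_def
proof (intro allI impI)
  fix \<delta> \<eta> :: real assume \<delta>: "\<delta> > 0" and \<eta>: "\<eta> > 0"
  obtain N0 where "(1/2::real) ^ N0 < \<delta> / 4" using real_arch_pow_inv[of "\<delta>/4" "1/2"] \<delta> by auto
  moreover define N where "N = Suc N0"
  ultimately have N: "2 * (1/2) ^ N \<le> \<delta> / 2" "N > 0" using \<delta> by auto
  \<comment> \<open>Three errors of this size arise, two from empirical approximations and one from
    sharing cells, and \<open>3 * \<epsilon> \<le> \<delta> / 2\<close>. The other half leaves room
    for the strict inequality.\<close>
  define \<epsilon> where "\<epsilon> = \<delta> / 8"
  have \<epsilon>: "\<epsilon> > 0" using \<delta> unfolding \<epsilon>_def by simp
  obtain \<delta>' where \<delta>': "\<delta>' > 0" "\<And>n x y. n < N \<Longrightarrow> x \<in> X \<Longrightarrow> y \<in> X \<Longrightarrow> dist x y < \<delta>' \<Longrightarrow> \<bar>c n x - c n y\<bar> < \<epsilon>"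
    using uniformly_close_c[OF \<epsilon>, of N] by metis
  obtain C where C: "C > 0" "\<And>n. n \<ge> 1 \<Longrightarrow> \<exists>\<P>. finite \<P> \<and> real (card \<P>) \<le> (C * real n) ^ k \<and> X \<subseteq> \<Union>\<P> \<and>
      (\<forall>D\<in>\<P>. \<forall>x\<in>D \<inter> X. \<forall>y\<in>D \<inter> X. \<forall>i<n. dist ((T ^^ i) x) ((T ^^ i) y) < \<delta>')"
    using poly[OF \<delta>'(1)] by blast
  let ?a = "8 / \<epsilon>\<^sup>2"
  have "\<forall>\<^sub>F n :: nat in sequentially. real k * (?a * ln (real (2 * N) * real n) + 2) * ln (C * n) \<le> \<eta> * n"
    using \<eta> C(1) N(2) by (intro polylog_power_subexponential) auto
  moreover have "\<forall>\<^sub>F n :: nat in sequentially. 1 \<le> C * real n"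
    using C(1) by real_asymp
  ultimately show "\<forall>\<^sub>F n in sequentially. \<exists>\<C>. finite \<C> \<and> real (card \<C>) \<le> exp (\<eta> * real n) \<and> K \<subseteq> \<Union>\<C> \<and>
      (\<forall>D\<in>\<C>. \<forall>x\<in>D. \<forall>y\<in>D. \<forall>i<n. dist ((push T ^^ i) x) ((push T ^^ i) y) < \<delta>)"
    using eventually_ge_at_top[of 1]
  proof eventually_elim
    case (elim n)
    obtain \<P> where P: "finite \<P>" "real (card \<P>) \<le> (C * real n) ^ k" "X \<subseteq> \<Union>\<P>"
      "\<And>D x y i. D \<in> \<P> \<Longrightarrow> x \<in> D \<inter> X \<Longrightarrow> y \<in> D \<inter> X \<Longrightarrow> i < n \<Longrightarrow> dist ((T ^^ i) x) ((T ^^ i) y) < \<delta>'"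
      using C(2)[OF elim(3)] by metis
    obtain cell where cell: "\<And>x. x \<in> X \<Longrightarrow> cell x \<in> \<P>" "\<And>x. x \<in> X \<Longrightarrow> x \<in> cell x"
    proof -
      have "\<forall>x\<in>X. \<exists>D. D \<in> \<P> \<and> x \<in> D" using P(3) by blast
      then obtain cell where "\<forall>x\<in>X. cell x \<in> \<P> \<and> x \<in> cell x" by (rule bchoice[THEN exE])
      then show thesis using that by blast
    qed
    define R where "R = {..<n} \<times> {..<N}"
    define v where "v r x = c (snd r) ((T ^^ fst r) x)" for r :: "nat \<times> nat" and x
    have R: "finite R" "card R = n * N" unfolding R_def by auto
    have v_reg: "regular (v r)" for r
      unfolding v_def using regular_comp[OF self_map_funpow[OF T] regular_c] .
    have v_le: "\<bar>v r x\<bar> \<le> 1" for r x unfolding v_def by (rule c_le)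
    define m where "m = nat \<lceil>?a * ln (2 * card R)\<rceil> + 1"
    have "ln (2 * real (card R)) \<ge> 0"
    proof -
      have "1 * 1 \<le> n * N" using elim(3) N(2) by (intro mult_le_mono) auto
      then have "1 \<le> 2 * card R" unfolding R by simp
      then have "1 \<le> 2 * real (card R)" by linarith
      then show ?thesis by (rule ln_ge_zero)
    qed
    then have a0: "?a * ln (2 * real (card R)) \<ge> 0" by simp
    have m: "m > 0" "real m \<ge> 8 * ln (2 * card R) / \<epsilon>\<^sup>2" "real m \<le> ?a * ln (real (2 * N) * real n) + 2"
    proof -
      show "m > 0" unfolding m_def by simp
      have "real (nat \<lceil>?a * ln (2 * card R)\<rceil>) = of_int \<lceil>?a * ln (2 * card R)\<rceil>" using a0 by simp
      moreover have "?a * ln (2 * card R) = 8 * ln (2 * card R) / \<epsilon>\<^sup>2" by simp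
      moreover have "?a * ln (2 * card R) = ?a * ln (real (2 * N) * real n)" unfolding R by (simp add: mult_ac)
      ultimately show "real m \<ge> 8 * ln (2 * card R) / \<epsilon>\<^sup>2" "real m \<le> ?a * ln (real (2 * N) * real n) + 2"
        unfolding m_def by linarith+
    qed
    \<comment> \<open>\<open>\<sigma>\<close> is the word of cells that contain the sample points.
      Only the word labels a member of the cover, so there are at most \<open>card \<P> ^ m\<close>
      members.\<close>
    define good where "good \<sigma> xs q \<longleftrightarrow> length xs = m \<and> set xs \<subseteq> X \<and> map cell xs = \<sigma> \<and>
      (\<forall>r\<in>R. \<bar>ev (v r) q - (\<Sum>x\<leftarrow>xs. v r x) / m\<bar> \<le> \<epsilon>)" for \<sigma> xs q
    define D where "D \<sigma> = {q\<in>K. \<exists>xs. good \<sigma> xs q}" for \<sigma>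
    let ?L = "{\<sigma>. set \<sigma> \<subseteq> \<P> \<and> length \<sigma> = m}"
    have L: "finite ?L" "card ?L = card \<P> ^ m"
      using P(1) finite_lists_length_eq card_lists_length_eq by auto
    show ?case
    proof (intro exI[of _ "D ` ?L"] conjI)
      show "finite (D ` ?L)" using L(1) by simp
      have "real (card (D ` ?L)) \<le> real (card \<P> ^ m)"
        using card_image_le[OF L(1), of D] L(2) by simp
      also have "\<dots> \<le> ((C * real n) ^ k) ^ m" unfolding of_nat_power using P(2) by (intro power_mono) auto
      also have "\<dots> = exp (real k * real m * ln (C * n))"
      proof -
        have "C * real n > 0" using elim(2) by linarith
        then have "((C * real n) ^ k) ^ m = exp (ln (C * real n)) ^ (k * m)" by (simp add: power_mult)
        then show ?thesis by (simp flip: exp_of_nat_mult)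
      qed
      also have "\<dots> \<le> exp (real k * (?a * ln (real (2 * N) * real n) + 2) * ln (C * n))"
        using m(3) elim(2) by (subst exp_le_cancel_iff) (intro mult_right_mono mult_left_mono ln_ge_zero; simp)
      also have "\<dots> \<le> exp (\<eta> * real n)" using elim(1) by simp
      finally show "real (card (D ` ?L)) \<le> exp (\<eta> * real n)" .
      show "K \<subseteq> \<Union>(D ` ?L)"
      proof
        fix q assume q: "q \<in> K"
        note mq = meas_in[OF q]
        obtain xs where xs: "length xs = m" "set xs \<subseteq> X"
          "\<And>r. r \<in> R \<Longrightarrow> \<bar>ev (v r) q - (\<Sum>x\<leftarrow>xs. v r x) / m\<bar> \<le> \<epsilon>"
          using exists_empirical_approximation[where v=v, OF prob_space_prob_on[OF mq] AE_prob_on[OF mq] R(1)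
              regular_measurable[OF mq v_reg] v_le \<epsilon> m(1,2)] by metis
        have "good (map cell xs) xs q" unfolding good_def using xs by blast
        moreover have "map cell xs \<in> ?L" using xs(1,2) cell(1) by auto
        ultimately show "q \<in> \<Union>(D ` ?L)" unfolding D_def using q by blast
      qed
      show "\<forall>E\<in>D ` ?L. \<forall>p\<in>E. \<forall>q\<in>E. \<forall>i<n. dist ((push T ^^ i) p) ((push T ^^ i) q) < \<delta>"
      proof (intro ballI allI impI)
        fix E p q i assume E: "E \<in> D ` ?L" "p \<in> E" "q \<in> E" and i: "i < n"
        then obtain \<sigma> xs ys where p: "p \<in> K" "good \<sigma> xs p" and q: "q \<in> K" "good \<sigma> ys q"
          unfolding D_def by blast
        have len: "length xs = m" "length ys = m" and X: "set xs \<subseteq> X" "set ys \<subseteq> X"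
          and eq: "map cell xs = map cell ys" using p(2) q(2) unfolding good_def by auto
        have "dist ((push T ^^ i) p) ((push T ^^ i) q) \<le> \<delta> / 2"
        proof (rule dist_K_le[OF funpow_push_in[OF T p(1)] funpow_push_in[OF T q(1)] N(1)])
          fix j assume j: "j < N"
          let ?r = "(i, j)"
          have r: "?r \<in> R" unfolding R_def using i j by simp
          have "\<bar>(\<Sum>x\<leftarrow>xs. v ?r x) - (\<Sum>x\<leftarrow>ys. v ?r x)\<bar> = \<bar>\<Sum>l<m. v ?r (xs ! l) - v ?r (ys ! l)\<bar>"
            using len by (simp add: sum_list_sum_nth atLeast0LessThan sum_subtractf)
          also have "\<dots> \<le> (\<Sum>l<m. \<epsilon>)"
          proof (rule order_trans[OF sum_abs sum_mono])
            fix l assume l: "l \<in> {..<m}"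
            then have in_X: "xs ! l \<in> X" "ys ! l \<in> X" using X len by (auto simp: subset_iff)
            have ceq: "cell (xs ! l) = cell (ys ! l)" using eq l len by (metis lessThan_iff nth_map)
            have "ys ! l \<in> cell (xs ! l)" unfolding ceq using in_X(2) by (rule cell(2))
            then have "dist ((T ^^ i) (xs ! l)) ((T ^^ i) (ys ! l)) < \<delta>'"
              using P(4)[OF cell(1)[OF in_X(1)] _ _ i] cell(2)[OF in_X(1)] in_X by blast
            moreover have "(T ^^ i) (xs ! l) \<in> X" "(T ^^ i) (ys ! l) \<in> X"
              using self_map_funpow[OF T, of i] in_X unfolding self_map_def by auto
            ultimately show "\<bar>v ?r (xs ! l) - v ?r (ys ! l)\<bar> \<le> \<epsilon>"
              unfolding v_def using \<delta>'(2)[OF j] by (auto intro: less_imp_le)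
          qed
          finally have "\<bar>(\<Sum>x\<leftarrow>xs. v ?r x) / m - (\<Sum>x\<leftarrow>ys. v ?r x) / m\<bar> \<le> \<epsilon>"
            using m(1) by (simp add: divide_le_eq mult.commute flip: diff_divide_distrib)
          moreover have "\<bar>ev (v ?r) p - (\<Sum>x\<leftarrow>xs. v ?r x) / m\<bar> \<le> \<epsilon>" "\<bar>ev (v ?r) q - (\<Sum>x\<leftarrow>ys. v ?r x) / m\<bar> \<le> \<epsilon>"
            using p(2) q(2) r unfolding good_def by auto
          ultimately have "\<bar>ev (v ?r) p - ev (v ?r) q\<bar> \<le> \<delta> / 2" unfolding \<epsilon>_def using \<delta> by linarith
          then show "\<bar>ev (c j) ((push T ^^ i) p) - ev (c j) ((push T ^^ i) q)\<bar> \<le> \<delta> / 2"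
            by (simp add: ev_push_funpow[OF T] p(1) q(1) v_def)
        qed
        then show "dist ((push T ^^ i) p) ((push T ^^ i) q) < \<delta>" using \<delta> by linarith
      qed
    qed
  qed
qed

end

section \<open>A space-filling curve\<close>

text \<open>Even and of period 2, equal to 0 on [0, 1/3] and to 1 on [2/3, 1]: a trigonometric
  version of the function in Schoenberg's space-filling curve.\<close>

definition schoenberg_bump :: "real \<Rightarrow> real" where
  "schoenberg_bump t = max 0 (min 1 (1/2 - cos (pi * t)))"

text \<open>The bump reads ternary digits of \<open>t\<close>: \<open>j = 0\<close> uses those in
  even positions and \<open>j = 1\<close> those in odd positions as the binary digits of the
  value.\<close>

definition schoenberg_coord :: "nat \<Rightarrow> real \<Rightarrow> real" where
  "schoenberg_coord j t = (\<Sum>i. schoenberg_bump (3 ^ (2 * i + j) * t) / 2 ^ Suc i)"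

lemma continuous_on_schoenberg_coord: "continuous_on UNIV (schoenberg_coord j)"
proof -
  define f where "f i t = schoenberg_bump (3 ^ (2 * i + j) * t) / 2 ^ Suc i" for i t
  have "norm (f i t) \<le> (1/2) ^ i" for i t
    unfolding f_def schoenberg_bump_def by (simp add: power_one_over divide_simps max_def min_def)
  then have "uniform_limit UNIV (\<lambda>n t. \<Sum>i<n. f i t) (\<lambda>t. \<Sum>i. f i t) sequentially"
    by (intro Weierstrass_m_test[where M="\<lambda>i. (1/2) ^ i"]) (auto simp: summable_geometric)
  then have "continuous_on UNIV (\<lambda>t. \<Sum>i. f i t)"
    unfolding f_def schoenberg_bump_def
    by (rule uniform_limit_theorem[rotated]) (auto intro!: always_eventually continuous_intros)
  then show ?thesis unfolding schoenberg_coord_def f_def by simp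
qed

text \<open>Multiplication by \<open>3 ^ m\<close> turns the digits before position \<open>m\<close>
  into an even integer, which the period 2 removes. The tail after digit \<open>m\<close> adds at
  most 1/3, so the argument lies in [0, 1/3] or [2/3, 1] according to that digit.\<close>

lemma schoenberg_bump_ternary:
  assumes d: "\<And>j. d j \<in> {0, 1 :: nat}"
  shows "schoenberg_bump (3 ^ m * (\<Sum>j. 2 * real (d j) / 3 ^ Suc j)) = d m"
proof -
  define f where "f j = 2 * real (d j) / 3 ^ Suc j" for j
  have d1: "real (d j) \<le> 1" for j using d[of j] by auto
  have f_le: "f j \<le> 2/3 * (1/3) ^ j" "f j \<ge> 0" for j
    using d1[of j] unfolding f_def by (auto simp: power_one_over divide_simps)
  have geo: "(\<lambda>j. 2/3 * (1/3::real) ^ j) sums (2/3 * (1 / (1 - 1/3)))"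
    by (intro sums_mult geometric_sums) simp
  have f_sum: "summable f"
    by (rule summable_comparison_test'[OF sums_summable[OF geo], of 0]) (use f_le in auto)
  define r where "r = (\<Sum>j. f (j + Suc m))"
  have f_sum': "summable (\<lambda>j. f (j + Suc m))" using f_sum by (subst summable_iff_shift)
  have r0: "r \<ge> 0" unfolding r_def using f_le(2) f_sum' by (intro suminf_nonneg)
  have shift_le: "f (j + Suc m) \<le> (1/3) ^ Suc m * (2/3 * (1/3) ^ j)" for j
    using f_le(1)[of "j + Suc m"] by (simp add: power_add mult_ac)
  have "r \<le> (\<Sum>j. (1/3) ^ Suc m * (2/3 * (1/3) ^ j))"
    unfolding r_def using shift_le f_sum' summable_mult[OF sums_summable[OF geo]] by (rule suminf_le)
  also have "\<dots> = (1/3) ^ Suc m"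
    using sums_unique[OF sums_mult[OF geo, of "(1/3) ^ Suc m"]] by simp
  finally have r1: "3 ^ m * r \<le> 1/3" by (simp add: power_one_over divide_simps mult.commute)
  have sf: "(\<Sum>j. f j) = r + (\<Sum>j<Suc m. f j)"
    unfolding r_def using suminf_split_initial_segment[OF f_sum, of "Suc m"] by simp
  define k where "k = (\<Sum>j<m. d j * 3 ^ (m - Suc j))"
  have "3 ^ m * f j = 2 * real (d j * 3 ^ (m - Suc j))" if "j < m" for j
  proof -
    have "(3::real) ^ m = 3 ^ (m - Suc j) * 3 ^ Suc j" using that by (metis Suc_leI le_add_diff_inverse2 power_add)
    then show ?thesis unfolding f_def by simp
  qed
  then have "3 ^ m * (\<Sum>j<m. f j) = 2 * real k"
    unfolding k_def by (simp add: sum_distrib_left)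
  moreover have "3 ^ m * f m = 2 * real (d m) / 3" unfolding f_def by simp
  ultimately have eq: "3 ^ m * (\<Sum>j. f j) = 2 * real k + (2 * real (d m) / 3 + 3 ^ m * r)"
    unfolding sf by (simp add: algebra_simps)
  define x where "x = 2 * real (d m) / 3 + 3 ^ m * r"
  have c: "cos (pi * (3 ^ m * (\<Sum>j. f j))) = cos (pi * x)"
    using cos.plus_of_nat[of "pi * x" k] unfolding eq x_def[symmetric] by (simp add: algebra_simps)
  have r0': "0 \<le> 3 ^ m * r" using r0 by simp
  show ?thesis
  proof (cases "d m = 0")
    case True
    have "pi * x \<le> pi / 3" "0 \<le> pi * x" using r1 r0' True unfolding x_def by auto
    then have "cos (pi / 3) \<le> cos (pi * x)" by (intro cos_monotone_0_pi_le) auto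
    then show ?thesis using True c unfolding schoenberg_bump_def f_def[symmetric] by (simp add: cos_60)
  next
    case False
    then have dm: "d m = 1" using d[of m] by auto
    have "x \<le> 1" "2/3 \<le> x" using r1 r0' dm unfolding x_def by auto
    then have "pi * x \<le> pi * 1" "pi * (2/3) \<le> pi * x" by (intro mult_left_mono; simp)+
    then have "cos (pi * x) \<le> cos (2 * pi / 3)" by (intro cos_monotone_0_pi_le) auto
    then show ?thesis using dm c unfolding schoenberg_bump_def f_def[symmetric] by (simp add: cos_120)
  qed
qed

text \<open>The digits are the defects \<open>a (Suc i) - 2 * a i\<close> of the dyadic floors, and
  the series telescopes.\<close>

lemma binary_expansion:
  assumes u: "0 \<le> u" "u < (1::real)"
  obtains d where "\<And>i. d i \<in> {0, 1 :: nat}" "(\<lambda>i. real (d i) / 2 ^ Suc i) sums u"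
proof -
  define a where "a i = \<lfloor>2 ^ i * u\<rfloor>" for i
  have b: "2 * a i \<le> a (Suc i)" "a (Suc i) \<le> 2 * a i + 1" for i
    unfolding a_def by (simp_all add: mult.assoc; linarith)+
  define d where "d i = nat (a (Suc i) - 2 * a i)" for i
  have "d i \<in> {0, 1}" for i using b[of i] unfolding d_def by auto
  moreover have "(\<lambda>i. a i / 2 ^ i) \<longlonglongrightarrow> u"
  proof (rule LIMSEQ_I)
    fix e :: real assume "e > 0"
    then obtain N where N: "(1/2::real) ^ N < e" using real_arch_pow_inv[of e "1/2"] by auto
    show "\<exists>no. \<forall>n\<ge>no. norm (a n / 2 ^ n - u) < e"
    proof (intro exI allI impI)
      fix n assume n: "N \<le> n"
      have "\<bar>a n - 2 ^ n * u\<bar> \<le> 1" unfolding a_def by linarith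
      then have "\<bar>(a n - 2 ^ n * u) / 2 ^ n\<bar> \<le> 1 / 2 ^ n" by (simp add: divide_right_mono)
      also have "\<dots> \<le> (1/2) ^ N" using n power_decreasing[of N n "1/2::real"] by (simp add: power_one_over)
      finally show "norm (a n / 2 ^ n - u) < e" using N by (simp add: diff_divide_distrib)
    qed
  qed
  then have "(\<lambda>i. a (Suc i) / 2 ^ Suc i - a i / 2 ^ i) sums (u - a 0 / 2 ^ 0)" by (rule telescope_sums)
  moreover have "a 0 = 0" using u unfolding a_def by (simp add: floor_eq_iff)
  moreover have "a (Suc i) / 2 ^ Suc i - a i / 2 ^ i = real (d i) / 2 ^ Suc i" for i
    using b[of i] unfolding d_def by (simp add: field_simps)
  ultimately show thesis using that[of d] by simp
qed

lemma schoenberg_surj: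
  assumes u: "0 \<le> u" "u < 1" and v: "0 \<le> v" "v < 1"
  obtains t where "t \<in> {0..1}" "schoenberg_coord 0 t = u" "schoenberg_coord 1 t = v"
proof -
  obtain d where d: "\<And>i. d i \<in> {0, 1 :: nat}" "(\<lambda>i. real (d i) / 2 ^ Suc i) sums u"
    using binary_expansion[OF u] by blast
  obtain e where e: "\<And>i. e i \<in> {0, 1 :: nat}" "(\<lambda>i. real (e i) / 2 ^ Suc i) sums v"
    using binary_expansion[OF v] by blast
  define g where "g j = (if even j then d (j div 2) else e (j div 2))" for j
  have g: "g j \<in> {0, 1}" for j unfolding g_def using d(1) e(1) by presburger
  define t where "t = (\<Sum>j. 2 * real (g j) / 3 ^ Suc j)"
  have bump: "schoenberg_bump (3 ^ m * t) = g m" for m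
    unfolding t_def by (rule schoenberg_bump_ternary[OF g])
  have geo: "(\<lambda>j. 2/3 * (1/3::real) ^ j) sums 1"
    using sums_mult[OF geometric_sums[of "1/3::real"], of "2/3"] by simp
  have le: "2 * real (g j) / 3 ^ Suc j \<le> 2/3 * (1/3) ^ j" for j
    using g[of j] by (auto simp: power_one_over)
  have s: "summable (\<lambda>j. 2 * real (g j) / 3 ^ Suc j)"
    by (rule summable_comparison_test'[OF sums_summable[OF geo], of 0]) (use le in auto)
  show thesis
  proof (rule that[of t])
    have "t \<le> 1"
      unfolding t_def using suminf_le[OF le s sums_summable[OF geo]] sums_unique[OF geo] by simp
    moreover have "t \<ge> 0" unfolding t_def using s by (intro suminf_nonneg) auto
    ultimately show "t \<in> {0..1}" by simp
    show "schoenberg_coord 0 t = u"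
      unfolding schoenberg_coord_def bump using sums_unique[OF d(2)] by (simp add: g_def)
    show "schoenberg_coord 1 t = v"
      unfolding schoenberg_coord_def bump using sums_unique[OF e(2)] by (simp add: g_def)
  qed
qed

section \<open>The torus and its characters\<close>

definition torus :: "(complex \<times> complex) set" where
  "torus = sphere 0 1 \<times> sphere 0 1"

definition torus_curve :: "real \<Rightarrow> complex \<times> complex" where
  "torus_curve t = (cis (2 * pi * schoenberg_coord 0 t), cis (2 * pi * schoenberg_coord 1 t))"

definition chr :: "int \<Rightarrow> int \<Rightarrow> complex \<times> complex \<Rightarrow> complex" where
  "chr a b x = fst x powi a * snd x powi b"

text \<open>The index type is countable, so \<open>from_nat\<close> enumerates the coordinates. The
  value 0 off the torus gives a global bound, which powers do not have.\<close>

definition torus_coord :: "int \<times> int \<times> bool \<Rightarrow> complex \<times> complex \<Rightarrow> real" where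
  "torus_coord = (\<lambda>(a, b, r) x. if x \<in> torus then (if r then Re (chr a b x) else Im (chr a b x)) else 0)"

lemma torus_norm: "x \<in> torus \<Longrightarrow> norm (fst x) = 1" "x \<in> torus \<Longrightarrow> norm (snd x) = 1"
  unfolding torus_def by auto

lemma torus_nonzero: "x \<in> torus \<Longrightarrow> fst x \<noteq> 0" "x \<in> torus \<Longrightarrow> snd x \<noteq> 0"
  using torus_norm by fastforce+

lemma compact_torus: "compact torus"
  unfolding torus_def by (intro compact_Times) auto

lemma norm_chr: "x \<in> torus \<Longrightarrow> norm (chr a b x) = 1"
  unfolding chr_def by (simp add: norm_mult norm_power_int torus_norm)

lemma chr_add: "x \<in> torus \<Longrightarrow> chr (a + a') (b + b') x = chr a b x * chr a' b' x"
  unfolding chr_def by (simp add: power_int_add torus_nonzero)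

lemma chr_minus: "x \<in> torus \<Longrightarrow> chr (- a) (- b) x = cnj (chr a b x)"
proof -
  have "z powi (- n) = cnj (z powi n)" if "norm z = 1" for z :: complex and n
  proof -
    have "norm (z powi n) = 1" using that by (simp add: norm_power_int)
    then have "z powi n * cnj (z powi n) = 1" by (metis complex_norm_square of_real_1 one_power2)
    then have "inverse (z powi n) = cnj (z powi n)" by (rule inverse_unique)
    then show ?thesis by (simp add: power_int_minus)
  qed
  then show "x \<in> torus \<Longrightarrow> chr (- a) (- b) x = cnj (chr a b x)" unfolding chr_def by (simp add: torus_norm)
qed

lemma chr_0: "chr 0 0 x = 1"
  unfolding chr_def by simp

lemma continuous_on_chr: "continuous_on torus (chr a b)"
  unfolding chr_def[abs_def] by (intro continuous_intros) (auto dest: torus_nonzero)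

lemma torus_coord_simps:
  "x \<in> torus \<Longrightarrow> torus_coord (a, b, True) x = Re (chr a b x)"
  "x \<in> torus \<Longrightarrow> torus_coord (a, b, False) x = Im (chr a b x)"
  unfolding torus_coord_def by auto

lemma continuous_on_torus_coord: "continuous_on torus (torus_coord i)"
proof -
  obtain a b r where i: "i = (a, b, r)" by (cases i) auto
  have "continuous_on torus (\<lambda>x. if r then Re (chr a b x) else Im (chr a b x))"
    by (cases r) (auto intro!: continuous_intros continuous_on_chr)
  then show ?thesis by (rule continuous_on_eq) (simp add: i torus_coord_def)
qed

lemma torus_coord_le: "\<bar>torus_coord i x\<bar> \<le> 1"
proof -
  obtain a b r where i: "i = (a, b, r)" by (cases i) auto
  show ?thesis
    using norm_chr[of x a b] abs_Re_le_cmod[of "chr a b x"] abs_Im_le_cmod[of "chr a b x"]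
    unfolding i torus_coord_def by auto
qed

lemma torus_borel: "torus \<in> sets borel"
  using compact_torus by (simp add: borel_closed compact_imp_closed)

lemma torus_coord_measurable: "torus_coord i \<in> borel_measurable borel"
proof -
  have "torus_coord i = (\<lambda>x. if x \<in> torus then torus_coord i x else 0)"
    by (cases i) (auto simp: torus_coord_def)
  also have "\<dots> \<in> borel_measurable borel"
    using borel_measurable_continuous_on_restrict[OF continuous_on_torus_coord[of i]] torus_borel
    by (subst measurable_If_restrict_space_iff) auto
  finally show ?thesis .
qed

definition trig :: "(complex \<times> complex \<Rightarrow> real) \<Rightarrow> bool" where
  "trig g \<longleftrightarrow> (\<exists>F \<alpha>. finite F \<and> (\<forall>x\<in>torus. g x = (\<Sum>i\<in>F. \<alpha> i * torus_coord i x)))"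

lemma trig_coord: "trig (torus_coord i)"
  unfolding trig_def by (intro exI[of _ "{i}"] exI[of _ "\<lambda>_. 1"]) auto

lemma trig_cong: "trig g \<Longrightarrow> (\<And>x. x \<in> torus \<Longrightarrow> h x = g x) \<Longrightarrow> trig h"
  unfolding trig_def by metis

lemma trig_add: assumes "trig g" "trig h" shows "trig (\<lambda>x. g x + h x)"
proof -
  obtain F \<alpha> where F: "finite F" "\<And>x. x \<in> torus \<Longrightarrow> g x = (\<Sum>i\<in>F. \<alpha> i * torus_coord i x)"
    using assms(1) unfolding trig_def by blast
  obtain G \<beta> where G: "finite G" "\<And>x. x \<in> torus \<Longrightarrow> h x = (\<Sum>i\<in>G. \<beta> i * torus_coord i x)"
    using assms(2) unfolding trig_def by blast
  have "g x + h x = (\<Sum>i\<in>F \<union> G. ((if i \<in> F then \<alpha> i else 0) + (if i \<in> G then \<beta> i else 0)) * torus_coord i x)"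
    if x: "x \<in> torus" for x
  proof -
    have "(\<Sum>i\<in>F. \<alpha> i * torus_coord i x) = (\<Sum>i\<in>F \<union> G. (if i \<in> F then \<alpha> i else 0) * torus_coord i x)"
      using F G by (intro sum.mono_neutral_cong_left) auto
    moreover have "(\<Sum>i\<in>G. \<beta> i * torus_coord i x) = (\<Sum>i\<in>F \<union> G. (if i \<in> G then \<beta> i else 0) * torus_coord i x)"
      using F G by (intro sum.mono_neutral_cong_left) auto
    ultimately show ?thesis using F(2)[OF x] G(2)[OF x] by (simp add: sum.distrib distrib_right)
  qed
  then show ?thesis unfolding trig_def using F(1) G(1)
    by (intro exI[of _ "F \<union> G"] exI[of _ "\<lambda>i. (if i \<in> F then \<alpha> i else 0) + (if i \<in> G then \<beta> i else 0)"]) blast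
qed

lemma trig_scale: assumes "trig g" shows "trig (\<lambda>x. k * g x)"
proof -
  obtain F \<alpha> where F: "finite F" "\<And>x. x \<in> torus \<Longrightarrow> g x = (\<Sum>i\<in>F. \<alpha> i * torus_coord i x)"
    using assms(1) unfolding trig_def by blast
  then have "\<And>x. x \<in> torus \<Longrightarrow> k * g x = (\<Sum>i\<in>F. (k * \<alpha> i) * torus_coord i x)"
    by (simp add: sum_distrib_left mult.assoc)
  then show ?thesis unfolding trig_def using F(1) by (intro exI[of _ F] exI[of _ "\<lambda>i. k * \<alpha> i"]) auto
qed

lemma trig_sum: "finite F \<Longrightarrow> (\<And>i. i \<in> F \<Longrightarrow> trig (g i)) \<Longrightarrow> trig (\<lambda>x. \<Sum>i\<in>F. g i x)"
proof (induction F rule: finite_induct)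
  case empty
  then show ?case using trig_scale[OF trig_coord, of 0] by simp
next
  case (insert i F)
  then show ?case using trig_add[of "g i" "\<lambda>x. \<Sum>i\<in>F. g i x"] by simp
qed

lemma trig_Re: "trig (\<lambda>x. Re (chr a b x))" and trig_Im: "trig (\<lambda>x. Im (chr a b x))"
  by (rule trig_cong[OF trig_coord[of "(a, b, True)"]] trig_cong[OF trig_coord[of "(a, b, False)"]];
      simp add: torus_coord_simps)+

text \<open>Product-to-sum formulas: the sum of the frequencies comes from \<open>chr_add\<close>,
  the difference from conjugation. This makes \<open>trig\<close> closed under products, as
  Stone-Weierstrass requires.\<close>

lemma trig_mult_coord: "trig (\<lambda>x. torus_coord i x * torus_coord j x)"
proof -
  obtain a b r a' b' r' where ij: "i = (a, b, r)" "j = (a', b', r')" by (cases i, cases j) auto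
  have p: "chr (a + a') (b + b') x = chr a b x * chr a' b' x" if "x \<in> torus" for x
    using that by (rule chr_add)
  have m: "chr (a - a') (b - b') x = chr a b x * cnj (chr a' b' x)" if "x \<in> torus" for x
    using chr_add[OF that, of a "- a'" b "- b'"] chr_minus[OF that] by simp
  show ?thesis
  proof (cases r; cases r')
    assume r: "r" "r'"
    show ?thesis
      by (rule trig_cong[OF trig_scale[OF trig_add[OF trig_Re[of "a + a'" "b + b'"] trig_Re[of "a - a'" "b - b'"]], of "1/2"]])
        (simp add: ij r torus_coord_simps p m)
  next
    assume r: "r" "\<not> r'"
    show ?thesis
      by (rule trig_cong[OF trig_add[OF trig_scale[OF trig_Im[of "a + a'" "b + b'"], of "1/2"] trig_scale[OF trig_Im[of "a - a'" "b - b'"], of "- 1/2"]]])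
        (simp only: ij r torus_coord_simps p m, simp add: field_simps)
  next
    assume r: "\<not> r" "r'"
    show ?thesis
      by (rule trig_cong[OF trig_scale[OF trig_add[OF trig_Im[of "a + a'" "b + b'"] trig_Im[of "a - a'" "b - b'"]], of "1/2"]])
        (simp add: ij r torus_coord_simps p m)
  next
    assume r: "\<not> r" "\<not> r'"
    show ?thesis
      by (rule trig_cong[OF trig_add[OF trig_scale[OF trig_Re[of "a + a'" "b + b'"], of "- 1/2"] trig_scale[OF trig_Re[of "a - a'" "b - b'"], of "1/2"]]])
        (simp only: ij r torus_coord_simps p m, simp add: field_simps)
  qed
qed

lemma trig_mult: assumes "trig g" "trig h" shows "trig (\<lambda>x. g x * h x)"
proof -
  obtain F \<alpha> where F: "finite F" "\<And>x. x \<in> torus \<Longrightarrow> g x = (\<Sum>i\<in>F. \<alpha> i * torus_coord i x)"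
    using assms(1) unfolding trig_def by blast
  obtain G \<beta> where G: "finite G" "\<And>x. x \<in> torus \<Longrightarrow> h x = (\<Sum>i\<in>G. \<beta> i * torus_coord i x)"
    using assms(2) unfolding trig_def by blast
  have "trig (\<lambda>x. \<Sum>i\<in>F. \<Sum>j\<in>G. (\<alpha> i * \<beta> j) * (torus_coord i x * torus_coord j x))"
    using F(1) G(1) by (intro trig_sum trig_scale trig_mult_coord)
  then show ?thesis
    by (rule trig_cong) (simp add: F(2) G(2) sum_product mult_ac)
qed

lemma trig_dense:
  assumes g: "continuous_on torus g" and e: "e > (0::real)"
  obtains h where "trig h" "\<And>x. x \<in> torus \<Longrightarrow> \<bar>g x - h x\<bar> < e"
proof -
  interpret function_ring_on "{h. trig h \<and> continuous_on torus h}" torus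
  proof unfold_locales
    show "compact torus" by (rule compact_torus)
    show "(\<lambda>_. k) \<in> {h. trig h \<and> continuous_on torus h}" for k
      using trig_cong[OF trig_scale[OF trig_Re[of 0 0], of k], of "\<lambda>_. k"] by (simp add: chr_0)
    fix x y assume "x \<in> torus" "y \<in> torus" "x \<noteq> y"
    then have "chr 1 0 x \<noteq> chr 1 0 y \<or> chr 0 1 x \<noteq> chr 0 1 y" unfolding chr_def by (auto simp: prod_eq_iff)
    then obtain a b where "chr a b x \<noteq> chr a b y" by blast
    then have "Re (chr a b x) \<noteq> Re (chr a b y) \<or> Im (chr a b x) \<noteq> Im (chr a b y)" by (auto simp: complex_eq_iff)
    moreover have "(\<lambda>x. Re (chr a b x)) \<in> {h. trig h \<and> continuous_on torus h}"
      using trig_Re continuous_on_Re[OF continuous_on_chr] by simp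
    moreover have "(\<lambda>x. Im (chr a b x)) \<in> {h. trig h \<and> continuous_on torus h}"
      using trig_Im continuous_on_Im[OF continuous_on_chr] by simp
    ultimately show "\<exists>f\<in>{h. trig h \<and> continuous_on torus h}. f x \<noteq> f y" by (elim disjE) (rule bexI; assumption)+
  qed (auto intro: trig_add trig_mult continuous_intros)
  show thesis using Stone_Weierstrass_basic[OF g e] that by blast
qed

lemma torus_curve_surj: "torus \<subseteq> torus_curve ` {0..1}"
proof
  fix x assume x: "x \<in> torus"
  have "\<exists>u. 0 \<le> u \<and> u < 1 \<and> z = cis (2 * pi * u)" if z: "norm z = 1" for z
  proof -
    have "z = cis (Arg2pi z)" using Arg2pi_eq[of z] z by (simp add: cis_conv_exp)
    moreover have "0 \<le> Arg2pi z / (2 * pi)" "Arg2pi z / (2 * pi) < 1"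
      using Arg2pi_ge_0[of z] Arg2pi_lt_2pi[of z] by (auto simp: divide_less_eq)
    ultimately show ?thesis by (intro exI[of _ "Arg2pi z / (2 * pi)"]) auto
  qed
  then obtain u v where u: "0 \<le> u" "u < 1" "fst x = cis (2 * pi * u)" and v: "0 \<le> v" "v < 1" "snd x = cis (2 * pi * v)"
    using torus_norm[OF x] by metis
  obtain t where "t \<in> {0..1}" "schoenberg_coord 0 t = u" "schoenberg_coord 1 t = v"
    using schoenberg_surj[OF u(1,2) v(1,2)] by blast
  then show "x \<in> torus_curve ` {0..1}"
    unfolding torus_curve_def using u(3) v(3) by (intro image_eqI[of _ _ t]) (auto simp: prod_eq_iff)
qed

interpretation torus: measure_simplex torus torus_curve "\<lambda>n. torus_coord (from_nat n)"
proof
  show "continuous_on UNIV torus_curve"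
    unfolding torus_curve_def cis_conv_exp
    by (intro continuous_intros continuous_on_schoenberg_coord)
  show "range torus_curve \<subseteq> torus" unfolding torus_curve_def torus_def by auto
  show "torus \<subseteq> torus_curve ` {0..1}" by (rule torus_curve_surj)
  fix g :: "complex \<times> complex \<Rightarrow> real" and e :: real assume g: "continuous_on torus g" "e > 0"
  obtain h where h: "trig h" "\<And>x. x \<in> torus \<Longrightarrow> \<bar>g x - h x\<bar> < e" using trig_dense[OF g] by blast
  obtain F \<alpha> where F: "finite F" "\<And>x. x \<in> torus \<Longrightarrow> h x = (\<Sum>i\<in>F. \<alpha> i * torus_coord i x)"
    using h(1) unfolding trig_def by blast
  define N where "N = Suc (Max (insert 0 (to_nat ` F)))"
  have N: "to_nat ` F \<subseteq> {..<N}" unfolding N_def using F(1) by (auto simp: less_Suc_eq_le)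
  define a where "a n = (if n \<in> to_nat ` F then \<alpha> (from_nat n) else 0)" for n
  have "h x = (\<Sum>n<N. a n * torus_coord (from_nat n) x)" if x: "x \<in> torus" for x
  proof -
    have "h x = (\<Sum>n\<in>to_nat ` F. \<alpha> (from_nat n) * torus_coord (from_nat n) x)"
      using F(2)[OF x] by (subst sum.reindex) auto
    also have "\<dots> = (\<Sum>n<N. a n * torus_coord (from_nat n) x)"
      using N by (intro sum.mono_neutral_cong_left) (auto simp: a_def)
    finally show ?thesis .
  qed
  then show "\<exists>N a. \<forall>x\<in>torus. \<bar>g x - (\<Sum>n<N. a n * torus_coord (from_nat n) x)\<bar> < e"
    using h(2) by metis
qed (rule torus_coord_measurable continuous_on_torus_coord torus_coord_le)+

section \<open>A skew product on the torus\<close>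

lemma affine_map_on_sum:
  assumes K: "convex K" and f: "affine_map_on K f" and I: "finite I"
    and a: "\<And>i. i \<in> I \<Longrightarrow> a i \<ge> 0" "sum a I = 1" and y: "\<And>i. i \<in> I \<Longrightarrow> y i \<in> K"
  shows "f (\<Sum>i\<in>I. a i *\<^sub>R y i) = (\<Sum>i\<in>I. a i *\<^sub>R f (y i))"
  using I a y
proof (induction I arbitrary: a rule: finite_induct)
  case (insert i I)
  have ai: "0 \<le> a i" "a i = 1 - sum a I" "0 \<le> sum a I" using insert by (auto intro!: sum_nonneg)
  show ?case
  proof (cases "sum a I = 0")
    case True
    then have "\<forall>j\<in>I. a j = 0" using insert by (simp add: sum_nonneg_eq_0_iff)
    then show ?thesis using ai insert True by simp
  next
    case False
    define b where "b j = a j / sum a I" for j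
    have b: "\<And>j. j \<in> I \<Longrightarrow> b j \<ge> 0" "sum b I = 1"
      using insert.prems(1) ai False unfolding b_def by (auto simp: sum_divide_distrib[symmetric])
    have ab: "a j = sum a I * b j" for j using False unfolding b_def by simp
    have "(\<Sum>j\<in>insert i I. a j *\<^sub>R y j) = (1 - sum a I) *\<^sub>R y i + sum a I *\<^sub>R (\<Sum>j\<in>I. b j *\<^sub>R y j)"
      using insert.hyps ai(2) by (simp add: scaleR_sum_right flip: ab)
    moreover have "(\<Sum>j\<in>I. b j *\<^sub>R y j) \<in> K" using K insert b by (intro convex_sum) auto
    ultimately have "f (\<Sum>j\<in>insert i I. a j *\<^sub>R y j) = (1 - sum a I) *\<^sub>R f (y i) + sum a I *\<^sub>R f (\<Sum>j\<in>I. b j *\<^sub>R y j)"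
      using f ai insert.prems(3) unfolding affine_map_on_def by simp
    also have "f (\<Sum>j\<in>I. b j *\<^sub>R y j) = (\<Sum>j\<in>I. b j *\<^sub>R f (y j))" using insert b by (intro insert.IH) auto
    also have "(1 - sum a I) *\<^sub>R f (y i) + sum a I *\<^sub>R (\<Sum>j\<in>I. b j *\<^sub>R f (y j)) = (\<Sum>j\<in>insert i I. a j *\<^sub>R f (y j))"
      using insert.hyps ai(2) by (simp add: scaleR_sum_right flip: ab)
    finally show ?thesis .
  qed
qed simp

text \<open>\<open>S\<close> moves the averages of an orbit only by a telescoped boundary term of
  norm at most \<open>2 * B / (n + 1)\<close>, so a limit point of the averages is fixed.\<close>

lemma affine_fixed_point:
  fixes K :: "'a::real_normed_vector set"
  assumes K: "compact K" "convex K" "K \<noteq> {}" and S: "affine_map_on K S" "continuous_on K S" "S \<in> K \<rightarrow> K"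
  obtains p where "p \<in> K" "S p = p"
proof -
  obtain x where x: "x \<in> K" using K(3) by blast
  have Sx: "(S ^^ i) x \<in> K" for i using S(3) x by (induction i) auto
  define y where "y n = (\<Sum>i<Suc n. (1 / real (Suc n)) *\<^sub>R (S ^^ i) x)" for n
  have yK: "y n \<in> K" for n unfolding y_def using K(2) Sx by (intro convex_sum) auto
  have Sy: "S (y n) = (\<Sum>i<Suc n. (1 / real (Suc n)) *\<^sub>R (S ^^ Suc i) x)" for n
    unfolding y_def using affine_map_on_sum[OF K(2) S(1), of "{..<Suc n}" "\<lambda>_. 1 / real (Suc n)" "\<lambda>i. (S ^^ i) x"] Sx
    by (simp del: sum.lessThan_Suc)
  have diff: "S (y n) - y n = (1 / real (Suc n)) *\<^sub>R ((S ^^ Suc n) x - x)" for n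
  proof -
    have "S (y n) - y n = (\<Sum>i<Suc n. (1 / real (Suc n)) *\<^sub>R ((S ^^ Suc i) x - (S ^^ i) x))"
      unfolding Sy unfolding y_def by (simp only: sum_subtractf scaleR_right_diff_distrib)
    also have "\<dots> = (1 / real (Suc n)) *\<^sub>R (\<Sum>i<Suc n. (S ^^ Suc i) x - (S ^^ i) x)"
      by (simp only: scaleR_sum_right)
    also have "(\<Sum>i<Suc n. (S ^^ Suc i) x - (S ^^ i) x) = (S ^^ Suc n) x - (S ^^ 0) x"
      by (rule sum_lessThan_telescope)
    finally show ?thesis by simp
  qed
  obtain B where B: "\<And>z. z \<in> K \<Longrightarrow> norm z \<le> B" using compact_imp_bounded[OF K(1)] unfolding bounded_iff by blast
  have lim0: "(\<lambda>n. S (y n) - y n) \<longlonglongrightarrow> 0"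
  proof (rule Lim_null_comparison)
    show "\<forall>\<^sub>F n in sequentially. norm (S (y n) - y n) \<le> (2 * B) * (1 / real (Suc n))"
    proof (intro always_eventually allI)
      fix n
      have "norm ((S ^^ Suc n) x - x) \<le> norm ((S ^^ Suc n) x) + norm x" by (rule norm_triangle_ineq4)
      also have "\<dots> \<le> 2 * B" using B[OF Sx[of "Suc n"]] B[OF x] by simp
      finally have "norm ((S ^^ Suc n) x - x) \<le> 2 * B" .
      then have "(1 / real (Suc n)) * norm ((S ^^ Suc n) x - x) \<le> (1 / real (Suc n)) * (2 * B)"
        by (intro mult_left_mono) auto
      then show "norm (S (y n) - y n) \<le> (2 * B) * (1 / real (Suc n))"
        unfolding diff by (simp add: mult.commute)
    qed
    show "(\<lambda>n. 2 * B * (1 / real (Suc n))) \<longlonglongrightarrow> 0"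
      by (rule tendsto_mult_right_zero) (use LIMSEQ_inverse_real_of_nat in \<open>simp add: inverse_eq_divide\<close>)
  qed
  obtain p r where p: "p \<in> K" "strict_mono r" "(y \<circ> r) \<longlonglongrightarrow> p"
    using K(1) yK unfolding compact_eq_seq_compact_metric seq_compact_def by meson
  have "(\<lambda>n. S (y (r n))) \<longlonglongrightarrow> S p"
    using S(2) p yK by (intro continuous_on_tendsto_compose[OF S(2)]) (auto simp: o_def)
  then have "(\<lambda>n. S (y (r n)) - y (r n)) \<longlonglongrightarrow> S p - p"
    using p(3) by (intro tendsto_diff) (auto simp: o_def)
  moreover have "(\<lambda>n. S (y (r n)) - y (r n)) \<longlonglongrightarrow> 0"
    using LIMSEQ_subseq_LIMSEQ[OF lim0 p(2)] by (simp add: o_def)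
  ultimately have "S p = p" using LIMSEQ_unique by fastforce
  then show thesis using that p(1) by blast
qed

text \<open>The sum of the first \<open>n\<close> functions has variance
  \<open>n - n^2 * (cmod I)^2\<close>. As this is nonnegative, \<open>n * (cmod I)^2 \<le> 1\<close>
  for all \<open>n\<close>.\<close>

lemma orthonormal_constant_mean_eq_0:
  fixes u :: "nat \<Rightarrow> 'a \<Rightarrow> complex"
  assumes M: "prob_space M" and u: "\<And>j. u j \<in> borel_measurable M" "\<And>j. AE x in M. norm (u j x) \<le> 1"
    and mean: "\<And>j. (\<integral>x. u j x \<partial>M) = I"
    and orth: "\<And>j l. (\<integral>x. u j x * cnj (u l x) \<partial>M) = (if j = l then 1 else 0)"
  shows "I = 0"
proof -
  interpret prob_space M by fact
  have ui: "integrable M (u j)" for j using u by (intro integrable_const_bound[of _ 1]) auto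
  have uui: "integrable M (\<lambda>x. u j x * cnj (u l x))" for j l
  proof (rule integrable_const_bound[of _ 1])
    show "AE x in M. norm (u j x * cnj (u l x)) \<le> 1"
      using u(2)[of j] u(2)[of l] by eventually_elim (auto simp: norm_mult intro: mult_le_one)
    have "cnj \<in> borel_measurable borel" by (intro borel_measurable_continuous_onI continuous_intros)
    then show "(\<lambda>x. u j x * cnj (u l x)) \<in> borel_measurable M"
      by (intro borel_measurable_times u(1) measurable_compose[OF u(1)])
  qed
  have bound: "real n * (cmod I)\<^sup>2 \<le> 1" for n
  proof (cases "n = 0")
    case False
    define m where "m = of_nat n * I"
    define f where "f x = (\<Sum>j<n. u j x)" for x
    have fi: "integrable M f" unfolding f_def using ui by auto
    have fm: "(\<integral>x. f x \<partial>M) = m" unfolding f_def m_def using ui by (simp add: mean)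
    have ffi: "integrable M (\<lambda>x. f x * cnj (f x))" unfolding f_def cnj_sum sum_product using uui by auto
    have ff: "(\<integral>x. f x * cnj (f x) \<partial>M) = of_nat n"
      unfolding f_def cnj_sum sum_product using uui by (simp add: orth)
    have "complex_of_real (\<integral>x. (cmod (f x - m))\<^sup>2 \<partial>M) = (\<integral>x. f x * cnj (f x) - m * cnj (f x) - cnj m * f x + m * cnj m \<partial>M)"
      unfolding integral_complex_of_real[symmetric] complex_norm_square
      by (intro Bochner_Integration.integral_cong) (auto simp: algebra_simps)
    also have "\<dots> = of_nat n - m * cnj m - cnj m * m + m * cnj m"
      using fi ffi fm ff by (simp add: prob_space)
    also have "\<dots> = complex_of_real (real n - (cmod m)\<^sup>2)"
      unfolding of_real_diff complex_norm_square by (simp add: mult.commute)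
    finally have "(\<integral>x. (cmod (f x - m))\<^sup>2 \<partial>M) = real n - (cmod m)\<^sup>2" by (simp only: of_real_eq_iff)
    moreover have "0 \<le> (\<integral>x. (cmod (f x - m))\<^sup>2 \<partial>M)" by simp
    ultimately have "(cmod m)\<^sup>2 \<le> real n" by linarith
    then have "real n * (real n * (cmod I)\<^sup>2) \<le> real n * 1" unfolding m_def by (simp add: norm_mult power2_eq_square mult_ac)
    then show ?thesis using False by (simp add: mult_le_cancel_left_pos)
  qed simp
  show "I = 0"
  proof (rule ccontr)
    assume "I \<noteq> 0"
    then obtain n where "1 < real n * (cmod I)\<^sup>2" using reals_Archimedean3[of "(cmod I)\<^sup>2"] by auto
    then show False using bound[of n] by linarith
  qed
qed

section \<open>The skew product, its characters and its periodic points\<close>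

definition rot :: complex where
  "rot = Complex (3/5) (4/5)"

lemma norm_rot: "norm rot = 1"
  unfolding rot_def by (simp add: cmod_def power2_eq_square)

text \<open>\<open>(3 + 4\<i>)\<^sup>n\<close> is congruent to \<open>3 + 4\<i>\<close> modulo 5.\<close>

lemma rot_power_neq_1:
  assumes "n \<ge> 1" shows "rot ^ n \<noteq> 1"
proof -
  have "\<exists>x y :: int. 5 ^ Suc n * rot ^ Suc n = Complex x y \<and> x mod 5 = 3 \<and> y mod 5 = 4" for n
  proof (induction n)
    case 0
    show ?case by (intro exI[of _ 3] exI[of _ 4]) (simp add: rot_def complex_eq_iff)
  next
    case (Suc n)
    then obtain x y :: int where xy: "5 ^ Suc n * rot ^ Suc n = Complex x y" "x mod 5 = 3" "y mod 5 = 4" by blast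
    have "5 ^ Suc (Suc n) * rot ^ Suc (Suc n) = (5 * rot) * (5 ^ Suc n * rot ^ Suc n)" by simp
    also have "\<dots> = Complex (of_int (3 * x - 4 * y)) (of_int (4 * x + 3 * y))"
      unfolding xy(1) by (simp add: rot_def complex_eq_iff)
    finally show ?case
      using xy(2,3) by (intro exI[of _ "3 * x - 4 * y"] exI[of _ "4 * x + 3 * y"] conjI; presburger?)
  qed
  from this[of "n - 1"] obtain x y :: int where xy: "5 ^ n * rot ^ n = Complex x y" "y mod 5 = 4" using assms by auto
  show ?thesis
  proof
    assume "rot ^ n = 1"
    then have "Complex x y = of_real (5 ^ n)" using xy(1) by simp
    then have "y = 0" by (simp add: complex_eq_iff)
    then show False using xy(2) by simp
  qed
qed

lemma rot_powi_neq_1: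
  assumes "a \<noteq> 0" shows "rot powi a \<noteq> 1"
proof (cases "a > 0")
  case True
  then show ?thesis using rot_power_neq_1[of "nat a"] by (simp add: power_int_def)
next
  case False
  then have "inverse (rot powi a) = rot ^ nat (- a)" by (simp add: power_int_def power_inverse)
  then show ?thesis using rot_power_neq_1[of "nat (- a)"] assms False by (metis inverse_1 less_one linorder_not_less nat_eq_iff2 neg_0_le_iff_le neg_equal_0_iff_equal of_nat_0 zero_order(1) nat_0_iff)
qed

definition skew :: "complex \<times> complex \<Rightarrow> complex \<times> complex" where
  "skew x = (rot * fst x, fst x * snd x)"

definition skew_inv :: "complex \<times> complex \<Rightarrow> complex \<times> complex" where
  "skew_inv x = (cnj rot * fst x, rot * cnj (fst x) * snd x)"

lemma cnj_mult_self: "norm z = 1 \<Longrightarrow> z * cnj z = 1"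
  by (metis complex_norm_square of_real_1 one_power2)

lemma skew_in: "x \<in> torus \<Longrightarrow> skew x \<in> torus"
  unfolding torus_def skew_def by (auto simp: norm_mult norm_rot)

lemma skew_inv_in: "x \<in> torus \<Longrightarrow> skew_inv x \<in> torus"
  unfolding torus_def skew_inv_def by (auto simp: norm_mult norm_rot)

lemma skew_inv_skew: "x \<in> torus \<Longrightarrow> skew_inv (skew x) = x"
  and skew_skew_inv: "x \<in> torus \<Longrightarrow> skew (skew_inv x) = x"
proof -
  assume x: "x \<in> torus"
  have r: "rot * cnj rot = 1" and z: "fst x * cnj (fst x) = 1"
    using cnj_mult_self norm_rot torus_norm(1)[OF x] by auto
  have "skew_inv (skew x) = ((rot * cnj rot) * fst x, (rot * cnj rot) * (fst x * cnj (fst x)) * snd x)"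
    unfolding skew_def skew_inv_def by (simp add: mult_ac)
  then show "skew_inv (skew x) = x" unfolding r z by simp
  have "skew (skew_inv x) = ((rot * cnj rot) * fst x, (rot * cnj rot) * (fst x * cnj (fst x)) * snd x)"
    unfolding skew_def skew_inv_def by (simp add: mult_ac)
  then show "skew (skew_inv x) = x" unfolding r z by simp
qed

lemma self_map_skew: "torus.self_map skew" and self_map_skew_inv: "torus.self_map skew_inv"
proof -
  have "continuous_on A skew" "continuous_on A skew_inv" for A
    unfolding skew_def[abs_def] skew_inv_def[abs_def] by (intro continuous_intros)+
  then show "torus.self_map skew" "torus.self_map skew_inv"
    unfolding torus.self_map_def using skew_in skew_inv_in by (auto intro: borel_measurable_continuous_onI)
qed

lemma chr_skew: "chr a b (skew x) = rot powi a * chr (a + b) b x" if "x \<in> torus"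
  unfolding chr_def skew_def using that
  by (simp add: power_int_mult_distrib power_int_add torus_nonzero mult_ac)

lemma funpow_skew_in: "x \<in> torus \<Longrightarrow> (skew ^^ n) x \<in> torus"
  by (induction n) (auto intro: skew_in)

text \<open>The phase is a power of \<open>rot\<close> whose exponent is in general quadratic in
  \<open>n\<close>; it stays existential since later arguments use only its modulus. That the first
  index moves by \<open>b\<close> at each step is the source of all orthogonality between
  iterates.\<close>

lemma chr_skew_funpow: "\<exists>\<theta>. norm \<theta> = 1 \<and> (\<forall>x\<in>torus. chr a b ((skew ^^ n) x) = \<theta> * chr (a + int n * b) b x)"
proof (induction n arbitrary: a)
  case 0 show ?case by (intro exI[of _ 1]) simp
next
  case (Suc n)
  obtain \<theta> where \<theta>: "norm \<theta> = 1" "\<And>x. x \<in> torus \<Longrightarrow> chr (a + b) b ((skew ^^ n) x) = \<theta> * chr (a + b + int n * b) b x"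
    using Suc.IH[of "a + b"] by blast
  have "chr a b ((skew ^^ Suc n) x) = rot powi a * \<theta> * chr (a + int (Suc n) * b) b x" if "x \<in> torus" for x
    using \<theta>(2)[OF that] funpow_skew_in[OF that] by (simp add: chr_skew algebra_simps)
  moreover have "norm (rot powi a * \<theta>) = 1" using \<theta>(1) by (simp add: norm_mult norm_power_int norm_rot)
  ultimately show ?case by blast
qed

lemma chr_skew_funpow_0: "x \<in> torus \<Longrightarrow> chr a 0 ((skew ^^ n) x) = rot powi (a * int n) * chr a 0 x"
proof (induction n)
  case (Suc n)
  have "rot \<noteq> 0" using norm_rot by fastforce
  then show ?case using Suc funpow_skew_in by (simp add: chr_skew distrib_left power_int_add)
qed simp

lemma chr_measurable: "chr a b \<in> borel_measurable borel"
proof -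
  have p: "(\<lambda>z :: complex. z powi n) \<in> borel_measurable borel" for n
    by (cases "n \<ge> 0") (simp_all add: power_int_def)
  have "(fst :: complex \<times> complex \<Rightarrow> complex) \<in> borel_measurable borel"
    by (intro borel_measurable_continuous_onI continuous_intros)
  from measurable_compose[OF this p] have 1: "(\<lambda>x :: complex \<times> complex. fst x powi a) \<in> borel_measurable borel" .
  have "(snd :: complex \<times> complex \<Rightarrow> complex) \<in> borel_measurable borel"
    by (intro borel_measurable_continuous_onI continuous_intros)
  from measurable_compose[OF this p] have "(\<lambda>x :: complex \<times> complex. snd x powi b) \<in> borel_measurable borel" .
  with 1 show ?thesis unfolding chr_def[abs_def] by (rule borel_measurable_times)
qed

lemma AE_norm_chr:
  assumes "\<nu> \<in> torus.prob_on" shows "AE x in \<nu>. norm (chr a b x) = 1"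
  using torus.AE_prob_on[OF assms] by eventually_elim (rule norm_chr)

lemma integrable_chr:
  assumes \<nu>: "\<nu> \<in> torus.prob_on" shows "integrable \<nu> (chr a b)"
proof -
  interpret prob_space \<nu> using \<nu> by (rule torus.prob_space_prob_on)
  show ?thesis
    using AE_norm_chr[OF \<nu>, of a b] torus.measurable_prob_on[OF \<nu> chr_measurable]
    by (intro integrable_const_bound[of _ 1]) (auto elim: eventually_mono)
qed

lemma integral_torus_coord:
  assumes \<nu>: "\<nu> \<in> torus.prob_on"
  shows "(\<integral>x. torus_coord (a, b, r) x \<partial>\<nu>) = (if r then Re else Im) (\<integral>x. chr a b x \<partial>\<nu>)"
proof -
  have "(\<integral>x. torus_coord (a, b, r) x \<partial>\<nu>) = (\<integral>x. (if r then Re else Im) (chr a b x) \<partial>\<nu>)"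
  proof (rule integral_cong_AE)
    show "torus_coord (a, b, r) \<in> borel_measurable \<nu>" by (rule torus.measurable_prob_on[OF \<nu> torus_coord_measurable])
    show "(\<lambda>x. (if r then Re else Im) (chr a b x)) \<in> borel_measurable \<nu>"
      using torus.measurable_prob_on[OF \<nu> chr_measurable] by (cases r) auto
    show "AE x in \<nu>. torus_coord (a, b, r) x = (if r then Re else Im) (chr a b x)"
      using torus.AE_prob_on[OF \<nu>] by eventually_elim (simp add: torus_coord_def)
  qed
  then show ?thesis using integrable_chr[OF \<nu>] by simp
qed

lemma (in measure_simplex) meas_funpow_push:
  assumes T: "self_map T" and q: "q \<in> K"
  shows "meas ((push T ^^ n) q) = distr (meas q) borel (T ^^ n)"
proof (induction n)
  case 0
  show ?case using distr_id2[OF sets_prob_on[OF meas_in[OF q], symmetric]] by (simp add: id_def)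
next
  case (Suc n)
  have Tm: "T \<in> borel \<rightarrow>\<^sub>M borel" using T unfolding self_map_def by blast
  have Tn: "T ^^ n \<in> borel_measurable (meas q)"
    using self_map_funpow[OF T, of n] sets_prob_on[OF meas_in[OF q]]
    unfolding self_map_def by (simp cong: measurable_cong_sets)
  have "meas ((push T ^^ Suc n) q) = distr (meas ((push T ^^ n) q)) borel T"
    using meas_bary[OF distr_prob_on[OF T meas_in[OF funpow_push_in[OF T q]]]] by (simp add: push_def)
  also have "\<dots> = distr (meas q) borel (T \<circ> (T ^^ n))"
    unfolding Suc.IH using Tm Tn by (rule distr_distr)
  finally show ?case by (simp add: o_def)
qed

lemma integral_chr_funpow_push:
  assumes q: "q \<in> torus.K"
  shows "(\<integral>x. chr a b x \<partial>torus.meas ((torus.push skew ^^ n) q)) = (\<integral>x. chr a b ((skew ^^ n) x) \<partial>torus.meas q)"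
proof -
  have "skew ^^ n \<in> borel_measurable (torus.meas q)"
    using torus.self_map_funpow[OF self_map_skew, of n] torus.sets_prob_on[OF torus.meas_in[OF q]]
    unfolding torus.self_map_def by (simp cong: measurable_cong_sets)
  then show ?thesis
    unfolding torus.meas_funpow_push[OF self_map_skew q] using chr_measurable by (rule integral_distr)
qed

lemma torus_K_eqI:
  assumes q: "p \<in> torus.K" "q \<in> torus.K"
    and eq: "\<And>a b. (\<integral>x. chr a b x \<partial>torus.meas p) = (\<integral>x. chr a b x \<partial>torus.meas q)"
  shows "p = q"
proof (rule torus.K_eqI[OF q])
  fix n :: nat
  obtain a b r where "(from_nat n :: int \<times> int \<times> bool) = (a, b, r)" by (cases "from_nat n :: int \<times> int \<times> bool") auto
  then show "torus.ev (torus_coord (from_nat n)) p = torus.ev (torus_coord (from_nat n)) q"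
    by (simp add: integral_torus_coord torus.meas_in q eq)
qed

text \<open>For \<open>b \<noteq> 0\<close> the functions \<open>chr a b \<circ> skew\<^sup>n\<^sup>j\<close> have the same integral for all \<open>j\<close>; they are
  orthonormal because the quotient of two of them is a character in the first coordinate only.\<close>

lemma periodic_integral_chr:
  assumes q: "q \<in> torus.K" and n: "n \<ge> 1" and per: "(torus.push skew ^^ n) q = q" and ab: "a \<noteq> 0 \<or> b \<noteq> 0"
  shows "(\<integral>x. chr a b x \<partial>torus.meas q) = 0"
proof -
  let ?\<nu> = "torus.meas q"
  note \<nu> = torus.meas_in[OF q]
  have per': "(torus.push skew ^^ (n * j)) q = q" for j
    by (induction j) (simp_all add: funpow_add per)
  have inv: "(\<integral>x. chr a b ((skew ^^ (n * j)) x) \<partial>?\<nu>) = (\<integral>x. chr a b x \<partial>?\<nu>)" for a b j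
    using integral_chr_funpow_push[OF q, where a=a and b=b and n="n * j"] by (simp add: per')
  \<comment> \<open>A character in the first coordinate alone is an eigenfunction of the iterate
    with an eigenvalue different from 1, so invariance forces its mean to vanish.\<close>
  have 0: "(\<integral>x. chr a 0 x \<partial>?\<nu>) = 0" if "a \<noteq> 0" for a
  proof -
    have "(\<integral>x. chr a 0 x \<partial>?\<nu>) = (\<integral>x. chr a 0 ((skew ^^ (n * 1)) x) \<partial>?\<nu>)" by (rule inv[symmetric])
    also have "\<dots> = (\<integral>x. rot powi (a * int n) * chr a 0 x \<partial>?\<nu>)"
    proof (rule integral_cong_AE)
      show "AE x in ?\<nu>. chr a 0 ((skew ^^ (n * 1)) x) = rot powi (a * int n) * chr a 0 x"
        using torus.AE_prob_on[OF \<nu>] by eventually_elim (simp add: chr_skew_funpow_0)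
      have "(\<lambda>x. chr a 0 ((skew ^^ (n * 1)) x)) \<in> borel_measurable borel"
        using torus.self_map_funpow[OF self_map_skew, of "n * 1"] unfolding torus.self_map_def
        by (blast intro: measurable_compose chr_measurable)
      then show "(\<lambda>x. chr a 0 ((skew ^^ (n * 1)) x)) \<in> borel_measurable ?\<nu>" by (rule torus.measurable_prob_on[OF \<nu>])
      show "(\<lambda>x. rot powi (a * int n) * chr a 0 x) \<in> borel_measurable ?\<nu>"
        using torus.measurable_prob_on[OF \<nu> chr_measurable] by (intro borel_measurable_times borel_measurable_const)
    qed
    also have "\<dots> = rot powi (a * int n) * (\<integral>x. chr a 0 x \<partial>?\<nu>)" by simp
    finally have "(1 - rot powi (a * int n)) * (\<integral>x. chr a 0 x \<partial>?\<nu>) = 0" by (simp add: algebra_simps)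
    moreover have "rot powi (a * int n) \<noteq> 1" using that n by (intro rot_powi_neq_1) simp
    ultimately show ?thesis by simp
  qed
  show ?thesis
  proof (cases "b = 0")
    case True
    then show ?thesis using 0 ab by blast
  next
    case False
    define u where "u j x = chr a b ((skew ^^ (n * j)) x)" for j x
    have um: "u j \<in> borel_measurable borel" for j
      unfolding u_def[abs_def] using torus.self_map_funpow[OF self_map_skew, of "n * j"] unfolding torus.self_map_def
      by (blast intro: measurable_compose chr_measurable)
    have "\<exists>\<theta>. norm \<theta> = 1 \<and> (\<forall>x\<in>torus. u j x = \<theta> * chr (a + int (n * j) * b) b x)" for j
      unfolding u_def by (rule chr_skew_funpow)
    then obtain \<theta> where \<theta>: "\<And>j. norm (\<theta> j) = 1" "\<And>j x. x \<in> torus \<Longrightarrow> u j x = \<theta> j * chr (a + int (n * j) * b) b x"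
      by metis
    show ?thesis
    proof (rule orthonormal_constant_mean_eq_0[of ?\<nu> u])
      show "prob_space ?\<nu>" using \<nu> by (rule torus.prob_space_prob_on)
      show "u j \<in> borel_measurable ?\<nu>" for j by (rule torus.measurable_prob_on[OF \<nu> um])
      show "AE x in ?\<nu>. norm (u j x) \<le> 1" for j
        using torus.AE_prob_on[OF \<nu>] by eventually_elim (simp add: \<theta> norm_mult norm_chr)
      show "(\<integral>x. u j x \<partial>?\<nu>) = (\<integral>x. chr a b x \<partial>?\<nu>)" for j unfolding u_def by (rule inv)
      fix j l
      have "(\<integral>x. u j x * cnj (u l x) \<partial>?\<nu>) = (\<integral>x. (\<theta> j * cnj (\<theta> l)) * chr (int n * (int j - int l) * b) 0 x \<partial>?\<nu>)"
      proof (rule integral_cong_AE)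
        have "cnj \<in> borel_measurable borel" by (intro borel_measurable_continuous_onI continuous_intros)
        from measurable_compose[OF torus.measurable_prob_on[OF \<nu> um] this]
        show "(\<lambda>x. u j x * cnj (u l x)) \<in> borel_measurable ?\<nu>"
          by (intro borel_measurable_times torus.measurable_prob_on[OF \<nu> um])
        show "(\<lambda>x. (\<theta> j * cnj (\<theta> l)) * chr (int n * (int j - int l) * b) 0 x) \<in> borel_measurable ?\<nu>"
          using torus.measurable_prob_on[OF \<nu> chr_measurable] by (intro borel_measurable_times borel_measurable_const)
        show "AE x in ?\<nu>. u j x * cnj (u l x) = (\<theta> j * cnj (\<theta> l)) * chr (int n * (int j - int l) * b) 0 x"
          using torus.AE_prob_on[OF \<nu>]
        proof eventually_elim
          case (elim x)
          have "chr (int n * (int j - int l) * b) 0 x = chr (a + int (n * j) * b) b x * cnj (chr (a + int (n * l) * b) b x)"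
            unfolding chr_minus[OF elim, symmetric] chr_add[OF elim, symmetric] by (simp add: algebra_simps)
          then show ?case using elim by (simp add: \<theta>(2))
        qed
      qed
      also have "\<dots> = (\<theta> j * cnj (\<theta> l)) * (\<integral>x. chr (int n * (int j - int l) * b) 0 x \<partial>?\<nu>)" by simp
      also have "\<dots> = (if j = l then 1 else 0)"
      proof (cases "j = l")
        case True
        interpret prob_space ?\<nu> using \<nu> by (rule torus.prob_space_prob_on)
        show ?thesis using True cnj_mult_self[OF \<theta>(1)] by (simp add: chr_0 prob_space)
      next
        case False
        then have "int n * (int j - int l) * b \<noteq> 0" using n \<open>b \<noteq> 0\<close> by simp
        then show ?thesis using 0 False by simp
      qed
      finally show "(\<integral>x. u j x * cnj (u l x) \<partial>?\<nu>) = (if j = l then 1 else 0)" .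
    qed
  qed
qed

lemma push_skew_Pi: "torus.push skew \<in> torus.K \<rightarrow> torus.K"
  using torus.push_in[OF self_map_skew] by blast

text \<open>Haar measure is not constructed: a fixed point exists by averaging, and every periodic
  point has the same Fourier coefficients, 1 at the origin and 0 elsewhere.\<close>

lemma unique_periodic_point:
  obtains p where "p \<in> torus.K" "torus.push skew p = p"
    "\<And>q n. q \<in> torus.K \<Longrightarrow> n \<ge> 1 \<Longrightarrow> (torus.push skew ^^ n) q = q \<Longrightarrow> q = p"
proof -
  obtain p where p: "p \<in> torus.K" "torus.push skew p = p"
    using affine_fixed_point[OF torus.compact_K torus.convex_K torus.K_ne torus.push_affine[OF self_map_skew]
        torus.push_continuous[OF self_map_skew] push_skew_Pi] by blast
  show thesis
  proof (rule that[OF p])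
    fix q n assume q: "q \<in> torus.K" "n \<ge> (1::nat)" "(torus.push skew ^^ n) q = q"
    show "q = p"
    proof (rule torus_K_eqI[OF q(1) p(1)])
      fix a b
      show "(\<integral>x. chr a b x \<partial>torus.meas q) = (\<integral>x. chr a b x \<partial>torus.meas p)"
      proof (cases "a = 0 \<and> b = 0")
        case True
        have "(\<integral>x. chr 0 0 x \<partial>torus.meas r) = 1" if "r \<in> torus.K" for r
        proof -
          interpret prob_space "torus.meas r" using torus.meas_in[OF that] by (rule torus.prob_space_prob_on)
          show ?thesis by (simp add: chr_0 prob_space)
        qed
        then show ?thesis using True q(1) p(1) by simp
      next
        case False
        then show ?thesis
          using periodic_integral_chr[OF q, of a b] periodic_integral_chr[OF p(1), of 1 a b] p(2) by simp
      qed
    qed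
  qed
qed

section \<open>Polynomial complexity of the skew product\<close>

lemma dist_skew_funpow:
  assumes x: "x \<in> torus" "y \<in> torus"
  shows "dist (fst ((skew ^^ i) x)) (fst ((skew ^^ i) y)) = dist (fst x) (fst y)"
    and "dist (snd ((skew ^^ i) x)) (snd ((skew ^^ i) y)) \<le> dist (snd x) (snd y) + i * dist (fst x) (fst y)"
proof -
  show fst: "dist (fst ((skew ^^ i) x)) (fst ((skew ^^ i) y)) = dist (fst x) (fst y)" for i
    by (induction i) (simp_all add: skew_def dist_norm norm_mult norm_rot flip: right_diff_distrib)
  show "dist (snd ((skew ^^ i) x)) (snd ((skew ^^ i) y)) \<le> dist (snd x) (snd y) + i * dist (fst x) (fst y)"
  proof (induction i)
    case (Suc i)
    let ?p = "(skew ^^ i) x" and ?q = "(skew ^^ i) y"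
    have pq: "?p \<in> torus" "?q \<in> torus" using funpow_skew_in x by auto
    have "snd ((skew ^^ Suc i) x) - snd ((skew ^^ Suc i) y) = fst ?p * (snd ?p - snd ?q) + (fst ?p - fst ?q) * snd ?q"
      by (simp add: skew_def algebra_simps)
    then have "dist (snd ((skew ^^ Suc i) x)) (snd ((skew ^^ Suc i) y)) \<le> norm (fst ?p * (snd ?p - snd ?q)) + norm ((fst ?p - fst ?q) * snd ?q)"
      unfolding dist_norm using norm_triangle_ineq by metis
    also have "\<dots> = dist (snd ?p) (snd ?q) + dist (fst ?p) (fst ?q)"
      using torus_norm[OF pq(1)] torus_norm[OF pq(2)] by (simp add: norm_mult dist_norm)
    also have "\<dots> \<le> dist (snd x) (snd y) + i * dist (fst x) (fst y) + dist (fst x) (fst y)"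
      using Suc.IH fst[of i] by simp
    finally show ?case by (simp add: algebra_simps)
  qed simp
qed

text \<open>Distances grow at most linearly in time, so the cells of a grid of mesh
  \<open>1 / L\<close> with \<open>L\<close> of order \<open>n / \<delta>\<close> stay small up to
  time \<open>n\<close>. A point has four real coordinates, hence the exponent 4.\<close>

lemma skew_polynomial_covers:
  assumes \<delta>: "\<delta> > 0"
  shows "\<exists>C>0. \<forall>n\<ge>1. \<exists>\<P>. finite \<P> \<and> real (card \<P>) \<le> (C * real n) ^ 4 \<and> torus \<subseteq> \<Union>\<P> \<and>
      (\<forall>D\<in>\<P>. \<forall>x\<in>D \<inter> torus. \<forall>y\<in>D \<inter> torus. \<forall>i<n. dist ((skew ^^ i) x) ((skew ^^ i) y) < \<delta>)"
\<comment> \<open>Each real coordinate has \<open>2 * L + 1\<close> grid values, and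
  \<open>n + 2 \<le> 3 * n\<close> bounds this by \<open>12 * n / \<delta> + 5\<close>.\<close>
proof (intro exI[of _ "12 / \<delta> + 5"] conjI allI impI)
  show "0 < 12 / \<delta> + 5" using \<delta> by (simp add: add_pos_pos)
  fix n :: nat assume n: "n \<ge> 1"
  \<comment> \<open>Two points of a cell are within \<open>2 / L\<close> in each factor, hence after
    fewer than \<open>n\<close> steps within \<open>2 * (n + 2) / L\<close>.\<close>
  define L where "L = nat \<lceil>2 * (real n + 2) / \<delta>\<rceil> + 1"
  have "2 * (real n + 2) / \<delta> > 0" using \<delta> by simp
  then have L: "2 * (real n + 2) / \<delta> < real L" "real L \<le> 2 * (real n + 2) / \<delta> + 2"
    unfolding L_def by (simp_all; linarith)+
  have L0: "real L > 0" unfolding L_def by simp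
  define code where "code x = (\<lfloor>L * Re (fst x)\<rfloor>, \<lfloor>L * Im (fst x)\<rfloor>, \<lfloor>L * Re (snd x)\<rfloor>, \<lfloor>L * Im (snd x)\<rfloor>)"
    for x :: "complex \<times> complex"
  let ?J = "{- int L..int L}"
  have fl: "\<lfloor>L * t\<rfloor> \<in> ?J" if "\<bar>t\<bar> \<le> 1" for t :: real
  proof -
    have "\<bar>L * t\<bar> \<le> real L * 1" unfolding abs_mult using that by (intro mult_mono) auto
    then have "- real L \<le> L * t" "L * t \<le> real L" by (auto simp: abs_le_iff)
    then have "- int L \<le> \<lfloor>L * t\<rfloor>" "\<lfloor>L * t\<rfloor> \<le> int L" by linarith+
    then show ?thesis by simp
  qed
  have code_in: "code x \<in> ?J \<times> ?J \<times> ?J \<times> ?J" if "x \<in> torus" for x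
    unfolding code_def using torus_norm[OF that] abs_Re_le_cmod abs_Im_le_cmod fl by (metis mem_Sigma_iff)
  define \<P> where "\<P> = (\<lambda>j. {x \<in> torus. code x = j}) ` (?J \<times> ?J \<times> ?J \<times> ?J)"
  show "\<exists>\<P>. finite \<P> \<and> real (card \<P>) \<le> ((12 / \<delta> + 5) * real n) ^ 4 \<and> torus \<subseteq> \<Union>\<P> \<and>
      (\<forall>D\<in>\<P>. \<forall>x\<in>D \<inter> torus. \<forall>y\<in>D \<inter> torus. \<forall>i<n. dist ((skew ^^ i) x) ((skew ^^ i) y) < \<delta>)"
  proof (intro exI[of _ \<P>] conjI ballI allI impI)
    show "finite \<P>" unfolding \<P>_def by simp
    have "card \<P> \<le> card (?J \<times> ?J \<times> ?J \<times> ?J)" unfolding \<P>_def by (rule card_image_le) simp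
    also have "\<dots> = (2 * L + 1) ^ 4"
    proof -
      have "card ?J = 2 * L + 1" by (simp add: nat_add_distrib nat_mult_distrib)
      then show ?thesis by (simp only: card_cartesian_product power4_eq_xxxx mult.assoc)
    qed
    finally have "card \<P> \<le> (2 * L + 1) ^ 4" .
    then have "real (card \<P>) \<le> real ((2 * L + 1) ^ 4)" by (rule of_nat_mono)
    also have "\<dots> = (2 * real L + 1) ^ 4" by (simp add: add.commute)
    also have "\<dots> \<le> ((12 / \<delta> + 5) * real n) ^ 4"
    proof (rule power_mono)
      have "2 * real L + 1 \<le> 2 * (2 * (real n + 2) / \<delta> + 2) + 1"
        by (intro add_right_mono mult_left_mono L(2)) simp
      also have "2 * (real n + 2) / \<delta> \<le> 2 * (real n + 2 * real n) / \<delta>" using n \<delta> by (intro divide_right_mono) auto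
      also have "2 * (2 * (real n + 2 * real n) / \<delta> + 2) + 1 = 12 / \<delta> * real n + 5" by (simp add: field_simps)
      also have "\<dots> \<le> (12 / \<delta> + 5) * real n" using n by (simp add: distrib_right)
      finally show "2 * real L + 1 \<le> (12 / \<delta> + 5) * real n" by simp
    qed simp
    finally show "real (card \<P>) \<le> ((12 / \<delta> + 5) * real n) ^ 4" .
    show "torus \<subseteq> \<Union>\<P>" unfolding \<P>_def using code_in by blast
  next
    fix D x y i assume D: "D \<in> \<P>" "x \<in> D \<inter> torus" "y \<in> D \<inter> torus" and i: "i < n"
    have xy: "x \<in> torus" "y \<in> torus" "code x = code y" using D unfolding \<P>_def by auto
    have close: "\<bar>s - t\<bar> \<le> 1 / L" if "\<lfloor>L * s\<rfloor> = \<lfloor>L * t\<rfloor>" for s t :: real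
    proof -
      have "\<bar>L * s - L * t\<bar> \<le> 1" using that by linarith
      then have "L * \<bar>s - t\<bar> \<le> 1" using L0 by (simp add: abs_mult flip: right_diff_distrib)
      then show ?thesis using L0 by (simp add: field_simps)
    qed
    have cdist: "dist z w \<le> 2 / L" if "\<lfloor>L * Re z\<rfloor> = \<lfloor>L * Re w\<rfloor>" "\<lfloor>L * Im z\<rfloor> = \<lfloor>L * Im w\<rfloor>" for z w
    proof -
      have "dist z w \<le> \<bar>Re z - Re w\<bar> + \<bar>Im z - Im w\<bar>" unfolding dist_norm using cmod_le[of "z - w"] by simp
      also have "\<dots> \<le> 1 / L + 1 / L" using close that by (intro add_mono)
      finally show ?thesis by simp
    qed
    have d: "dist (fst x) (fst y) \<le> 2 / L" "dist (snd x) (snd y) \<le> 2 / L"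
      using xy(3) cdist unfolding code_def by auto
    have "dist ((skew ^^ i) x) ((skew ^^ i) y) \<le> dist (fst ((skew ^^ i) x)) (fst ((skew ^^ i) y)) + dist (snd ((skew ^^ i) x)) (snd ((skew ^^ i) y))"
      unfolding dist_prod_def using sqrt_sum_squares_le_sum[OF zero_le_dist zero_le_dist] .
    also have "\<dots> \<le> dist (fst x) (fst y) + (dist (snd x) (snd y) + i * dist (fst x) (fst y))"
      using dist_skew_funpow[OF xy(1,2), of i] by simp
    also have "\<dots> \<le> 2 / L + (2 / L + i * (2 / L))" using d by (intro add_mono mult_left_mono) auto
    also have "\<dots> \<le> 2 / L + (2 / L + n * (2 / L))" using i L0 by (intro add_mono mult_right_mono) auto
    also have "\<dots> = 2 * (real n + 2) / L" using L0 by (simp add: field_simps)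
    also have "\<dots> < \<delta>" using L(1) L0 \<delta> by (simp add: field_simps)
    finally show "dist ((skew ^^ i) x) ((skew ^^ i) y) < \<delta>" .
  qed
qed

lemma subexponential_covers_skew: "subexponential_covers torus.K (torus.push skew)"
  by (rule torus.subexponential_covers_push[OF self_map_skew skew_polynomial_covers])

section \<open>Affine equivariant functions do not separate points\<close>

text \<open>Gram-Schmidt, with the span expressed through its annihilator, the form in which the
  projection uses it. Since \<open>ip\<close> sees functions only on \<open>A\<close>, a remainder
  of norm 0 vanishes on \<open>A\<close> but need not be the zero function.\<close>

lemma exists_orthonormal_span:
  fixes \<Lambda> :: "('i \<Rightarrow> real) set"
  assumes A: "finite A" and \<Lambda>: "finite \<Lambda>"
  defines "ip \<equiv> \<lambda>f g :: 'i \<Rightarrow> real. \<Sum>a\<in>A. f a * g a"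
  shows "\<exists>Q. finite Q \<and> card Q \<le> card \<Lambda> \<and> (\<forall>p\<in>Q. \<forall>q\<in>Q. ip p q = (if p = q then 1 else 0)) \<and>
    (\<forall>l\<in>\<Lambda>. \<forall>t. (\<forall>q\<in>Q. ip q t = 0) \<longrightarrow> ip l t = 0)"
  using \<Lambda>
proof (induction \<Lambda> rule: finite_induct)
  case (insert l \<Lambda>)
  from insert.IH obtain Q where *: "finite Q \<and> card Q \<le> card \<Lambda> \<and> (\<forall>p\<in>Q. \<forall>q\<in>Q. ip p q = (if p = q then 1 else 0)) \<and>
    (\<forall>l\<in>\<Lambda>. \<forall>t. (\<forall>q\<in>Q. ip q t = 0) \<longrightarrow> ip l t = 0)" by (rule exE)
  have Q: "finite Q" "card Q \<le> card \<Lambda>" "\<And>p q. p \<in> Q \<Longrightarrow> q \<in> Q \<Longrightarrow> ip p q = (if p = q then 1 else 0)"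
    and ann: "\<And>l t. l \<in> \<Lambda> \<Longrightarrow> (\<And>q. q \<in> Q \<Longrightarrow> ip q t = 0) \<Longrightarrow> ip l t = 0"
    using * by simp_all
  have ip_comm: "ip f g = ip g f" for f g unfolding ip_def by (simp add: mult.commute)
  define r where "r a = l a - (\<Sum>q\<in>Q. ip l q * q a)" for a
  have ip_r: "ip r t = ip l t - (\<Sum>q\<in>Q. ip l q * ip q t)" for t
  proof -
    have "ip r t = ip l t - (\<Sum>a\<in>A. \<Sum>q\<in>Q. ip l q * q a * t a)"
      unfolding ip_def r_def by (simp add: left_diff_distrib sum_subtractf sum_distrib_right)
    also have "(\<Sum>a\<in>A. \<Sum>q\<in>Q. ip l q * q a * t a) = (\<Sum>q\<in>Q. ip l q * ip q t)"
      unfolding ip_def by (subst sum.swap) (simp add: sum_distrib_left mult.assoc)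
    finally show ?thesis .
  qed
  have r_orth: "ip r q = 0" if "q \<in> Q" for q
  proof -
    have "(\<Sum>p\<in>Q. ip l p * ip p q) = (\<Sum>p\<in>Q. if p = q then ip l p else 0)"
      using that by (intro sum.cong) (auto simp: Q(3))
    then show ?thesis unfolding ip_r using Q(1) that by simp
  qed
  show ?case
  proof (cases "ip r r = 0")
    case True
    then have "r a = 0" if "a \<in> A" for a
      unfolding ip_def using A that by (simp add: sum_nonneg_eq_0_iff)
    then have "ip r t = 0" for t unfolding ip_def by simp
    then have "ip l t = 0" if "\<forall>q\<in>Q. ip q t = 0" for t using ip_r[of t] that by simp
    then show ?thesis using Q ann insert.hyps by (intro exI[of _ Q]) auto
  next
    case False
    have rr: "ip r r > 0" using False unfolding ip_def by (simp add: less_le sum_nonneg)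
    define e where "e a = r a / sqrt (ip r r)" for a
    have ip_e: "ip e t = ip r t / sqrt (ip r r)" for t
      unfolding ip_def e_def by (simp add: sum_divide_distrib)
    have ee: "ip e e = 1"
      unfolding ip_e using rr by (subst ip_comm) (simp add: ip_e)
    have eq: "ip e q = 0" "ip q e = 0" if "q \<in> Q" for q
      using ip_e[of q] r_orth[OF that] ip_comm[of q e] by simp_all
    have "e \<notin> Q" using ee eq by fastforce
    show ?thesis
    proof (intro exI[of _ "insert e Q"] conjI ballI allI impI)
      show "finite (insert e Q)" using Q(1) by simp
      show "card (insert e Q) \<le> card (insert l \<Lambda>)" using Q(1,2) \<open>e \<notin> Q\<close> insert.hyps by simp
      show "ip p q = (if p = q then 1 else 0)" if "p \<in> insert e Q" "q \<in> insert e Q" for p q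
        using that ee eq Q(3) \<open>e \<notin> Q\<close> by auto
      fix l' t assume l': "l' \<in> insert l \<Lambda>" and t: "\<forall>q\<in>insert e Q. ip q t = 0"
      have "ip r t = 0" using t ip_e[of t] rr by simp
      then have "ip l t = 0" using ip_r[of t] t by simp
      then show "ip l' t = 0" using l' ann[of l' t] t by auto
    qed
  qed
qed (intro exI[of _ "{}"]; simp)

text \<open>The orthogonal projection of a standard basis vector onto the annihilator; by a trace
  computation the projections have large diagonal entries on average.\<close>

lemma exists_concentrated_vector:
  fixes \<Lambda> :: "('i \<Rightarrow> real) set"
  assumes A: "finite A" "A \<noteq> {}" and \<Lambda>: "finite \<Lambda>" "2 * card \<Lambda> \<le> card A"
  shows "\<exists>t. \<exists>a\<in>A. t a \<ge> 1/2 \<and> t a \<le> 1 \<and> (\<Sum>b\<in>A. (t b)\<^sup>2) = t a \<and> (\<forall>l\<in>\<Lambda>. (\<Sum>b\<in>A. l b * t b) = 0)"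
proof -
  define ip where "ip f g = (\<Sum>a\<in>A. f a * g a)" for f g :: "'i \<Rightarrow> real"
  from exists_orthonormal_span[OF A(1) \<Lambda>(1)]
  obtain Q where *: "finite Q \<and> card Q \<le> card \<Lambda> \<and> (\<forall>p\<in>Q. \<forall>q\<in>Q. ip p q = (if p = q then 1 else 0)) \<and>
    (\<forall>l\<in>\<Lambda>. \<forall>t. (\<forall>q\<in>Q. ip q t = 0) \<longrightarrow> ip l t = 0)" unfolding ip_def by (rule exE)
  have Q: "finite Q" "card Q \<le> card \<Lambda>" "\<And>p q. p \<in> Q \<Longrightarrow> q \<in> Q \<Longrightarrow> ip p q = (if p = q then 1 else 0)"
    and ann: "\<And>l t. l \<in> \<Lambda> \<Longrightarrow> (\<And>q. q \<in> Q \<Longrightarrow> ip q t = 0) \<Longrightarrow> ip l t = 0"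
    using * by simp_all
  define s where "s a = (\<Sum>q\<in>Q. (q a)\<^sup>2)" for a
  have "(\<Sum>a\<in>A. s a) = (\<Sum>q\<in>Q. ip q q)"
    unfolding s_def ip_def power2_eq_square by (rule sum.swap)
  also have "\<dots> = card Q" using Q(3) by simp
  also have "\<dots> \<le> card A * (1/2)" using Q(2) \<Lambda>(2) by linarith
  finally have tr: "(\<Sum>a\<in>A. s a) \<le> card A * (1/2)" .
  have "\<exists>a\<in>A. s a \<le> 1/2"
  proof (rule ccontr)
    assume "\<not> ?thesis"
    then have "(\<Sum>a\<in>A. 1/2) < (\<Sum>a\<in>A. s a)" using A by (intro sum_strict_mono) auto
    then show False using tr by simp
  qed
  then obtain a where a: "a \<in> A" "s a \<le> 1/2" by blast
  define t where "t b = (if b = a then 1 else 0) - (\<Sum>q\<in>Q. q a * q b)" for b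
  have ip_t: "ip f t = f a - (\<Sum>q\<in>Q. q a * ip f q)" for f
  proof -
    have "ip f t = f a - (\<Sum>b\<in>A. \<Sum>q\<in>Q. f b * (q a * q b))"
      unfolding ip_def t_def using A(1) a(1)
      by (simp add: right_diff_distrib sum_subtractf sum_distrib_left if_distrib[of "\<lambda>z. f _ * z"] cong: if_cong)
    also have "(\<Sum>b\<in>A. \<Sum>q\<in>Q. f b * (q a * q b)) = (\<Sum>q\<in>Q. q a * ip f q)"
      unfolding ip_def by (subst sum.swap) (simp add: sum_distrib_left mult_ac)
    finally show ?thesis .
  qed
  have orth: "ip q t = 0" if "q \<in> Q" for q
  proof -
    have "(\<Sum>p\<in>Q. p a * ip q p) = (\<Sum>p\<in>Q. if p = q then p a else 0)"
      using that by (intro sum.cong) (auto simp: Q(3))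
    then show ?thesis unfolding ip_t using Q(1) that by simp
  qed
  have ta: "t a = 1 - s a" unfolding t_def s_def by (simp add: power2_eq_square)
  have s0: "s a \<ge> 0" unfolding s_def by (simp add: sum_nonneg)
  have comm: "ip f g = ip g f" for f g unfolding ip_def by (simp add: mult.commute)
  \<comment> \<open>\<open>t\<close> is the projection of the basis vector at \<open>a\<close>, so
    its squared norm is its own entry there.\<close>
  have "ip t t = t a" unfolding ip_t using orth comm[of t] by simp
  then have "(\<Sum>b\<in>A. (t b)\<^sup>2) = t a" unfolding ip_def by (simp add: power2_eq_square)
  moreover have "(\<Sum>b\<in>A. l b * t b) = 0" if "l \<in> \<Lambda>" for l using ann[OF that orth] unfolding ip_def .
  ultimately show ?thesis using a ta s0 by (intro exI[of _ t] bexI[of _ a]) auto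
qed

section \<open>Densities as points of the simplex\<close>

context measure_simplex
begin

definition is_density :: "'a measure \<Rightarrow> ('a \<Rightarrow> real) \<Rightarrow> bool" where
  "is_density \<nu> g \<longleftrightarrow> g \<in> borel_measurable borel \<and> (\<exists>B. \<forall>x. 0 \<le> g x \<and> g x \<le> B) \<and> (\<integral>x. g x \<partial>\<nu>) = 1"

definition density_point :: "'a measure \<Rightarrow> ('a \<Rightarrow> real) \<Rightarrow> nat \<Rightarrow>\<^sub>C real" where
  "density_point \<nu> g = bary (density \<nu> (\<lambda>x. ennreal (g x)))"

context
  fixes \<nu> assumes \<nu>: "\<nu> \<in> prob_on"
begin

lemma density_in_prob_on:
  assumes "is_density \<nu> g" shows "density \<nu> (\<lambda>x. ennreal (g x)) \<in> prob_on"
  using assms density_prob_on(1)[OF \<nu>] unfolding is_density_def by blast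

lemma density_point_in: "is_density \<nu> g \<Longrightarrow> density_point \<nu> g \<in> K"
  unfolding density_point_def K_def using density_in_prob_on by blast

lemma ev_density_point:
  assumes "is_density \<nu> g" "f \<in> borel_measurable borel"
  shows "ev f (density_point \<nu> g) = (\<integral>x. g x * f x \<partial>\<nu> :: real)"
  using assms(1) density_prob_on(2)[OF \<nu> _ _ _ _ assms(2)]
  unfolding density_point_def meas_bary[OF density_in_prob_on[OF assms(1)]] is_density_def by blast

lemma integrable_mult_c:
  assumes "is_density \<nu> g" shows "integrable \<nu> (\<lambda>x. g x * c n x)"
proof -
  obtain B where B: "\<And>x. 0 \<le> g x" "\<And>x. g x \<le> B" and g: "g \<in> borel_measurable borel"
    using assms unfolding is_density_def by blast
  have "\<bar>g x * c n x\<bar> \<le> B * 1" for x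
    unfolding abs_mult using B[of x] c_le[of n x] by (intro mult_mono) auto
  then show ?thesis using g by (intro integrable_bounded_borel[OF \<nu>, of _ "B * 1"]) auto
qed

lemma density_point_combination:
  assumes I: "finite I" and g: "\<And>i. i \<in> I \<Longrightarrow> is_density \<nu> (g i)" and f: "is_density \<nu> f"
    and eq: "\<And>x. f x = (\<Sum>i\<in>I. w i * g i x)"
  shows "density_point \<nu> f = (\<Sum>i\<in>I. w i *\<^sub>R density_point \<nu> (g i))"
proof (rule bcontfun_eqI)
  fix n
  have "(\<integral>x. f x * c n x \<partial>\<nu>) = (\<integral>x. (\<Sum>i\<in>I. w i * (g i x * c n x)) \<partial>\<nu>)"
    unfolding eq by (simp add: sum_distrib_right mult.assoc)
  also have "\<dots> = (\<Sum>i\<in>I. w i * (\<integral>x. g i x * c n x \<partial>\<nu>))"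
    using integrable_mult_c[OF g] by (simp add: Bochner_Integration.integral_sum)
  finally have "ev (c n) (density_point \<nu> f) = (\<Sum>i\<in>I. w i * ev (c n) (density_point \<nu> (g i)))"
    using f g by (simp add: ev_density_point)
  then show "apply_bcontfun (density_point \<nu> f) n = apply_bcontfun (\<Sum>i\<in>I. w i *\<^sub>R density_point \<nu> (g i)) n"
    using f g density_point_in by (simp add: apply_bcontfun_sum apply_K sum_divide_distrib)
qed

lemma density_point_convex2:
  assumes "is_density \<nu> f" "is_density \<nu> g" "is_density \<nu> h" "\<And>x. h x = (1 - t) * f x + t * g x"
  shows "density_point \<nu> h = (1 - t) *\<^sub>R density_point \<nu> f + t *\<^sub>R density_point \<nu> g"
  using density_point_combination[of "{False, True}" "\<lambda>b. if b then g else f" h "\<lambda>b. if b then t else 1 - t"] assms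
  by simp

end

end

text \<open>The index is a pair of a frequency \<open>j\<close> and a time \<open>n\<close>: this is
  the real part of \<open>z^j w^B\<close> observed after \<open>n\<close> steps. Up to a phase the
  underlying character has indices \<open>j + n * B\<close> and \<open>B\<close>.\<close>

definition wave :: "nat \<Rightarrow> nat \<times> nat \<Rightarrow> complex \<times> complex \<Rightarrow> real" where
  "wave B a x = torus_coord (int (fst a), int B, True) ((skew ^^ snd a) x)"

lemma wave_measurable: "wave B a \<in> borel_measurable borel"
  unfolding wave_def[abs_def] using torus.self_map_funpow[OF self_map_skew] torus_coord_measurable
  unfolding torus.self_map_def by (blast intro: measurable_compose)

lemma wave_le: "\<bar>wave B a x\<bar> \<le> 1"
  unfolding wave_def by (rule torus_coord_le)

context
  fixes p assumes p: "p \<in> torus.K" "torus.push skew p = p"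
begin

lemma integral_chr_fixed: "a \<noteq> 0 \<or> b \<noteq> 0 \<Longrightarrow> (\<integral>x. chr a b x \<partial>torus.meas p) = 0"
  using periodic_integral_chr[OF p(1), of 1] p(2) by simp

lemma fixed_funpow: "(torus.push skew ^^ n) p = p"
  by (induction n) (simp_all add: p(2))

lemma integral_wave:
  assumes "B > 0" shows "torus.ev (wave B a) p = 0"
proof -
  have "torus.ev (wave B a) p = torus.ev (torus_coord (int (fst a), int B, True)) ((torus.push skew ^^ snd a) p)"
    unfolding wave_def[abs_def] by (rule torus.ev_push_funpow[OF self_map_skew p(1) torus_coord_measurable, symmetric])
  also have "\<dots> = 0"
    unfolding fixed_funpow integral_torus_coord[OF torus.meas_in[OF p(1)]] using assms by (simp add: integral_chr_fixed)
  finally show ?thesis .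
qed

text \<open>In the product of two waves, the sum of the frequencies has second index
  \<open>2 * B\<close> and integrates to 0. The difference has first index
  \<open>e a - e a'\<close>, which vanishes only for equal pairs: the frequency is the remainder of
  \<open>e\<close> modulo \<open>B\<close> and the time is the quotient.\<close>

lemma integral_wave_mult:
  assumes B: "B > 0" and a: "fst a < B" "fst a' < B"
  shows "torus.ev (\<lambda>x. wave B a x * wave B a' x) p = (if a = a' then 1/2 else 0)"
proof -
  let ?\<mu> = "torus.meas p"
  note \<mu> = torus.meas_in[OF p(1)]
  define e where "e b = int (fst b) + int (snd b) * int B" for b :: "nat \<times> nat"
  have "\<exists>\<theta>. norm \<theta> = 1 \<and> (\<forall>x\<in>torus. chr (int (fst b)) (int B) ((skew ^^ snd b) x) = \<theta> * chr (e b) (int B) x)" for b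
    unfolding e_def by (rule chr_skew_funpow)
  then obtain \<theta> where \<theta>: "\<And>b. norm (\<theta> b) = 1"
    "\<And>b x. x \<in> torus \<Longrightarrow> chr (int (fst b)) (int B) ((skew ^^ snd b) x) = \<theta> b * chr (e b) (int B) x" by metis
  have wave: "wave B b x = Re (\<theta> b * chr (e b) (int B) x)" if "x \<in> torus" for b x
    unfolding wave_def using that funpow_skew_in \<theta>(2) by (simp add: torus_coord_simps)
  define f where "f x = \<theta> a * \<theta> a' / 2 * chr (e a + e a') (int B + int B) x + \<theta> a * cnj (\<theta> a') / 2 * chr (e a - e a') 0 x" for x
  have "torus.ev (\<lambda>x. wave B a x * wave B a' x) p = (\<integral>x. Re (f x) \<partial>?\<mu>)"
  proof (rule integral_cong_AE)
    show "(\<lambda>x. wave B a x * wave B a' x) \<in> borel_measurable ?\<mu>"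
      by (intro borel_measurable_times torus.measurable_prob_on[OF \<mu> wave_measurable])
    have "f \<in> borel_measurable ?\<mu>" unfolding f_def[abs_def]
      by (intro borel_measurable_add borel_measurable_times borel_measurable_const torus.measurable_prob_on[OF \<mu> chr_measurable])
    then show "(\<lambda>x. Re (f x)) \<in> borel_measurable ?\<mu>" by simp
    show "AE x in ?\<mu>. wave B a x * wave B a' x = Re (f x)"
      using torus.AE_prob_on[OF \<mu>]
    proof eventually_elim
      case (elim x)
      have m: "chr (e a - e a') 0 x = chr (e a) (int B) x * cnj (chr (e a') (int B) x)"
        unfolding chr_minus[OF elim, symmetric] chr_add[OF elim, symmetric] by simp
      define u v where "u = \<theta> a * chr (e a) (int B) x" and "v = \<theta> a' * chr (e a') (int B) x"
      have fx: "f x = (u * v + u * cnj v) / 2"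
        unfolding f_def chr_add[OF elim] m u_def v_def by (simp add: field_simps)
      have "wave B a x * wave B a' x = Re u * Re v" unfolding wave[OF elim] u_def v_def ..
      also have "\<dots> = Re ((u * v + u * cnj v) / 2)" by simp
      finally show ?case unfolding fx .
    qed
  qed
  also have "\<dots> = Re (\<integral>x. f x \<partial>?\<mu>)"
  proof -
    have "integrable ?\<mu> f" unfolding f_def[abs_def]
      by (intro Bochner_Integration.integrable_add integrable_mult_right integrable_chr \<mu>)
    then show ?thesis by simp
  qed
  also have "(\<integral>x. f x \<partial>?\<mu>) = \<theta> a * \<theta> a' / 2 * (\<integral>x. chr (e a + e a') (int B + int B) x \<partial>?\<mu>) + \<theta> a * cnj (\<theta> a') / 2 * (\<integral>x. chr (e a - e a') 0 x \<partial>?\<mu>)"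
    unfolding f_def using integrable_chr[OF \<mu>] by simp
  also have "\<dots> = \<theta> a * cnj (\<theta> a') / 2 * (\<integral>x. chr (e a - e a') 0 x \<partial>?\<mu>)" using B by (simp add: integral_chr_fixed)
  also have "Re \<dots> = (if a = a' then 1/2 else 0)"
  proof (cases "a = a'")
    case True
    interpret prob_space ?\<mu> using \<mu> by (rule torus.prob_space_prob_on)
    show ?thesis using True cnj_mult_self[OF \<theta>(1)] by (simp add: chr_0 prob_space)
  next
    case False
    have "e a \<noteq> e a'"
    proof
      assume "e a = e a'"
      then have eq: "fst a + snd a * B = fst a' + snd a' * B" unfolding e_def by (metis of_nat_add of_nat_eq_iff of_nat_mult)
      then have "(fst a + snd a * B) mod B = (fst a' + snd a' * B) mod B" by simp
      then have "fst a = fst a'" using a by simp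
      then show False using eq B False by (simp add: prod_eq_iff)
    qed
    then show ?thesis using False by (simp add: integral_chr_fixed)
  qed
  finally show ?thesis .
qed

text \<open>The bound 1/4 does not depend on \<open>d\<close>, which is what the limit over growing
  windows needs. Counting dimensions gives wave coefficients that no \<open>F m i\<close> in an
  enlarged window sees; the positive and negative parts of the resulting function give the two
  measures.\<close>

lemma exists_nearly_indistinguishable:
  fixes F :: "int \<Rightarrow> nat \<Rightarrow> (nat \<Rightarrow>\<^sub>C real) \<Rightarrow> real"
  assumes k: "k \<ge> 1" and F: "\<And>m i. i < k \<Longrightarrow> affine_map_on torus.K (F m i)"
    and shift: "\<And>m i q. i < k \<Longrightarrow> q \<in> torus.K \<Longrightarrow> F m i (torus.push skew q) = F (m + 1) i q"
  obtains q q' where "q \<in> torus.K" "q' \<in> torus.K"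
    "\<And>m i. i < k \<Longrightarrow> \<bar>m\<bar> \<le> int d \<Longrightarrow> F m i q = F m i q'"
    "(\<Sum>j<4 * k. \<bar>torus.ev (torus_coord (int j, int (4 * k), True)) q - torus.ev (torus_coord (int j, int (4 * k), True)) q'\<bar>) \<ge> 1/4"
proof -
  let ?\<mu> = "torus.meas p"
  let ?D = "torus.density_point ?\<mu>"
  note \<mu> = torus.meas_in[OF p(1)]
  interpret prob_space ?\<mu> using \<mu> by (rule torus.prob_space_prob_on)
  \<comment> \<open>This makes \<open>4 * k * (2 * d + 1)\<close> waves against
    \<open>(4 * d + 1) * k\<close> conditions, at least twice as many, as
    \<open>exists_concentrated_vector\<close> demands.\<close>
  define B where "B = 4 * k"
  have B: "B > 0" using k unfolding B_def by simp
  define h where "h = wave B"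
  have hm: "h a \<in> borel_measurable borel" for a unfolding h_def by (rule wave_measurable)
  have h1: "\<bar>h a x\<bar> \<le> 1" for a x unfolding h_def by (rule wave_le)
  have hi: "integrable ?\<mu> (h a)" for a using hm h1 by (intro torus.integrable_bounded_borel[OF \<mu>, of _ 1])
  have hhi: "integrable ?\<mu> (\<lambda>x. h a x * h b x)" for a b
  proof (rule torus.integrable_bounded_borel[OF \<mu>, of _ "1 * 1"])
    show "\<bar>h a x * h b x\<bar> \<le> 1 * 1" for x unfolding abs_mult using h1 by (intro mult_mono) auto
  qed (intro borel_measurable_times hm)
  have dens1: "torus.is_density ?\<mu> (\<lambda>x. 1 + s * h a x)" if "\<bar>s\<bar> \<le> 1" for s a
    unfolding torus.is_density_def
  proof (intro conjI exI[of _ 2] allI)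
    have "\<bar>s * h a x\<bar> \<le> 1 * 1" for x unfolding abs_mult using h1 that by (intro mult_mono) auto
    then have b: "- 1 \<le> s * h a x" "s * h a x \<le> 1" for x by (simp_all add: abs_le_iff minus_le_iff)
    show "0 \<le> 1 + s * h a x" "1 + s * h a x \<le> 2" for x using b[of x] by linarith+
    show "(\<lambda>x. 1 + s * h a x) \<in> borel_measurable borel" using hm by simp
    show "(\<integral>x. 1 + s * h a x \<partial>?\<mu>) = 1" using hi integral_wave[OF B] by (simp add: h_def prob_space)
  qed
  have dens0: "torus.is_density ?\<mu> (\<lambda>_. 1)" using dens1[of 0] by simp
  have D1: "?D (\<lambda>_. 1) = p"
    by (rule torus.K_eqI[OF torus.density_point_in[OF \<mu> dens0] p(1)])
      (simp add: torus.ev_density_point[OF \<mu> dens0 torus.c_meas])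
  define A where "A = {..<B} \<times> {..2 * d}"
  \<comment> \<open>The large coefficient may sit at any time up to \<open>2 * d\<close>, and the
    pair is finally moved by that time; the window from \<open>-d\<close> to \<open>d\<close> then
    reaches up to \<open>3 * d\<close>.\<close>
  define J where "J = {- int d..3 * int d} \<times> {..<k}"
  define lam where "lam mi a = F (fst mi) (snd mi) (?D (\<lambda>x. 1 + 1 * h a x)) - F (fst mi) (snd mi) p" for mi a
  have A: "finite A" "A \<noteq> {}" "card A = B * (2 * d + 1)" unfolding A_def using B by (auto simp: card_cartesian_product)
  have J: "finite J" "card J = (4 * d + 1) * k" unfolding J_def by (auto simp: card_cartesian_product nat_add_distrib)
  have "card (lam ` J) \<le> (4 * d + 1) * k" using card_image_le[OF J(1), of lam] J(2) by simp
  then have "2 * card (lam ` J) \<le> 2 * ((4 * d + 1) * k)" by simp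
  also have "\<dots> \<le> card A" unfolding A(3) B_def by (simp add: algebra_simps)
  finally have card: "2 * card (lam ` J) \<le> card A" .
  from exists_concentrated_vector[OF A(1,2) finite_imageI[OF J(1)] card]
  obtain t where "\<exists>a\<in>A. t a \<ge> 1/2 \<and> t a \<le> 1 \<and> (\<Sum>b\<in>A. (t b)\<^sup>2) = t a \<and> (\<forall>l\<in>lam ` J. (\<Sum>b\<in>A. l b * t b) = 0)"
    by (rule exE)
  then obtain a0 where t: "a0 \<in> A" "t a0 \<ge> 1/2" "t a0 \<le> 1" "(\<Sum>b\<in>A. (t b)\<^sup>2) = t a0"
    and ann: "\<forall>l\<in>lam ` J. (\<Sum>b\<in>A. l b * t b) = 0" by (elim bexE conjE)
  define H where "H x = (\<Sum>a\<in>A. t a * h a x)" for x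
  define C0 where "C0 = (\<Sum>a\<in>A. \<bar>t a\<bar>)"
  define C where "C = 1 + C0"
  have C0: "C0 \<ge> 0" unfolding C0_def by (simp add: sum_nonneg)
  have C: "C \<ge> 1" unfolding C_def using C0 by simp
  have Hm: "H \<in> borel_measurable borel" unfolding H_def[abs_def] using hm by (intro borel_measurable_sum borel_measurable_times) auto
  have HC: "\<bar>H x\<bar> \<le> C0" for x
    unfolding H_def C0_def
  proof (rule order_trans[OF sum_abs sum_mono])
    show "\<bar>t a * h a x\<bar> \<le> \<bar>t a\<bar>" for a using mult_left_mono[OF h1, of "\<bar>t a\<bar>" a x] by (simp add: abs_mult)
  qed
  have Hi: "integrable ?\<mu> H" unfolding H_def[abs_def] using hi by auto
  have H0: "(\<integral>x. H x \<partial>?\<mu>) = 0"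
    unfolding H_def using hi integral_wave[OF B] by (simp add: h_def)
  have Hh: "(\<integral>x. H x * h b x \<partial>?\<mu>) = t b / 2" if b: "b \<in> A" for b
  proof -
    have "(\<integral>x. H x * h b x \<partial>?\<mu>) = (\<Sum>a\<in>A. t a * (\<integral>x. h a x * h b x \<partial>?\<mu>))"
      unfolding H_def using hhi by (simp add: sum_distrib_right mult.assoc)
    also have "\<dots> = (\<Sum>a\<in>A. if a = b then t a / 2 else 0)"
    proof (intro sum.cong refl)
      fix a assume "a \<in> A"
      then have "fst a < B" "fst b < B" using b unfolding A_def by auto
      then show "t a * (\<integral>x. h a x * h b x \<partial>?\<mu>) = (if a = b then t a / 2 else 0)"
        unfolding h_def by (simp add: integral_wave_mult[OF B])
    qed
    finally show ?thesis using A(1) b by simp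
  qed
  have Hhi: "integrable ?\<mu> (\<lambda>x. H x * h b x)" for b
    unfolding H_def sum_distrib_right mult.assoc using hhi by auto
  have HH: "(\<integral>x. (H x)\<^sup>2 \<partial>?\<mu>) = t a0 / 2" and HHi: "integrable ?\<mu> (\<lambda>x. (H x)\<^sup>2)"
  proof -
    have sq: "(H x)\<^sup>2 = (\<Sum>b\<in>A. t b * (H x * h b x))" for x
      unfolding power2_eq_square by (subst (2) H_def) (simp add: sum_distrib_left mult_ac)
    show "integrable ?\<mu> (\<lambda>x. (H x)\<^sup>2)" unfolding sq using Hhi by auto
    have "(\<integral>x. (H x)\<^sup>2 \<partial>?\<mu>) = (\<Sum>b\<in>A. t b * (\<integral>x. H x * h b x \<partial>?\<mu>))" unfolding sq using Hhi by simp
    also have "\<dots> = (\<Sum>b\<in>A. t b * (t b / 2))" by (intro sum.cong refl) (simp add: Hh)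
    also have "\<dots> = (\<Sum>b\<in>A. (t b)\<^sup>2) / 2" by (simp add: sum_divide_distrib power2_eq_square)
    finally show "(\<integral>x. (H x)\<^sup>2 \<partial>?\<mu>) = t a0 / 2" unfolding t(4) .
  qed
  \<comment> \<open>The second moment of \<open>H\<close> is \<open>t a0 / 2\<close>, so the mass
    \<open>M\<close> of its positive part is bounded even if the sup bound \<open>C0\<close> is
    huge. This keeps the padding \<open>1 - M\<close> nonnegative.\<close>
  define M where "M = (\<integral>x. max 0 (H x) \<partial>?\<mu>)"
  have maxi: "integrable ?\<mu> (\<lambda>x. max 0 (H x))" using Hi by simp
  have M: "0 \<le> M" "M \<le> 1"
  proof -
    show "0 \<le> M" unfolding M_def by (rule Bochner_Integration.integral_nonneg) simp
    have "max 0 z \<le> (1 + z\<^sup>2) / 2" for z :: real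
      using zero_le_power2[of "z - 1"] by (simp add: max_def power2_eq_square algebra_simps)
    then have "M \<le> (\<integral>x. (1 + (H x)\<^sup>2) / 2 \<partial>?\<mu>)" unfolding M_def using maxi HHi by (intro integral_mono) auto
    also have "\<dots> = (1 + t a0 / 2) / 2" using HHi HH by (simp add: prob_space)
    finally show "M \<le> 1" using t(3) by simp
  qed
  \<comment> \<open>The positive and negative parts of \<open>H\<close> plus a common constant:
    \<open>H\<close> has mean 0, so both parts have mass \<open>M\<close>. Their difference is
    \<open>H\<close> without any scaling.\<close>
  define g where "g s x = max 0 (s * H x) + (1 - M)" for s x
  define E where "E s x = 1 + s / C * H x" for s x
  have g: "torus.is_density ?\<mu> (g s)" if s: "s = 1 \<or> s = -1" for s
    unfolding torus.is_density_def
  proof (intro conjI exI[of _ "C0 + (1 - M)"] allI)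
    show "g s \<in> borel_measurable borel" unfolding g_def[abs_def] using Hm by simp
    have "\<bar>s * H x\<bar> \<le> C0" for x using HC[of x] s by (auto simp: abs_mult)
    then show "g s x \<le> C0 + (1 - M)" for x unfolding g_def using C0 by (simp add: abs_le_iff)
    show "0 \<le> g s x" for x unfolding g_def using M by simp
    have "(\<integral>x. max 0 (s * H x) \<partial>?\<mu>) = M"
    proof (cases "s = 1")
      case False
      then have "max 0 (s * H x) = max 0 (H x) - H x" for x using s by (auto simp: max_def)
      then show ?thesis using maxi Hi H0 unfolding M_def by simp
    qed (simp add: M_def)
    moreover have "integrable ?\<mu> (\<lambda>x. max 0 (s * H x))" using Hi by simp
    ultimately show "(\<integral>x. g s x \<partial>?\<mu>) = 1" unfolding g_def by (simp add: prob_space)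
  qed
  have E: "torus.is_density ?\<mu> (E s)" if s: "s = 1 \<or> s = -1" for s
    unfolding torus.is_density_def
  proof (intro conjI exI[of _ 2] allI)
    show "E s \<in> borel_measurable borel" unfolding E_def[abs_def] using Hm by simp
    have "\<bar>s / C * H x\<bar> \<le> 1" for x
    proof -
      have "\<bar>s / C * H x\<bar> = \<bar>H x\<bar> / C" using s C by (auto simp: abs_mult)
      also have "\<dots> \<le> C / C" using HC[of x] C by (intro divide_right_mono) (auto simp: C_def)
      finally show ?thesis using C by simp
    qed
    then have b: "- 1 \<le> s / C * H x" "s / C * H x \<le> 1" for x by (simp_all only: abs_le_iff minus_le_iff)
    show "0 \<le> E s x" "E s x \<le> 2" for x using b[of x] unfolding E_def by linarith+
    show "(\<integral>x. E s x \<partial>?\<mu>) = 1" unfolding E_def using Hi H0 by (simp add: prob_space)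
  qed
  have aff: "F m i ((1 - u) *\<^sub>R x + u *\<^sub>R y) = (1 - u) * F m i x + u * F m i y"
    if "i < k" "x \<in> torus.K" "y \<in> torus.K" "u \<in> {0..1}" for m i x y u
    using F[OF that(1), of m] that unfolding affine_map_on_def by simp
  \<comment> \<open>\<open>p\<close> is the midpoint of the points with densities
    \<open>1 - h a\<close> and \<open>1 + h a\<close>, so affinity makes increments in opposite
    directions opposite.\<close>
  have F1: "F m i (?D (\<lambda>x. 1 + s * h a x)) = F m i p + s * lam (m, i) a"
    if i: "i < k" and s: "s = -1 \<or> s = 0 \<or> s = 1" for m i s a
  proof -
    have "?D (\<lambda>_. 1) = (1 - 1/2) *\<^sub>R ?D (\<lambda>x. 1 + (-1) * h a x) + (1/2) *\<^sub>R ?D (\<lambda>x. 1 + 1 * h a x)"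
      using dens1[of "-1" a] dens1[of 1 a] dens0 by (intro torus.density_point_convex2[OF \<mu>]) (auto simp: field_simps)
    then have "F m i p = (1 - 1/2) * F m i (?D (\<lambda>x. 1 + (-1) * h a x)) + (1/2) * F m i (?D (\<lambda>x. 1 + 1 * h a x))"
      unfolding D1 using aff[OF i torus.density_point_in[OF \<mu> dens1[of "-1" a]] torus.density_point_in[OF \<mu> dens1[of 1 a]], of "1/2" m] by simp
    then show ?thesis using s D1 unfolding lam_def by auto
  qed
  \<comment> \<open>\<open>E s\<close> is the convex combination of the densities 1 and
    \<open>1 + s * sgn (t a) * h a\<close> with weights \<open>1 / C\<close> and
    \<open>\<bar>t a\<bar> / C\<close>. The increments add up to a multiple of a sum that the choice
    of \<open>t\<close> annihilates.\<close>
  have FE: "F m i (?D (E s)) = F m i p" if mi: "(m, i) \<in> J" and s: "s = 1 \<or> s = -1" for m i s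
  proof -
    have i: "i < k" using mi unfolding J_def by simp
    define w where "w o' = (case o' of None \<Rightarrow> 1 / C | Some a \<Rightarrow> \<bar>t a\<bar> / C)" for o'
    define f where "f o' = (case o' of None \<Rightarrow> \<lambda>_. 1 | Some a \<Rightarrow> \<lambda>x. 1 + s * sgn (t a) * h a x)" for o'
    let ?I = "insert None (Some ` A)"
    have sumI: "(\<Sum>o'\<in>?I. G o') = G None + (\<Sum>a\<in>A. G (Some a))" for G :: "(nat \<times> nat) option \<Rightarrow> 'z::comm_monoid_add"
      using A(1) by (subst sum.insert) (auto simp: sum.reindex)
    have sg: "s * sgn (t a) = -1 \<or> s * sgn (t a) = 0 \<or> s * sgn (t a) = 1" for a using s by (auto simp: sgn_if)
    have fd: "torus.is_density ?\<mu> (f o')" for o'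
    proof (cases o')
      case (Some a)
      then show ?thesis using dens1[of "s * sgn (t a)" a] sg[of a] unfolding f_def by auto
    qed (simp add: f_def dens0)
    have w: "w o' \<ge> 0" for o' unfolding w_def using C by (cases o') auto
    have w1: "sum w ?I = 1"
      unfolding sumI w_def using C by (simp add: C0_def[symmetric] sum_divide_distrib[symmetric] C_def add_divide_distrib[symmetric])
    have "E s x = (\<Sum>o'\<in>?I. w o' * f o' x)" for x
    proof -
      have "(\<Sum>o'\<in>?I. w o' * f o' x) = (\<Sum>o'\<in>?I. w o') + s / C * (\<Sum>a\<in>A. \<bar>t a\<bar> * sgn (t a) * h a x)"
        unfolding sumI w_def f_def by (simp add: distrib_left sum.distrib sum_distrib_left mult_ac)
      also have "\<dots> = E s x" unfolding w1 E_def H_def by (simp add: abs_mult_sgn)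
      finally show ?thesis ..
    qed
    then have "?D (E s) = (\<Sum>o'\<in>?I. w o' *\<^sub>R ?D (f o'))"
      using A(1) fd E[OF s] by (intro torus.density_point_combination[OF \<mu>]) auto
    then have "F m i (?D (E s)) = (\<Sum>o'\<in>?I. w o' *\<^sub>R F m i (?D (f o')))"
      using affine_map_on_sum[OF torus.convex_K F[OF i, of m], of ?I w "\<lambda>o'. ?D (f o')"] A(1) w w1
        torus.density_point_in[OF \<mu> fd] by simp
    also have "\<dots> = (\<Sum>o'\<in>?I. w o' * F m i p) + s / C * (\<Sum>a\<in>A. lam (m, i) a * t a)"
    proof -
      have "w (Some a) * F m i (?D (f (Some a))) = w (Some a) * F m i p + s / C * (lam (m, i) a * t a)" for a
      proof -
        have "w (Some a) * F m i (?D (f (Some a))) = w (Some a) * F m i p + s / C * (lam (m, i) a * (\<bar>t a\<bar> * sgn (t a)))"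
          unfolding f_def w_def using F1[OF i sg[of a], of m a] by (simp add: distrib_left)
        then show ?thesis by (simp only: abs_mult_sgn)
      qed
      moreover have "f None = (\<lambda>_. 1)" by (simp add: f_def)
      ultimately show ?thesis unfolding sumI by (simp add: D1 sum.distrib sum_distrib_left)
    qed
    also have "(\<Sum>a\<in>A. lam (m, i) a * t a) = 0" using ann mi by blast
    also have "(\<Sum>o'\<in>?I. w o' * F m i p) = F m i p" using w1 by (simp only: sum_distrib_right[symmetric] mult_1)
    finally show ?thesis by simp
  qed
  \<comment> \<open>Chosen so that \<open>1 - u = u * (2 / C)\<close>. As
    \<open>g 1 - g (-1) = H\<close> and \<open>E 1 - E (-1) = 2 / C * H\<close>, mixing
    \<open>g\<close> with \<open>E\<close> of the opposite sign then gives the same density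
    \<open>Z\<close> for both signs.\<close>
  define u where "u = (C / 2) / (1 + C / 2)"
  have u: "u \<in> {0..1}" "1 - u = 1 / (1 + C / 2)" using C unfolding u_def by (auto simp: field_simps)
  define Z where "Z x = (1 - u) * g 1 x + u * E (-1) x" for x
  have Z': "Z x = (1 - u) * g (-1) x + u * E 1 x" for x
  proof -
    have d: "g 1 x - g (-1) x = H x" "E 1 x - E (-1) x = 2 / C * H x"
      unfolding g_def E_def by (simp_all add: max_def algebra_simps)
    have "1 - u = u * (2 / C)" unfolding u(2) u_def using C by (simp add: field_simps)
    then have "(1 - u) * H x = u * (2 / C) * H x" by (rule arg_cong)
    then have "(1 - u) * (g 1 x - g (-1) x) = u * (E 1 x - E (-1) x)" unfolding d by (simp only: mult.assoc)
    then show ?thesis unfolding Z_def by (simp add: algebra_simps)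
  qed
  have Zd: "torus.is_density ?\<mu> Z"
  proof -
    obtain Bg where Bg: "\<And>x. 0 \<le> g 1 x" "\<And>x. g 1 x \<le> Bg" and gm: "g 1 \<in> borel_measurable borel" and gi: "(\<integral>x. g 1 x \<partial>?\<mu>) = 1"
      using g[of 1] unfolding torus.is_density_def by auto
    obtain BE where BE: "\<And>x. 0 \<le> E (-1) x" "\<And>x. E (-1) x \<le> BE" and Em: "E (-1) \<in> borel_measurable borel" and Ei: "(\<integral>x. E (-1) x \<partial>?\<mu>) = 1"
      using E[of "-1"] unfolding torus.is_density_def by auto
    have i: "integrable ?\<mu> (g 1)" "integrable ?\<mu> (E (-1))"
      by (rule torus.integrable_bounded_borel[OF \<mu> gm, of Bg], simp only: abs_of_nonneg[OF Bg(1)] Bg(2))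
        (rule torus.integrable_bounded_borel[OF \<mu> Em, of BE], simp only: abs_of_nonneg[OF BE(1)] BE(2))
    show ?thesis
      unfolding torus.is_density_def
    proof (intro conjI exI[of _ "(1 - u) * Bg + u * BE"] allI)
      show "Z \<in> borel_measurable borel" unfolding Z_def[abs_def] using gm Em by simp
      show "0 \<le> Z x" for x unfolding Z_def using u(1) Bg(1) BE(1) by simp
      show "Z x \<le> (1 - u) * Bg + u * BE" for x unfolding Z_def using u(1) Bg(2) BE(2) by (intro add_mono mult_left_mono) auto
      show "(\<integral>x. Z x \<partial>?\<mu>) = 1" unfolding Z_def using i gi Ei by simp
    qed
  qed
  have Feq: "F m i (?D (g 1)) = F m i (?D (g (-1)))" if mi: "(m, i) \<in> J" for m i
  proof -
    have i: "i < k" using mi unfolding J_def by simp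
    have "?D Z = (1 - u) *\<^sub>R ?D (g 1) + u *\<^sub>R ?D (E (-1))"
      using g[of 1] E[of "-1"] Zd Z_def by (intro torus.density_point_convex2[OF \<mu>]) auto
    then have 1: "F m i (?D Z) = (1 - u) * F m i (?D (g 1)) + u * F m i p"
      using aff[OF i _ _ u(1)] torus.density_point_in[OF \<mu>] g[of 1] E[of "-1"] FE[OF mi, of "-1"] by simp
    have "?D Z = (1 - u) *\<^sub>R ?D (g (-1)) + u *\<^sub>R ?D (E 1)"
      using g[of "-1"] E[of 1] Zd Z' by (intro torus.density_point_convex2[OF \<mu>]) auto
    then have "F m i (?D Z) = (1 - u) * F m i (?D (g (-1))) + u * F m i p"
      using aff[OF i _ _ u(1)] torus.density_point_in[OF \<mu>] g[of "-1"] E[of 1] FE[OF mi, of 1] by simp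
    with 1 have "(1 - u) * F m i (?D (g 1)) = (1 - u) * F m i (?D (g (-1)))" by linarith
    moreover have "1 - u \<noteq> 0" unfolding u(2) using C by simp
    ultimately show ?thesis by simp
  qed
  define y where "y s = ?D (g s)" for s
  have y: "y s \<in> torus.K" if "s = 1 \<or> s = -1" for s unfolding y_def by (rule torus.density_point_in[OF \<mu> g[OF that]])
  define n0 where "n0 = snd a0"
  \<comment> \<open>Moving by the time \<open>n0\<close> of the large coefficient brings it to time
    0, where one of the \<open>4 * k\<close> coordinates in the conclusion sees it.\<close>
  define q where "q s = (torus.push skew ^^ n0) (y s)" for s
  have Fq: "F m i (q s) = F (m + int n0) i (y s)" if "i < k" and s: "s = 1 \<or> s = -1" for m i s
  proof -
    have "F m i ((torus.push skew ^^ n) (y s)) = F (m + int n) i (y s)" for n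
    proof (induction n arbitrary: m)
      case (Suc n)
      then show ?case using shift[OF \<open>i < k\<close> torus.funpow_push_in[OF self_map_skew y[OF s], of n], of m]
        by (simp add: algebra_simps)
    qed simp
    then show ?thesis unfolding q_def .
  qed
  show thesis
  proof (rule that[of "q 1" "q (-1)"])
    show "q 1 \<in> torus.K" "q (-1) \<in> torus.K"
      unfolding q_def using y by (auto intro: torus.funpow_push_in[OF self_map_skew])
    have n0: "n0 \<le> 2 * d" and j0: "fst a0 < 4 * k" using t(1) unfolding n0_def A_def B_def by auto
    show "F m i (q 1) = F m i (q (-1))" if "i < k" "\<bar>m\<bar> \<le> int d" for m i
    proof -
      have "(m + int n0, i) \<in> J" unfolding J_def using that n0 by auto
      then show ?thesis using Feq that(1) by (simp add: Fq y_def)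
    qed
    let ?c = "\<lambda>j. torus_coord (int j, int (4 * k), True)"
    have "torus.ev (?c (fst a0)) (q s) = (\<integral>x. g s x * h a0 x \<partial>?\<mu>)" if s: "s = 1 \<or> s = -1" for s
    proof -
      have "torus.ev (?c (fst a0)) (q s) = torus.ev (\<lambda>x. ?c (fst a0) ((skew ^^ n0) x)) (y s)"
        unfolding q_def by (rule torus.ev_push_funpow[OF self_map_skew y[OF s] torus_coord_measurable])
      also have "\<dots> = torus.ev (h a0) (y s)" unfolding h_def wave_def[abs_def] n0_def B_def ..
      also have "\<dots> = (\<integral>x. g s x * h a0 x \<partial>?\<mu>)" unfolding y_def by (rule torus.ev_density_point[OF \<mu> g[OF s] hm])
      finally show ?thesis .
    qed
    then have "torus.ev (?c (fst a0)) (q 1) - torus.ev (?c (fst a0)) (q (-1)) = (\<integral>x. g 1 x * h a0 x \<partial>?\<mu>) - (\<integral>x. g (-1) x * h a0 x \<partial>?\<mu>)"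
      by simp
    also have "\<dots> = (\<integral>x. g 1 x * h a0 x - g (-1) x * h a0 x \<partial>?\<mu>)"
    proof -
      have "integrable ?\<mu> (\<lambda>x. g s x * h a0 x)" if s: "s = 1 \<or> s = -1" for s
      proof -
        obtain Bg where Bg: "\<And>x. 0 \<le> g s x" "\<And>x. g s x \<le> Bg" and gm: "g s \<in> borel_measurable borel"
          using g[OF s] unfolding torus.is_density_def by auto
        have "\<bar>g s x * h a0 x\<bar> \<le> Bg * 1" for x
          unfolding abs_mult using Bg[of x] h1[of a0 x] by (intro mult_mono) auto
        then show ?thesis using gm hm by (intro torus.integrable_bounded_borel[OF \<mu>, of _ "Bg * 1"]) auto
      qed
      from this[of 1] this[of "-1"] show ?thesis by simp
    qed
    also have "\<dots> = (\<integral>x. H x * h a0 x \<partial>?\<mu>)"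
      by (intro Bochner_Integration.integral_cong) (auto simp: g_def max_def left_diff_distrib[symmetric])
    also have "\<dots> \<ge> 1/4" using Hh[OF t(1)] t(2) by simp
    finally have "1/4 \<le> \<bar>torus.ev (?c (fst a0)) (q 1) - torus.ev (?c (fst a0)) (q (-1))\<bar>" by linarith
    also have "\<dots> \<le> (\<Sum>j<4 * k. \<bar>torus.ev (?c j) (q 1) - torus.ev (?c j) (q (-1))\<bar>)"
      using j0 by (intro member_le_sum[where i="fst a0"]) auto
    finally show "1/4 \<le> (\<Sum>j<4 * k. \<bar>torus.ev (?c j) (q 1) - torus.ev (?c j) (q (-1))\<bar>)" .
  qed
qed

end

text \<open>Pairs that agree on longer and longer windows accumulate at a pair that agrees at all
  times, because the components of \<open>\<phi>\<close> are continuous. The sum over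
  \<open>4 * k\<close> fixed coordinates stays at least 1/4, so the limit pair is distinct, against
  injectivity.\<close>

lemma not_embeds_affinely_skew:
  assumes k: "k \<ge> 1" shows "\<not> embeds_affinely torus.K (torus.push skew) k"
proof
  assume "embeds_affinely torus.K (torus.push skew) k"
  then obtain \<phi> where cont: "continuous_map (top_of_set torus.K) (cube_shift_space k) \<phi>" and inj: "inj_on \<phi> torus.K"
    and aff: "\<And>n i. i < k \<Longrightarrow> affine_map_on torus.K (\<lambda>x. \<phi> x n i)"
    and equiv: "\<And>x. x \<in> torus.K \<Longrightarrow> \<phi> (torus.push skew x) = shift (\<phi> x)"
    unfolding embeds_affinely_def by blast
  have cont1: "continuous_map (top_of_set torus.K) (product_topology (\<lambda>i. top_of_set {0..1}) {..<k}) (\<lambda>x. \<phi> x n)" for n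
    using cont unfolding cube_shift_space_def continuous_map_componentwise by blast
  have extn: "\<phi> x n \<in> extensional {..<k}" if "x \<in> torus.K" for x n
    using cont1[of n] that unfolding continuous_map_componentwise by auto
  have cont2: "continuous_on torus.K (\<lambda>x. \<phi> x n i)" if "i < k" for n i
    using cont1[of n] that unfolding continuous_map_componentwise
    by (auto simp: continuous_map_in_subtopology)
  obtain p where p: "p \<in> torus.K" "torus.push skew p = p" using unique_periodic_point by blast
  define f where "f j q = torus.ev (torus_coord (int j, int (4 * k), True)) q" for j q
  have "\<exists>z. z \<in> torus.K \<times> torus.K \<and> (\<forall>m i. i < k \<longrightarrow> \<bar>m\<bar> \<le> int d \<longrightarrow> \<phi> (fst z) m i = \<phi> (snd z) m i) \<and>
      (\<Sum>j<4 * k. \<bar>f j (fst z) - f j (snd z)\<bar>) \<ge> 1/4" (is "\<exists>z. ?P d z") for d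
  proof -
    have sh: "\<phi> (torus.push skew q) m i = \<phi> q (m + 1) i" if "q \<in> torus.K" for m i q
      using equiv[OF that] by (simp add: shift_def)
    obtain q q' where "q \<in> torus.K" "q' \<in> torus.K"
      "\<And>m i. i < k \<Longrightarrow> \<bar>m\<bar> \<le> int d \<Longrightarrow> \<phi> q m i = \<phi> q' m i"
      "(\<Sum>j<4 * k. \<bar>f j q - f j q'\<bar>) \<ge> 1/4"
      using exists_nearly_indistinguishable[OF p k, where F="\<lambda>m i q. \<phi> q m i" and d=d, OF aff sh]
      unfolding f_def by blast
    then show ?thesis by (intro exI[of _ "(q, q')"]) auto
  qed
  then have "\<forall>d. \<exists>z. ?P d z" by blast
  from choice[OF this] obtain z where z': "\<forall>d. ?P d (z d)" by (rule exE)
  have z: "\<And>d. z d \<in> torus.K \<times> torus.K"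
    "\<And>d m i. i < k \<Longrightarrow> \<bar>m\<bar> \<le> int d \<Longrightarrow> \<phi> (fst (z d)) m i = \<phi> (snd (z d)) m i"
    "\<And>d. (\<Sum>j<4 * k. \<bar>f j (fst (z d)) - f j (snd (z d))\<bar>) \<ge> 1/4" using z' by blast+
  have "compact (torus.K \<times> torus.K)" by (intro compact_Times torus.compact_K)
  then obtain l r where l: "l \<in> torus.K \<times> torus.K" and r: "strict_mono r" "(z \<circ> r) \<longlonglongrightarrow> l"
    using z(1) unfolding compact_eq_seq_compact_metric seq_compact_def by meson
  have lK: "fst l \<in> torus.K" "snd l \<in> torus.K" using l by auto
  have lim: "(\<lambda>d. g (fst (z (r d)))) \<longlonglongrightarrow> g (fst l)" "(\<lambda>d. g (snd (z (r d)))) \<longlonglongrightarrow> g (snd l)"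
    if g: "continuous_on torus.K g" for g :: "_ \<Rightarrow> real"
  proof -
    have 1: "(\<lambda>d. fst (z (r d))) \<longlonglongrightarrow> fst l" "(\<lambda>d. snd (z (r d))) \<longlonglongrightarrow> snd l"
      using tendsto_fst[OF r(2)] tendsto_snd[OF r(2)] by (simp_all add: o_def)
    have 2: "fst (z (r d)) \<in> torus.K" "snd (z (r d)) \<in> torus.K" for d using z(1)[of "r d"] by auto
    show "(\<lambda>d. g (fst (z (r d)))) \<longlonglongrightarrow> g (fst l)"
      using 2 by (intro continuous_on_tendsto_compose[OF g 1(1) lK(1)]) auto
    show "(\<lambda>d. g (snd (z (r d)))) \<longlonglongrightarrow> g (snd l)"
      using 2 by (intro continuous_on_tendsto_compose[OF g 1(2) lK(2)]) auto
  qed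
  have "\<phi> (fst l) m i = \<phi> (snd l) m i" if i: "i < k" for m i
  proof -
    have "\<forall>\<^sub>F d in sequentially. \<phi> (fst (z (r d))) m i = \<phi> (snd (z (r d))) m i"
      using eventually_ge_at_top[of "nat \<bar>m\<bar>"]
    proof eventually_elim
      case (elim d)
      then have "\<bar>m\<bar> \<le> int (r d)" using seq_suble[OF r(1), of d] by linarith
      then show ?case using z(2)[OF i] by blast
    qed
    then have "(\<lambda>d. \<phi> (snd (z (r d))) m i) \<longlonglongrightarrow> \<phi> (fst l) m i"
      using lim(1)[OF cont2[OF i, of m]] by (rule Lim_transform_eventually[rotated])
    then show ?thesis using lim(2)[OF cont2[OF i, of m]] LIMSEQ_unique by blast
  qed
  \<comment> \<open>Entries from \<open>k\<close> on are \<open>undefined\<close> on both sides, so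
    agreement below \<open>k\<close> is equality.\<close>
  then have "\<phi> (fst l) m = \<phi> (snd l) m" for m
    using extn[OF lK(1), of m] extn[OF lK(2), of m] by (intro extensionalityI[of _ "{..<k}"]) auto
  then have "\<phi> (fst l) = \<phi> (snd l)" by (rule ext)
  then have "fst l = snd l" using inj lK by (auto simp: inj_on_def)
  moreover have "(\<lambda>d. \<Sum>j<4 * k. \<bar>f j (fst (z (r d))) - f j (snd (z (r d)))\<bar>) \<longlonglongrightarrow> (\<Sum>j<4 * k. \<bar>f j (fst l) - f j (snd l)\<bar>)"
  proof -
    have "continuous_on torus.K (f j)" for j
      unfolding f_def[abs_def] using torus.continuous_on_ev[OF torus.regular_c[of "to_nat (int j, int (4 * k), True)"]] by simp
    then show ?thesis by (intro tendsto_intros lim)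
  qed
  then have "(\<Sum>j<4 * k. \<bar>f j (fst l) - f j (snd l)\<bar>) \<ge> 1/4"
    by (rule LIMSEQ_le_const) (use z(3) in blast)
  ultimately show False by simp
qed

theorem corollary3p4:
  shows "\<exists>(K :: (nat \<Rightarrow>\<^sub>C real) set) S.
    affine_system K S \<and>
    (\<exists>p. {x\<in>K. \<exists>n\<ge>1. (S ^^ n) x = x} = {p} \<and> S p = p) \<and>
    topological_entropy (top_of_set K) S = 0 \<and>
    mean_dim (top_of_set K) S = 0 \<and>
    (\<forall>n\<ge>1. covering_dim (top_of_set {x\<in>K. (S ^^ n) x = x}) = 0) \<and>
    (\<forall>k\<ge>1. \<not> embeds_affinely K S k)"
proof -
  let ?K = "torus.K" and ?S = "torus.push skew"
  obtain p where p: "p \<in> ?K" "?S p = p" "\<And>q n. q \<in> ?K \<Longrightarrow> n \<ge> 1 \<Longrightarrow> (?S ^^ n) q = q \<Longrightarrow> q = p"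
    using unique_periodic_point by blast
  have per: "(?S ^^ n) p = p" for n by (rule fixed_funpow[OF p(1,2)])
  show ?thesis
  proof (intro exI conjI allI impI)
    show "affine_system ?K ?S"
      using torus.affine_system_push[OF self_map_skew self_map_skew_inv] skew_inv_skew skew_skew_inv by blast
    show "{x\<in>?K. \<exists>n\<ge>1. (?S ^^ n) x = x} = {p}" using p(1,3) per by blast
    show "?S p = p" by (rule p(2))
    show "topological_entropy (top_of_set ?K) ?S = 0"
      by (rule topological_entropy_eq_0[OF torus.compact_K torus.K_ne push_skew_Pi subexponential_covers_skew])
    show "mean_dim (top_of_set ?K) ?S = 0"
      by (rule mean_dim_eq_0[OF torus.compact_K torus.K_ne push_skew_Pi
            torus.push_continuous[OF self_map_skew] subexponential_covers_skew])
    show "covering_dim (top_of_set {x\<in>?K. (?S ^^ n) x = x}) = 0" if "n \<ge> 1" for n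
    proof -
      have "{x\<in>?K. (?S ^^ n) x = x} = {p}" using p(1) p(3)[OF _ that] per by blast
      then show ?thesis by (simp add: covering_dim_singleton)
    qed
    show "\<not> embeds_affinely ?K ?S k" if "k \<ge> 1" for k using that by (rule not_embeds_affinely_skew)
  qed
qed

end
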